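(* Let $d\ge 1$. There is a constant $c_d$ depending only on the dimension $d$ such that the following holds. Let $\sigma=\{\sigma_I\}_{I\in\mathcal D}$ be a sequence, indexed by the dyadic cubes of $\mathbb R^d$, of $(2^d-1)\times(2^d-1)$ diagonal matrices with diagonal entries $\sigma_{I,\alpha}$, $\alpha\in\Gamma_d$, with $\|\sigma\|_\infty=\sup_{I\in\mathcal D}\sup_{\alpha\in\Gamma_d}|\sigma_{I,\alpha}|<\infty$, and let $T_\sigma f=\sum_{\alpha\in\Gamma_d}\sum_{I\in\mathcal D}\sigma_{I,\alpha}\widehat f(I,\alpha)h_I^\alpha$ for $f\in L^2$. Let $w$ be an $A_2$ weight on $\mathbb R^d$. Then each of the nine operators $$Q_{T_\sigma,w}^{(\varepsilon_1,\varepsilon_2),(\varepsilon_3,\varepsilon_4)}=\mathsf P^{(\varepsilon_1,\varepsilon_2)}_{w^{1/2}}\,T_\sigma\,\mathsf P^{(\varepsilon_3,\varepsilon_4)}_{w^{-1/2}},\qquad (\varepsilon_1,\varepsilon_2),(\varepsilon_3,\varepsilon_4)\in\{(0,1),(1,0),(0,0)\},$$ (where the operators $\mathsf P^{(\varepsilon,\varepsilon')}_{w^{\pm 1/2}}$ are the three canonical paraproducts of $w^{\pm1/2}$ defined in the context) is bounded on $L^2$ and satisfies $$\left\|Q_{T_\sigma,w}^{(\varepsilon_1,\varepsilon_2),(\varepsilon_3,\varepsilon_4)}\right\|_{L^2\to L^2}\le c_d\,[w]_{A_2}\,\|\sigma\|_\infty .$$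
   Context: $L^2=L^2(\mathbb R^d)$ with Lebesgue measure; $|E|$ is Lebesgue measure; $\langle f\rangle_E=\frac1{|E|}\int_E f$. A weight is a positive locally integrable function $w$ on $\mathbb R^d$; it is an $A_2$ weight if $[w]_{A_2}=\sup_I\langle w\rangle_I\langle w^{-1}\rangle_I<\infty$, the supremum being over cubes $I$. $\mathcal D$ is the usual dyadic grid of cubes in $\mathbb R^d$; $\mathcal C_1(I)$ is the set of the $2^d$ dyadic children of $I\in\mathcal D$; $\Gamma_d=\{0,1\}^d\setminus\{(1,\dots,1)\}$, a set of $2^d-1$ indices. Wilson's Haar system. For each $I\in\mathcal D$ fix pairs of sets $\{(E^1_{\alpha,I},E^2_{\alpha,I})\}_{\alpha\in\Gamma_d}$ such that: (i) $|E^1_{\alpha,I}|=|E^2_{\alpha,I}|$; (ii) each $E^s_{\alpha,I}$ ($s=1,2$) is a non-empty union of cubes from $\mathcal C_1(I)$; (iii) $E^1_{\alpha,I}\cap E^2_{\alpha,I}=\emptyset$; (iv) writing $E_{\alpha,I}=E^1_{\alpha,I}\cup E^2_{\alpha,I}$, for all $\alpha\ne\beta$ either $E_{\alpha,I}$ is contained in $E^1_{\beta,I}$ or in $E^2_{\beta,I}$, or $E_{\beta,I}$ is contained in $E^1_{\alpha,I}$ or in $E^2_{\alpha,I}$, or $E_{\alpha,I}\cap E_{\beta,I}=\emptyset$. (Such families exist.) Put $$h_I^\alpha=|E_{\alpha,I}|^{-1/2}\left(\mathbf 1_{E^2_{\alpha,I}}-\mathbf 1_{E^1_{\alpha,I}}\right),\qquad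 h^1_{E}=\frac{\mathbf 1_E}{|E|},\qquad \widehat f(I,\alpha)=\int f\,h_I^\alpha .$$ The family $\{h_I^\alpha\}_{I\in\mathcal D,\alpha\in\Gamma_d}$ is an orthonormal basis of $L^2$. Paraproducts. For a sequence of numbers $a=\{a_{I,\alpha}\}_{I\in\mathcal D,\alpha\in\Gamma_d}$ define $$\mathsf P_a^{(0,0)}f=\sum_{\alpha,I}a_{I,\alpha}\widehat f(I,\alpha)h_I^\alpha,\quad \mathsf P_a^{(0,1)}f=\sum_{\alpha,I}a_{I,\alpha}\langle f\rangle_{E_{\alpha,I}}h_I^\alpha,\quad \mathsf P_a^{(1,0)}f=\sum_{\alpha,I}a_{I,\alpha}\widehat f(I,\alpha)h^1_{E_{\alpha,I}} .$$ For $g=w^{1/2}$ or $g=w^{-1/2}$ set $$\mathsf P_g^{(0,0)}:=\mathsf P^{(0,0)}_{a}\text{ with }a_{I,\alpha}=\langle g\rangle_{E_{\alpha,I}},\quad \mathsf P_g^{(0,1)}:=\mathsf P^{(0,1)}_{a},\ \ \mathsf P_g^{(1,0)}:=\mathsf P^{(1,0)}_{a}\text{ with }a_{I,\alpha}=\widehat g(I,\alpha).$$ Formally, multiplication by $g$ is $M_g=\mathsf P_g^{(0,1)}+\mathsf P_g^{(1,0)}+\mathsf P_g^{(0,0)}$, so that $M_{w^{1/2}}T_\sigma M_{w^{-1/2}}$ is the sum of the nine operators $Q_{T_\sigma,w}^{(\varepsilon_1,\varepsilon_2),(\varepsilon_3,\varepsilon_4)}$. Meaning of the compositions. The formal adjoint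 of $\mathsf P_g^{(0,1)}$ is $\mathsf P_g^{(1,0)}$ and vice versa, while $\mathsf P_g^{(0,0)}$ is formally self-adjoint; each of the three operators maps finite linear combinations of Haar functions $h_I^\alpha$ into $L^2$. The operator $Q=\mathsf P^{(\varepsilon_1,\varepsilon_2)}_{w^{1/2}}T_\sigma\mathsf P^{(\varepsilon_3,\varepsilon_4)}_{w^{-1/2}}$ is understood through the form $$\langle Q\phi,\psi\rangle_{L^2}=\left\langle T_\sigma\mathsf P^{(\varepsilon_3,\varepsilon_4)}_{w^{-1/2}}\phi,\ \mathsf P^{(\varepsilon_2,\varepsilon_1)}_{w^{1/2}}\psi\right\rangle_{L^2}$$ for $\phi,\psi$ finite linear combinations of Haar functions, and the norm bound means $|\langle Q\phi,\psi\rangle_{L^2}|\le c_d[w]_{A_2}\|\sigma\|_\infty\|\phi\|_{L^2}\|\psi\|_{L^2}$ for all such $\phi,\psi$ (equivalently, $Q$ extends to a bounded operator on $L^2$ with that norm bound). *)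

theory Defs
  imports "HOL-Analysis.Analysis"
begin

section \<open>The space \<open>L\<^sup>2\<close> and unconditional sums in it\<close>

text \<open>
  Functions are complex valued and are not identified when they agree almost everywhere;
  every quantity below built from \<open>L2_norm\<close> and \<open>L2_inner\<close> only depends on the class.
\<close>

definition L2 :: "((real^'n) \<Rightarrow> complex) set" where
  "L2 = {f. f \<in> borel_measurable lebesgue \<and> integrable lebesgue (\<lambda>x. (cmod (f x))\<^sup>2)}"

definition L2_norm :: "((real^'n) \<Rightarrow> complex) \<Rightarrow> real" where
  "L2_norm f = sqrt (LINT x|lebesgue. (cmod (f x))\<^sup>2)"

definition L2_inner :: "((real^'n) \<Rightarrow> complex) \<Rightarrow> ((real^'n) \<Rightarrow> complex) \<Rightarrow> complex" where
  "L2_inner f g = (LINT x|lebesgue. f x * cnj (g x))"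

definition L2_has_sum ::
  "('i \<Rightarrow> (real^'n) \<Rightarrow> complex) \<Rightarrow> 'i set \<Rightarrow> ((real^'n) \<Rightarrow> complex) \<Rightarrow> bool" where
  "L2_has_sum F A g \<longleftrightarrow> (\<forall>i\<in>A. F i \<in> L2) \<and> g \<in> L2 \<and>
     ((\<lambda>S. L2_norm (\<lambda>x. (\<Sum>i\<in>S. F i x) - g x)) \<longlongrightarrow> 0) (finite_subsets_at_top A)"

text \<open>
  A representative of the sum, which is unique up to null sets by \<open>L2_has_sum_unique\<close> below;
  unspecified if the family is not summable in \<open>L\<^sup>2\<close>.
\<close>

definition L2_sum :: "('i \<Rightarrow> (real^'n) \<Rightarrow> complex) \<Rightarrow> 'i set \<Rightarrow> (real^'n) \<Rightarrow> complex" where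
  "L2_sum F A = (SOME g. L2_has_sum F A g)"

lemma L2_add_bound:
  assumes "f \<in> L2" "g \<in> L2"
  shows "(\<lambda>x. f x + g x) \<in> L2"
    and "(L2_norm (\<lambda>x. f x + g x))\<^sup>2 \<le> 2 * (L2_norm f)\<^sup>2 + 2 * (L2_norm g)\<^sup>2"
proof -
  have m: "f \<in> borel_measurable lebesgue" "g \<in> borel_measurable lebesgue"
    and i: "integrable lebesgue (\<lambda>x. (cmod (f x))\<^sup>2)" "integrable lebesgue (\<lambda>x. (cmod (g x))\<^sup>2)"
    using assms by (auto simp: L2_def)
  have b: "(cmod (f x + g x))\<^sup>2 \<le> 2 * (cmod (f x))\<^sup>2 + 2 * (cmod (g x))\<^sup>2" for x
  proof -
    have "(cmod (f x + g x))\<^sup>2 \<le> (cmod (f x) + cmod (g x))\<^sup>2"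
      by (intro power_mono norm_triangle_ineq) auto
    also have "\<dots> \<le> 2 * (cmod (f x))\<^sup>2 + 2 * (cmod (g x))\<^sup>2"
      using sum_squares_bound[of "cmod (f x)" "cmod (g x)"] by (simp add: power2_sum)
    finally show ?thesis .
  qed
  have i2: "integrable lebesgue (\<lambda>x. 2 * (cmod (f x))\<^sup>2 + 2 * (cmod (g x))\<^sup>2)"
    using i by auto
  have i3: "integrable lebesgue (\<lambda>x. (cmod (f x + g x))\<^sup>2)"
    by (rule Bochner_Integration.integrable_bound[OF i2]) (use m b in auto)
  then show "(\<lambda>x. f x + g x) \<in> L2" using m by (auto simp: L2_def)
  have "(LINT x|lebesgue. (cmod (f x + g x))\<^sup>2)
          \<le> (LINT x|lebesgue. 2 * (cmod (f x))\<^sup>2 + 2 * (cmod (g x))\<^sup>2)"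
    by (rule integral_mono[OF i3 i2 b])
  also have "\<dots> = 2 * (LINT x|lebesgue. (cmod (f x))\<^sup>2) + 2 * (LINT x|lebesgue. (cmod (g x))\<^sup>2)"
    using i by simp
  finally show "(L2_norm (\<lambda>x. f x + g x))\<^sup>2 \<le> 2 * (L2_norm f)\<^sup>2 + 2 * (L2_norm g)\<^sup>2"
    by (simp add: L2_norm_def)
qed

lemma L2_uminus: "f \<in> L2 \<Longrightarrow> (\<lambda>x. - f x) \<in> L2"
  by (auto simp: L2_def)

lemma L2_setsum:
  assumes "finite S" "\<And>i. i \<in> S \<Longrightarrow> F i \<in> L2"
  shows "(\<lambda>x. \<Sum>i\<in>S. F i x) \<in> L2"
  using assms
proof (induction S rule: finite_induct)
  case empty
  then show ?case by (simp add: L2_def)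
next
  case (insert i S)
  then show ?case using L2_add_bound(1)[of "F i" "\<lambda>x. \<Sum>i\<in>S. F i x"] by simp
qed

lemma L2_has_sum_unique:
  assumes g: "L2_has_sum F A g" and h: "L2_has_sum F A h"
  shows "AE x in lebesgue. g x = h x"
proof -
  let ?N = "\<lambda>S g. L2_norm (\<lambda>x. (\<Sum>i\<in>S. F i x) - g x)"
  let ?d = "\<lambda>x. g x - h x"
  have L: "g \<in> L2" "h \<in> L2" "\<And>i. i \<in> A \<Longrightarrow> F i \<in> L2"
    using g h by (auto simp: L2_has_sum_def)
  have bd: "(L2_norm ?d)\<^sup>2 \<le> 2 * (?N S h)\<^sup>2 + 2 * (?N S g)\<^sup>2" if S: "finite S" "S \<subseteq> A" for S
  proof -
    have s: "(\<lambda>x. \<Sum>i\<in>S. F i x) \<in> L2" using S L(3) by (intro L2_setsum) auto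
    have a: "(\<lambda>x. (\<Sum>i\<in>S. F i x) - h x) \<in> L2" "(\<lambda>x. - ((\<Sum>i\<in>S. F i x) - g x)) \<in> L2"
      using L2_add_bound(1)[OF s L2_uminus[OF L(2)]]
        L2_uminus[OF L2_add_bound(1)[OF s L2_uminus[OF L(1)]]] by simp_all
    have n: "L2_norm (\<lambda>x. - ((\<Sum>i\<in>S. F i x) - g x)) = ?N S g"
      by (simp add: L2_norm_def norm_minus_commute)
    show ?thesis using L2_add_bound(2)[OF a] unfolding n by simp
  qed
  have "((\<lambda>S. 2 * (?N S h)\<^sup>2 + 2 * (?N S g)\<^sup>2) \<longlongrightarrow> 2 * 0\<^sup>2 + 2 * 0\<^sup>2) (finite_subsets_at_top A)"
    using g h by (intro tendsto_intros) (auto simp: L2_has_sum_def)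
  moreover have "eventually (\<lambda>S. (L2_norm ?d)\<^sup>2 \<le> 2 * (?N S h)\<^sup>2 + 2 * (?N S g)\<^sup>2)
      (finite_subsets_at_top A)"
    using bd by (intro eventually_finite_subsets_at_top_weakI) auto
  ultimately have "(L2_norm ?d)\<^sup>2 \<le> 2 * 0\<^sup>2 + 2 * 0\<^sup>2"
    by (intro tendsto_lowerbound[OF _ _ finite_subsets_at_top_neq_bot])
  then have "(LINT x|lebesgue. (cmod (?d x))\<^sup>2) = 0"
    by (intro antisym) (simp_all add: L2_norm_def)
  moreover have "integrable lebesgue (\<lambda>x. (cmod (?d x))\<^sup>2)"
    using L2_add_bound(1)[OF L(1) L2_uminus[OF L(2)]] by (simp add: L2_def)
  ultimately have "AE x in lebesgue. (cmod (?d x))\<^sup>2 = 0"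
    by (subst (asm) integral_nonneg_eq_0_iff_AE) auto
  then show ?thesis by eventually_elim simp
qed

section \<open>Averages and \<open>A\<^sub>2\<close> weights\<close>

definition average :: "(real^'n) set \<Rightarrow> ((real^'n) \<Rightarrow> complex) \<Rightarrow> complex" where
  "average E f = (LINT x:E|lebesgue. f x) / of_real (measure lebesgue E)"

definition cubes :: "(real^'n) set set" where
  "cubes = {cbox a (\<chi> i. a $ i + l) | a l. 0 < l}"

definition locally_integrable :: "((real^'n) \<Rightarrow> real) \<Rightarrow> bool" where
  "locally_integrable f \<longleftrightarrow>
     f \<in> borel_measurable lebesgue \<and> (\<forall>K. compact K \<longrightarrow> set_integrable lebesgue K f)"

definition weight :: "((real^'n) \<Rightarrow> real) \<Rightarrow> bool" where
  "weight w \<longleftrightarrow> (\<forall>x. 0 < w x) \<and> locally_integrable w"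

text \<open>
  The averages in the \<open>A\<^sub>2\<close> characteristic are taken in \<^typ>\<open>ennreal\<close>, so that a reciprocal
  with infinite integral makes the characteristic infinite.
\<close>

definition nn_average :: "(real^'n) set \<Rightarrow> ((real^'n) \<Rightarrow> real) \<Rightarrow> ennreal" where
  "nn_average E f = (\<integral>\<^sup>+x\<in>E. ennreal (f x) \<partial>lebesgue) / emeasure lebesgue E"

definition A2_char :: "((real^'n) \<Rightarrow> real) \<Rightarrow> ennreal" where
  "A2_char w = (SUP I\<in>cubes. nn_average I w * nn_average I (\<lambda>x. inverse (w x)))"

definition A2_weight :: "((real^'n) \<Rightarrow> real) \<Rightarrow> bool" where
  "A2_weight w \<longleftrightarrow> weight w \<and> A2_char w < \<infinity>"

section \<open>Dyadic cubes and Wilson's Haar system\<close>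

definition dyadic_cube :: "int \<Rightarrow> ('n \<Rightarrow> int) \<Rightarrow> (real^'n) set" where
  "dyadic_cube k m =
     {x. \<forall>i. 2 powi k * of_int (m i) \<le> x $ i \<and> x $ i < 2 powi k * (of_int (m i) + 1)}"

definition dyadic_grid :: "(real^'n) set set" where
  "dyadic_grid = {dyadic_cube k m | k m. True}"

definition children :: "(real^'n) set \<Rightarrow> (real^'n) set set" where
  "children I =
     {J. \<exists>k m m'. I = dyadic_cube k m \<and> J = dyadic_cube (k - 1) m' \<and> J \<subseteq> I}"

text \<open>The points of \<open>{0,1}\<^sup>d\<close> are functions from the coordinates to \<^typ>\<open>bool\<close>.\<close>

definition Gamma :: "('n \<Rightarrow> bool) set" where
  "Gamma = UNIV - {\<lambda>_. True}"

text \<open>\<open>E s \<alpha> I\<close> stands for \<open>E\<^sup>s\<^sub>\<alpha>\<^sub>,\<^sub>I\<close>; only \<open>s = 1\<close> and \<open>s = 2\<close> are used.\<close>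

type_synonym 'n haar_sets = "nat \<Rightarrow> ('n \<Rightarrow> bool) \<Rightarrow> (real^'n) set \<Rightarrow> (real^'n) set"

definition haar_supp :: "'n haar_sets \<Rightarrow> ('n \<Rightarrow> bool) \<Rightarrow> (real^'n) set \<Rightarrow> (real^'n) set" where
  "haar_supp E \<alpha> I = E 1 \<alpha> I \<union> E 2 \<alpha> I"

definition wilson_system :: "'n::finite haar_sets \<Rightarrow> bool" where
  "wilson_system E \<longleftrightarrow> (\<forall>I\<in>dyadic_grid.
     (\<forall>\<alpha>\<in>Gamma. measure lebesgue (E 1 \<alpha> I) = measure lebesgue (E 2 \<alpha> I)) \<and>
     (\<forall>\<alpha>\<in>Gamma. \<forall>s\<in>{1, 2}. \<exists>C. C \<subseteq> children I \<and> C \<noteq> {} \<and> E s \<alpha> I = \<Union>C) \<and>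
     (\<forall>\<alpha>\<in>Gamma. E 1 \<alpha> I \<inter> E 2 \<alpha> I = {}) \<and>
     (\<forall>\<alpha>\<in>Gamma. \<forall>\<beta>\<in>Gamma. \<alpha> \<noteq> \<beta> \<longrightarrow>
        haar_supp E \<alpha> I \<subseteq> E 1 \<beta> I \<or> haar_supp E \<alpha> I \<subseteq> E 2 \<beta> I \<or>
        haar_supp E \<beta> I \<subseteq> E 1 \<alpha> I \<or> haar_supp E \<beta> I \<subseteq> E 2 \<alpha> I \<or>
        haar_supp E \<alpha> I \<inter> haar_supp E \<beta> I = {}))"

definition haar ::
  "'n::finite haar_sets \<Rightarrow> (real^'n) set \<Rightarrow> ('n \<Rightarrow> bool) \<Rightarrow> (real^'n) \<Rightarrow> complex" where
  "haar E I \<alpha> x = of_real (measure lebesgue (haar_supp E \<alpha> I) powr (- 1/2) *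
     (indicator (E 2 \<alpha> I) x - indicator (E 1 \<alpha> I) x))"

definition haar1 :: "(real^'n) set \<Rightarrow> (real^'n) \<Rightarrow> complex" where
  "haar1 A x = of_real (indicator A x / measure lebesgue A)"

definition haar_coeff :: "'n::finite haar_sets \<Rightarrow> ((real^'n) \<Rightarrow> complex) \<Rightarrow>
    (real^'n) set \<Rightarrow> ('n \<Rightarrow> bool) \<Rightarrow> complex" where
  "haar_coeff E f I \<alpha> = (LINT x|lebesgue. f x * haar E I \<alpha> x)"

definition haar_polys :: "'n::finite haar_sets \<Rightarrow> ((real^'n) \<Rightarrow> complex) set" where
  "haar_polys E = {\<lambda>x. \<Sum>(I, \<alpha>)\<in>S. c I \<alpha> * haar E I \<alpha> x | S c.
     finite S \<and> S \<subseteq> dyadic_grid \<times> Gamma}"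

section \<open>Haar multipliers and paraproducts\<close>

definition haar_multiplier :: "'n::finite haar_sets \<Rightarrow> ((real^'n) set \<Rightarrow> ('n \<Rightarrow> bool) \<Rightarrow> complex) \<Rightarrow>
    ((real^'n) \<Rightarrow> complex) \<Rightarrow> (real^'n) \<Rightarrow> complex" where
  "haar_multiplier E \<sigma> f =
     L2_sum (\<lambda>(I, \<alpha>) x. \<sigma> I \<alpha> * haar_coeff E f I \<alpha> * haar E I \<alpha> x) (dyadic_grid \<times> Gamma)"

definition symbol_bounded :: "((real^'n) set \<Rightarrow> ('n \<Rightarrow> bool) \<Rightarrow> complex) \<Rightarrow> bool" where
  "symbol_bounded \<sigma> \<longleftrightarrow> bdd_above ((\<lambda>(I, \<alpha>). cmod (\<sigma> I \<alpha>)) ` (dyadic_grid \<times> Gamma))"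

definition symbol_norm :: "((real^'n) set \<Rightarrow> ('n \<Rightarrow> bool) \<Rightarrow> complex) \<Rightarrow> real" where
  "symbol_norm \<sigma> = (SUP (I, \<alpha>)\<in>dyadic_grid \<times> Gamma. cmod (\<sigma> I \<alpha>))"

definition para00 :: "'n::finite haar_sets \<Rightarrow> ((real^'n) set \<Rightarrow> ('n \<Rightarrow> bool) \<Rightarrow> complex) \<Rightarrow>
    ((real^'n) \<Rightarrow> complex) \<Rightarrow> (real^'n) \<Rightarrow> complex" where
  "para00 E a f =
     L2_sum (\<lambda>(I, \<alpha>) x. a I \<alpha> * haar_coeff E f I \<alpha> * haar E I \<alpha> x) (dyadic_grid \<times> Gamma)"

definition para01 :: "'n::finite haar_sets \<Rightarrow> ((real^'n) set \<Rightarrow> ('n \<Rightarrow> bool) \<Rightarrow> complex) \<Rightarrow>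
    ((real^'n) \<Rightarrow> complex) \<Rightarrow> (real^'n) \<Rightarrow> complex" where
  "para01 E a f =
     L2_sum (\<lambda>(I, \<alpha>) x. a I \<alpha> * average (haar_supp E \<alpha> I) f * haar E I \<alpha> x)
       (dyadic_grid \<times> Gamma)"

definition para10 :: "'n::finite haar_sets \<Rightarrow> ((real^'n) set \<Rightarrow> ('n \<Rightarrow> bool) \<Rightarrow> complex) \<Rightarrow>
    ((real^'n) \<Rightarrow> complex) \<Rightarrow> (real^'n) \<Rightarrow> complex" where
  "para10 E a f =
     L2_sum (\<lambda>(I, \<alpha>) x. a I \<alpha> * haar_coeff E f I \<alpha> * haar1 (haar_supp E \<alpha> I) x)
       (dyadic_grid \<times> Gamma)"

definition para_types :: "(nat \<times> nat) set" where
  "para_types = {(0, 1), (1, 0), (0, 0)}"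

text \<open>The paraproduct of type \<open>e \<in> para_types\<close> of the function \<open>g\<close>.\<close>

definition para :: "'n::finite haar_sets \<Rightarrow> nat \<times> nat \<Rightarrow> ((real^'n) \<Rightarrow> real) \<Rightarrow>
    ((real^'n) \<Rightarrow> complex) \<Rightarrow> (real^'n) \<Rightarrow> complex" where
  "para E e g =
     (if e = (0, 0) then para00 E (\<lambda>I \<alpha>. average (haar_supp E \<alpha> I) (\<lambda>x. of_real (g x)))
      else if e = (0, 1) then para01 E (haar_coeff E (\<lambda>x. of_real (g x)))
      else if e = (1, 0) then para10 E (haar_coeff E (\<lambda>x. of_real (g x)))
      else undefined)"

text \<open>
  The sesquilinear form of \<open>P\<^sup>e\<close> (of the square root of \<open>w\<close>) after the Haar multiplier after
  \<open>P\<^sup>e\<^sup>'\<close> (of the reciprocal square root of \<open>w\<close>): the outer paraproduct is moved to \<open>\<psi>\<close>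
  as its formal adjoint, which has the two entries of \<open>e\<close> swapped.
\<close>

definition Q_form :: "'n::finite haar_sets \<Rightarrow> ((real^'n) set \<Rightarrow> ('n \<Rightarrow> bool) \<Rightarrow> complex) \<Rightarrow>
    ((real^'n) \<Rightarrow> real) \<Rightarrow> nat \<times> nat \<Rightarrow> nat \<times> nat \<Rightarrow>
    ((real^'n) \<Rightarrow> complex) \<Rightarrow> ((real^'n) \<Rightarrow> complex) \<Rightarrow> complex" where
  "Q_form E \<sigma> w e e' \<phi> \<psi> =
     L2_inner (haar_multiplier E \<sigma> (para E e' (\<lambda>x. w x powr (- 1/2)) \<phi>))
              (para E (prod.swap e) (\<lambda>x. w x powr (1/2)) \<psi>)"

end

theory Submission
  imports Defs
begin

text \<open>
  Write \<open>h = w\<^sup>-\<^sup>1\<^sup>/\<^sup>2\<close>, \<open>g = w\<^sup>1\<^sup>/\<^sup>2\<close>, and let \<open>k\<close> run over the pairs \<open>(I, \<alpha>)\<close>. Since the Haar functions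
  are orthonormal, the form is the sum of \<open>\<sigma>\<^sub>k A\<^sub>k cnj B\<^sub>k\<close>, where \<open>A\<^sub>k\<close>, \<open>B\<^sub>k\<close> are the Haar coefficients
  of a paraproduct of \<open>h\<close> applied to \<open>\<phi>\<close> and of one of \<open>g\<close> applied to \<open>\<psi>\<close>. The coefficients of the
  three paraproducts of \<open>h\<close> add up to those of \<open>h \<phi>\<close>, so all of them are dominated by one sum of
  three terms (\<open>dominant\<close>): a local term, which is square summable by Bessel inequalities for
  \<open>dx\<close> and for \<open>h\<^sup>2 dx\<close> and carries the factor \<open>\<langle>h\<^sup>2\<rangle>\<^sup>1\<^sup>/\<^sup>2\<close>; a term \<open>carl\<close> with the relative jump
  of \<open>h\<^sup>2\<close> and the \<open>h\<^sup>2\<close>-weighted average of \<open>\<phi> / h\<close>; and a term \<open>osc\<close> with the relative jump of \<open>h\<close>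
  and the average of \<open>\<phi>\<close>. Pairing the three terms for \<open>h\<close> with the three for \<open>g\<close> gives nine sums, bounded
  by Cauchy--Schwarz and Carleson embedding. The Carleson sequences come from the Bellman functions
  \<open>(\<langle>h\<^sup>2\<rangle>\<langle>g\<^sup>2\<rangle>)\<^sup>1\<^sup>/\<^sup>4\<close> and \<open>\<langle>h\<rangle>\<^sup>1\<^sup>/\<^sup>4 \<langle>g\<^sup>2\<rangle>\<^sup>1\<^sup>/\<^sup>8\<close>, and the maximal functions from weighted Carleson embedding
  on disjoint sets. Multiplied by Lebesgue measure, the Bellman functions are superadditive functions of an
  arbitrary set, so only the laminar structure of the supports is used, and no regularity of the grid.
\<close>

section \<open>Local integrability and the Cauchy--Schwarz inequality\<close>

text \<open>The paraproduct of type \<open>(1, 0)\<close> is nonlocal: its Haar coefficient at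
  \<open>k\<close> collects all indices below \<open>k\<close>. It is never estimated directly. The
  coefficient of the full product and those of the other two paraproducts are bounded, and the third
  is obtained as a difference; this is why all three types share one majorant.

  The linear power of the characteristic depends on how the weights are shared out in each pair.
  Concavity only admits small powers of the product of the two means, but a Carleson sequence with a
  small power can be raised to a larger one at the price of the pointwise bound, so no power of
  \<open>Q\<close> is lost. In a mixed pair the two square sums grow like \<open>Q^(3/2)\<close> and
  \<open>Q^(1/2)\<close> under reciprocal weights, hence like \<open>Q\<close> after
  Cauchy--Schwarz. For two terms \<open>carl\<close> no such splitting is available; there the jumps
  are multiplied with each other, and the two weighted maximal functions are multiplied using
  \<open>h g = 1\<close>.

  All estimates are for finite index sets with constants independent of the set; the limit is taken
  once, at the level of the form.\<close>

abbreviation vol :: "(real^'n) set \<Rightarrow> real" where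
  "vol \<equiv> measure lebesgue"

abbreviation sq :: "((real^'n) \<Rightarrow> real) \<Rightarrow> (real^'n) \<Rightarrow> real" where
  "sq f \<equiv> (\<lambda>x. (f x)\<^sup>2)"

text \<open>These sets are closed under union and difference, and a locally integrable function has
  a finite integral over each of them. The Bellman induction needs remainders such as
  \<open>A - U k\<close>, which need not come from a grid.\<close>

definition bsets :: "(real^'n) set set" where
  "bsets = {A. A \<in> sets lebesgue \<and> bounded A}"

lemma bsets_Un: "A \<in> bsets \<Longrightarrow> B \<in> bsets \<Longrightarrow> A \<union> B \<in> bsets"
  by (auto simp: bsets_def)

lemma bsets_UN: "finite T \<Longrightarrow> (\<And>k. k \<in> T \<Longrightarrow> U k \<in> bsets) \<Longrightarrow> (\<Union>k\<in>T. U k) \<in> bsets"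
  by (auto simp: bsets_def)

lemma bsets_Diff: "A \<in> bsets \<Longrightarrow> B \<in> bsets \<Longrightarrow> A - B \<in> bsets"
  by (auto simp: bsets_def intro: bounded_subset)

lemma bsets_sets: "A \<in> bsets \<Longrightarrow> A \<in> sets lebesgue"
  by (auto simp: bsets_def)

lemma bsets_lmeasurable: "A \<in> bsets \<Longrightarrow> A \<in> lmeasurable"
  by (simp add: bsets_def bounded_set_imp_lmeasurable)

lemma locally_integrable_set:
  assumes "locally_integrable f" "A \<in> bsets"
  shows "set_integrable lebesgue A f"
proof -
  have "compact (closure A)" using assms by (auto simp: bsets_def)
  then have "set_integrable lebesgue (closure A) f"
    using assms by (auto simp: locally_integrable_def)
  then show ?thesis
    by (rule set_integrable_subset) (use assms closure_subset in \<open>auto simp: bsets_def\<close>)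
qed

lemma locally_integrable_bound:
  assumes "locally_integrable f" "g \<in> borel_measurable lebesgue" "\<And>x. \<bar>g x\<bar> \<le> \<bar>f x\<bar>"
  shows "locally_integrable g"
  unfolding locally_integrable_def
proof (intro conjI allI impI)
  fix K :: "(real^'a) set" assume K: "compact K"
  have f: "set_integrable lebesgue K f" using assms K by (auto simp: locally_integrable_def)
  have "K \<in> sets lebesgue" using K by (simp add: compact_imp_closed)
  with assms(2) have "set_borel_measurable lebesgue K g"
    by (auto simp: set_borel_measurable_def)
  from set_integrable_bound[OF f this] show "set_integrable lebesgue K g" using assms(3) by simp
qed fact

lemma locally_integrable_add:
  "locally_integrable f \<Longrightarrow> locally_integrable g \<Longrightarrow> locally_integrable (\<lambda>x. f x + g x)"
  by (auto simp: locally_integrable_def intro: set_integral_add)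

lemma locally_integrable_cmult:
  "locally_integrable f \<Longrightarrow> locally_integrable (\<lambda>x. c * f x)"
  by (auto simp: locally_integrable_def)

lemma locally_integrable_const: "locally_integrable (\<lambda>x. c)"
  unfolding locally_integrable_def set_integrable_def
proof (intro conjI allI impI)
  fix K :: "(real^'a) set" assume "compact K"
  then have "integrable lebesgue (indicator K :: _ \<Rightarrow> real)"
    using lmeasurable_compact lmeasurable_iff_integrable by blast
  then show "integrable lebesgue (\<lambda>x. indicat_real K x *\<^sub>R c)" by simp
qed simp

abbreviation mass :: "((real^'n) \<Rightarrow> real) \<Rightarrow> (real^'n) set \<Rightarrow> real" where
  "mass f A \<equiv> (LINT x:A|lebesgue. f x)"

lemma mass_Un:
  assumes "locally_integrable f" "A \<in> bsets" "B \<in> bsets" "A \<inter> B = {}"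
  shows "mass f (A \<union> B) = mass f A + mass f B"
  using assms by (intro set_integral_Un locally_integrable_set)

lemma mass_nonneg: "(\<And>x. x \<in> A \<Longrightarrow> 0 \<le> f x) \<Longrightarrow> 0 \<le> mass f A"
  unfolding set_lebesgue_integral_def
  by (intro Bochner_Integration.integral_nonneg) (auto simp: indicator_def)

lemma mass_mono:
  assumes "locally_integrable f" "locally_integrable g" "A \<in> bsets" "\<And>x. x \<in> A \<Longrightarrow> f x \<le> g x"
  shows "mass f A \<le> mass g A"
  using assms by (intro set_integral_mono locally_integrable_set)

lemma mass_mono_set:
  assumes "locally_integrable f" "A \<in> bsets" "B \<in> bsets" "A \<subseteq> B" "\<And>x. x \<in> B \<Longrightarrow> 0 \<le> f x"
  shows "mass f A \<le> mass f B"
proof -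
  have "mass f B = mass f A + mass f (B - A)"
    using mass_Un[OF assms(1,2), of "B - A"] assms by (auto simp: bsets_Diff Un_absorb1)
  then show ?thesis using mass_nonneg[of "B - A" f] assms(5) by simp
qed

lemma mass_const: "A \<in> bsets \<Longrightarrow> mass (\<lambda>x. c) A = c * vol A"
  using bsets_lmeasurable[of A] by (simp add: set_lebesgue_integral_def bsets_sets)

lemma mass_add:
  "locally_integrable f \<Longrightarrow> locally_integrable g \<Longrightarrow> A \<in> bsets \<Longrightarrow>
    mass (\<lambda>x. f x + g x) A = mass f A + mass g A"
  by (intro set_integral_add locally_integrable_set)

lemma mass_pos:
  assumes "locally_integrable f" "A \<in> bsets" "\<And>x. 0 < f x" "vol A > 0"
  shows "0 < mass f A"
proof -
  have "mass f A \<noteq> 0"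
  proof
    assume "mass f A = 0"
    then have "AE x in lebesgue. indicator A x *\<^sub>R f x = 0"
      unfolding set_lebesgue_integral_def
      by (subst (asm) integral_nonneg_eq_0_iff_AE)
        (use assms less_imp_le locally_integrable_set[OF assms(1,2)] in
          \<open>auto simp: set_integrable_def indicator_def\<close>)
    then have "AE x in lebesgue. x \<notin> A"
      by eventually_elim (use assms(3) in \<open>auto simp: indicator_def less_le split: if_splits\<close>)
    then have "A \<in> null_sets lebesgue"
      using assms(2) AE_iff_null_sets bsets_sets by blast
    then show False using assms(4) by (simp add: measure_def null_setsD1)
  qed
  then show ?thesis using mass_nonneg[of A f] assms(3) less_imp_le by (metis less_le)
qed

section \<open>Locally square integrable functions and the Cauchy--Schwarz inequality on a
  set\<close>

definition loc_L2 :: "((real^'n) \<Rightarrow> real) \<Rightarrow> bool" where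
  "loc_L2 f \<longleftrightarrow> f \<in> borel_measurable lebesgue \<and> locally_integrable (sq f)"

lemma loc_L2_mult:
  assumes "loc_L2 f" "loc_L2 g"
  shows "locally_integrable (\<lambda>x. f x * g x)"
proof (rule locally_integrable_bound)
  show "locally_integrable (\<lambda>x. (f x)\<^sup>2 + (g x)\<^sup>2)"
    using assms by (auto simp: loc_L2_def intro: locally_integrable_add)
  fix x
  have "0 \<le> (\<bar>f x\<bar> - \<bar>g x\<bar>)\<^sup>2" by simp
  then have "2 * (\<bar>f x\<bar> * \<bar>g x\<bar>) \<le> (f x)\<^sup>2 + (g x)\<^sup>2"
    by (simp add: power2_diff)
  moreover have "0 \<le> \<bar>f x\<bar> * \<bar>g x\<bar>" by simp
  ultimately show "\<bar>f x * g x\<bar> \<le> \<bar>(f x)\<^sup>2 + (g x)\<^sup>2\<bar>"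
    unfolding abs_mult by linarith
qed (use assms in \<open>auto simp: loc_L2_def\<close>)

lemma loc_L2_one: "loc_L2 (\<lambda>x. 1)"
  by (simp add: loc_L2_def locally_integrable_const)

lemma loc_L2_locally_integrable: "loc_L2 f \<Longrightarrow> locally_integrable f"
  using loc_L2_mult[OF _ loc_L2_one, of f] by simp

lemma loc_L2_bounded_mult:
  assumes "loc_L2 f" "M \<in> borel_measurable lebesgue" "\<And>x. \<bar>M x\<bar> \<le> C"
  shows "loc_L2 (\<lambda>x. f x * M x)"
  unfolding loc_L2_def
proof
  show "locally_integrable (\<lambda>x. (f x * M x)\<^sup>2)"
  proof (rule locally_integrable_bound)
    show "locally_integrable (\<lambda>x. C\<^sup>2 * (f x)\<^sup>2)"
      using assms by (auto simp: loc_L2_def intro: locally_integrable_cmult)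
    fix x
    have "\<bar>M x\<bar>\<^sup>2 \<le> C\<^sup>2" using assms(3) by (intro power_mono) auto
    then show "\<bar>(f x * M x)\<^sup>2\<bar> \<le> \<bar>C\<^sup>2 * (f x)\<^sup>2\<bar>"
      using mult_right_mono[of "(M x)\<^sup>2" "C\<^sup>2" "(f x)\<^sup>2"]
      by (simp add: power_mult_distrib mult.commute)
  qed (use assms in \<open>auto simp: loc_L2_def\<close>)
qed (use assms in \<open>auto simp: loc_L2_def\<close>)

text \<open>Shared by the two Cauchy--Schwarz inequalities, \<open>mass_Cauchy_Schwarz\<close> and
  \<open>L2_Cauchy_Schwarz\<close>. The case \<open>a = 0\<close> covers functions that vanish
  almost everywhere.\<close>

lemma discriminant_bound:
  fixes a b c :: real
  assumes "0 \<le> a" "\<And>s. 0 \<le> a * s\<^sup>2 + 2 * c * s + b"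
  shows "c\<^sup>2 \<le> a * b"
proof (cases "a = 0")
  case True
  have "c = 0"
  proof (rule ccontr)
    assume "c \<noteq> 0"
    \<comment> \<open>With \<open>a = 0\<close> this value of \<open>s\<close> makes the remaining
      linear expression equal to -1.\<close>
    then show False using assms(2)[of "- (b + 1) / (2 * c)"] True by simp
  qed
  then show ?thesis using True by simp
next
  case False
  then have "0 \<le> a * (a * (- c / a)\<^sup>2 + 2 * c * (- c / a) + b)"
    using assms by (intro mult_nonneg_nonneg) blast+
  also have "\<dots> = a * b - c\<^sup>2" using False by (simp add: power2_eq_square field_simps)
  finally show ?thesis by simp
qed

lemma mass_Cauchy_Schwarz:
  assumes f: "loc_L2 f" and g: "loc_L2 g" and A: "A \<in> bsets"
  shows "(mass (\<lambda>x. f x * g x) A)\<^sup>2 \<le> mass (sq f) A * mass (sq g) A"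
proof (rule discriminant_bound)
  fix s :: real
  have i: "set_integrable lebesgue A (sq f)" "set_integrable lebesgue A (sq g)"
     "set_integrable lebesgue A (\<lambda>x. f x * g x)"
    using f g A loc_L2_mult[OF f g] by (auto simp: loc_L2_def intro: locally_integrable_set)
  have "0 \<le> mass (\<lambda>x. (s * f x + g x)\<^sup>2) A" by (intro mass_nonneg) simp
  also have "\<dots> = mass (\<lambda>x. s\<^sup>2 * (f x)\<^sup>2 + 2 * s * (f x * g x) + (g x)\<^sup>2) A"
    by (simp add: power2_sum power_mult_distrib algebra_simps)
  also have "\<dots> = s\<^sup>2 * mass (sq f) A + 2 * s * mass (\<lambda>x. f x * g x) A
      + mass (sq g) A"
    using i by (simp add: set_integral_add)
  finally show "0 \<le> mass (sq f) A * s\<^sup>2 + 2 * mass (\<lambda>x. f x * g x) A * s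
      + mass (sq g) A" by (simp add: mult.commute mult.left_commute)
qed (simp add: mass_nonneg)

section \<open>Induction over laminar families of halved sets\<close>

text \<open>This takes the place of concavity: a concave function, homogeneous of degree one, of
  additive quantities is superadditive in the set.\<close>

definition superadditive :: "((real^'n) set \<Rightarrow> real) \<Rightarrow> bool" where
  "superadditive \<Phi> \<longleftrightarrow> (\<forall>A\<in>bsets. 0 \<le> \<Phi> A) \<and>
     (\<forall>A\<in>bsets. \<forall>B\<in>bsets. A \<inter> B = {} \<longrightarrow> \<Phi> A + \<Phi> B \<le> \<Phi> (A \<union> B))"

lemma superadditive_mass:
  "locally_integrable f \<Longrightarrow> (\<And>x. 0 \<le> f x) \<Longrightarrow> superadditive (mass f)"
  by (auto simp: superadditive_def mass_Un mass_nonneg)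

text \<open>\<open>P k\<close> and \<open>N k\<close> are where the Haar function with index
  \<open>k\<close> is positive and negative; equal volumes give it mean zero. The index type is
  abstract, so that supports in one cube and supports in different cubes are compared by the same
  clause \<open>nested\<close>.\<close>

locale laminar =
  fixes P N :: "'k \<Rightarrow> (real^'n) set" and K :: "'k set"
  assumes P_bsets: "k \<in> K \<Longrightarrow> P k \<in> bsets"
    and N_bsets: "k \<in> K \<Longrightarrow> N k \<in> bsets"
    and disj: "k \<in> K \<Longrightarrow> P k \<inter> N k = {}"
    and halves: "k \<in> K \<Longrightarrow> vol (P k) = vol (N k)"
    and P_pos: "k \<in> K \<Longrightarrow> 0 < vol (P k)"
    and nested: "k \<in> K \<Longrightarrow> l \<in> K \<Longrightarrow> k \<noteq> l \<Longrightarrow>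
      P k \<union> N k \<subseteq> P l \<or> P k \<union> N k \<subseteq> N l \<or> P l \<union> N l \<subseteq> P k \<or> P l \<union> N l \<subseteq> N k \<or>
      (P k \<union> N k) \<inter> (P l \<union> N l) = {}"
begin

definition U :: "'k \<Rightarrow> (real^'n) set" where "U k = P k \<union> N k"

lemma U_bsets: "k \<in> K \<Longrightarrow> U k \<in> bsets"
  by (simp add: U_def P_bsets N_bsets bsets_Un)

lemma N_pos: "k \<in> K \<Longrightarrow> 0 < vol (N k)"
  using halves P_pos by metis

lemma measure_U: "k \<in> K \<Longrightarrow> vol (U k) = 2 * vol (P k)"
  using mass_Un[OF locally_integrable_const[of 1] P_bsets N_bsets disj, of k]
  by (simp add: mass_const U_bsets P_bsets N_bsets halves U_def bsets_Un)

lemma U_pos: "k \<in> K \<Longrightarrow> 0 < vol (U k)"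
  by (simp add: measure_U P_pos)

lemma mass_U:
  "locally_integrable f \<Longrightarrow> k \<in> K \<Longrightarrow> mass f (U k) = mass f (P k) + mass f (N k)"
  unfolding U_def by (intro mass_Un P_bsets N_bsets disj)

text \<open>Volume is the order that replaces dyadic generations: a half of \<open>U l\<close> has
  only half its volume, so a set at least as large as \<open>U l\<close> cannot fit into it.\<close>

lemma nested_of_measure_le:
  assumes "k \<in> K" "l \<in> K" "k \<noteq> l" "vol (U l) \<le> vol (U k)"
  shows "U l \<subseteq> P k \<or> U l \<subseteq> N k \<or> U k \<inter> U l = {}"
proof -
  have "\<not> U k \<subseteq> P l"
  proof
    assume "U k \<subseteq> P l"
    then have "vol (U k) \<le> vol (P l)"
      using assms by (intro measure_mono_fmeasurable)
        (auto simp: U_bsets P_bsets bsets_sets bsets_lmeasurable)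
    then show False using assms measure_U[of l] P_pos[of l] by simp
  qed
  moreover have "\<not> U k \<subseteq> N l"
  proof
    assume "U k \<subseteq> N l"
    then have "vol (U k) \<le> vol (N l)"
      using assms by (intro measure_mono_fmeasurable)
        (auto simp: U_bsets N_bsets bsets_sets bsets_lmeasurable)
    then show False using assms measure_U[of l] P_pos[of l] halves[of l] by simp
  qed
  ultimately show ?thesis using nested[OF assms(1-3)] unfolding U_def by blast
qed

lemma largest:
  assumes "finite T" "T \<noteq> {}"
  obtains k where "k \<in> T" "\<And>l. l \<in> T \<Longrightarrow> vol (U l) \<le> vol (U k)"
proof -
  have "Max ((\<lambda>k. vol (U k)) ` T) \<in> (\<lambda>k. vol (U k)) ` T" using assms by (intro Max_in) auto
  then obtain k where k: "k \<in> T" "Max ((\<lambda>k. vol (U k)) ` T) = vol (U k)" by auto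
  have "vol (U l) \<le> vol (U k)" if "l \<in> T" for l
    unfolding k(2)[symmetric] using assms that by (intro Max_ge) auto
  with k(1) show ?thesis by (rule that)
qed

text \<open>Bellman induction without a tree. A member \<open>k\<close> of largest volume splits the
  rest into those inside \<open>P k\<close>, those inside \<open>N k\<close> and those disjoint from
  \<open>U k\<close>; the three subfamilies are smaller, and the hypothesis at \<open>k\<close>
  absorbs \<open>\<tau> k\<close>. The third subfamily is charged to \<open>A - U k\<close>, which
  is why \<open>\<Phi>\<close> has to be superadditive on general sets.\<close>

lemma sum_le_superadditive:
  assumes \<Phi>: "superadditive \<Phi>" and "finite T" "T \<subseteq> K"
    and "\<And>k. k \<in> T \<Longrightarrow> \<tau> k + \<Phi> (P k) + \<Phi> (N k) \<le> \<Phi> (U k)"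
    and "A \<in> bsets" "\<And>k. k \<in> T \<Longrightarrow> U k \<subseteq> A"
  shows "sum \<tau> T \<le> \<Phi> A"
  using assms(2-)
proof (induction "card T" arbitrary: T A rule: less_induct)
  case less
  show ?case
  proof (cases "T = {}")
    case True
    then show ?thesis using \<Phi> less.prems by (auto simp: superadditive_def)
  next
    case False
    from largest[OF \<open>finite T\<close> False] obtain k
      where k: "k \<in> T" and le: "\<And>l. l \<in> T \<Longrightarrow> vol (U l) \<le> vol (U k)" by blast
    have kK: "k \<in> K" using k less.prems by auto
    define T1 where "T1 = {l\<in>T - {k}. U l \<subseteq> P k}"
    define T2 where "T2 = {l\<in>T - {k}. \<not> U l \<subseteq> P k \<and> U l \<subseteq> N k}"
    define T3 where "T3 = {l\<in>T - {k}. \<not> U l \<subseteq> P k \<and> \<not> U l \<subseteq> N k}"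
    have fin: "finite T1" "finite T2" "finite T3"
      using less.prems by (auto simp: T1_def T2_def T3_def)
    have T: "T = insert k (T1 \<union> T2 \<union> T3)" using k by (auto simp: T1_def T2_def T3_def)
    have dj: "k \<notin> T1 \<union> T2 \<union> T3" "(T1 \<union> T2) \<inter> T3 = {}" "T1 \<inter> T2 = {}"
      by (auto simp: T1_def T2_def T3_def)
    have cd: "card T1 < card T" "card T2 < card T" "card T3 < card T"
      using less.prems(1) k(1) by (auto intro!: psubset_card_mono simp: T1_def T2_def T3_def)
    have b: "P k \<in> bsets" "N k \<in> bsets" "U k \<in> bsets" "A - U k \<in> bsets"
      using U_bsets[OF kK] P_bsets[OF kK] N_bsets[OF kK] bsets_Diff[OF less.prems(4) U_bsets[OF kK]]
      by auto
    have s1: "sum \<tau> T1 \<le> \<Phi> (P k)"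
      by (rule less.hyps[OF cd(1) fin(1)]) (use less.prems b in \<open>auto simp: T1_def\<close>)
    have s2: "sum \<tau> T2 \<le> \<Phi> (N k)"
      by (rule less.hyps[OF cd(2) fin(2)]) (use less.prems b in \<open>auto simp: T2_def\<close>)
    have s3: "sum \<tau> T3 \<le> \<Phi> (A - U k)"
    proof (rule less.hyps[OF cd(3) fin(3)])
      fix l assume l: "l \<in> T3"
      then have "U k \<inter> U l = {}"
        using nested_of_measure_le[OF kK, of l] le[of l] less.prems by (auto simp: T3_def)
      moreover have "U l \<subseteq> A" using l less.prems by (auto simp: T3_def)
      ultimately show "U l \<subseteq> A - U k" by auto
    qed (use less.prems b in \<open>auto simp: T3_def\<close>)
    have "sum \<tau> T = \<tau> k + (sum \<tau> T1 + sum \<tau> T2 + sum \<tau> T3)"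
      unfolding T using fin dj by (simp add: sum.union_disjoint)
    also have "\<dots> \<le> (\<tau> k + \<Phi> (P k) + \<Phi> (N k)) + \<Phi> (A - U k)"
      using s1 s2 s3 by simp
    also have "\<dots> \<le> \<Phi> (U k) + \<Phi> (A - U k)" using less.prems k by simp
    also have "\<dots> \<le> \<Phi> (U k \<union> (A - U k))"
      using \<Phi> b unfolding superadditive_def by blast
    also have "U k \<union> (A - U k) = A" using less.prems k by auto
    finally show ?thesis .
  qed
qed

end
section \<open>Bellman functions\<close>

text \<open>After squaring, the cross term is the arithmetic--geometric mean inequality for
  \<open>x1 * y2\<close> and \<open>x2 * y1\<close>.\<close>

lemma sqrt_mult_add_le:
  fixes x1 x2 y1 y2 :: real
  assumes "0 \<le> x1" "0 \<le> x2" "0 \<le> y1" "0 \<le> y2"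
  shows "sqrt (x1 * y1) + sqrt (x2 * y2) \<le> sqrt ((x1 + x2) * (y1 + y2))"
proof (rule real_le_rsqrt)
  have "2 * sqrt ((x1 * y2) * (x2 * y1)) \<le> x1 * y2 + x2 * y1"
    using arith_geo_mean_sqrt[of "x1 * y2" "x2 * y1"] assms by simp
  also have "sqrt ((x1 * y2) * (x2 * y1)) = sqrt (x1 * y1) * sqrt (x2 * y2)"
    by (simp add: real_sqrt_mult)
  finally show "(sqrt (x1 * y1) + sqrt (x2 * y2))\<^sup>2 \<le> (x1 + x2) * (y1 + y2)"
    using assms by (simp add: power2_sum algebra_simps)
qed

text \<open>Iterating this closure property produces the fractional powers: the Bellman functions
  that control jumps are nested geometric means of masses and volume, so they stay homogeneous of
  degree one.\<close>

lemma superadditive_sqrt: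
  assumes "superadditive \<Phi>" "superadditive \<Psi>"
  shows "superadditive (\<lambda>A. sqrt (\<Phi> A * \<Psi> A))"
  unfolding superadditive_def
proof (intro conjI ballI impI)
  fix A B :: "(real^'a) set" assume AB: "A \<in> bsets" "B \<in> bsets" "A \<inter> B = {}"
  then have n: "0 \<le> \<Phi> A" "0 \<le> \<Phi> B" "0 \<le> \<Psi> A" "0 \<le> \<Psi> B"
    and le: "\<Phi> A + \<Phi> B \<le> \<Phi> (A \<union> B)" "\<Psi> A + \<Psi> B \<le> \<Psi> (A \<union> B)"
    using assms by (auto simp: superadditive_def)
  show "sqrt (\<Phi> A * \<Psi> A) + sqrt (\<Phi> B * \<Psi> B) \<le> sqrt (\<Phi> (A \<union> B) * \<Psi> (A \<union> B))"
    by (rule order_trans[OF sqrt_mult_add_le[OF n(1,2,3,4)]])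
      (use n le in \<open>auto intro!: mult_mono\<close>)
qed (use assms in \<open>auto simp: superadditive_def\<close>)

lemma sqrt_one_minus_le: "sqrt (1 - s) \<le> 1 - s / 2" if "s \<le> 2" for s :: real
  by (rule real_le_lsqrt) (use that in \<open>auto simp: power2_eq_square algebra_simps\<close>)

text \<open>With \<open>s\<close> the squared relative jump, \<open>4 * a1 * a2\<close> is
  \<open>(a1 + a2)\<^sup>2 * (1 - s)\<close>, and this defect survives the roots. \<open>n\<close>
  is the common volume of the two halves, which lets the defect be read off from \<open>a1\<close>
  and \<open>a2\<close> alone. It is halved four times, by three square roots and by the expansion
  of one square, hence the factor 1/16.\<close>

lemma bellman_step:
  fixes a1 a2 n R R1 R2 :: real
  assumes pos: "0 < a1" "0 < a2" "0 < n" and R: "0 \<le> R1" "0 \<le> R2" "R1 + R2 \<le> R"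
  shows "((a1 - a2) / (a1 + a2))\<^sup>2 / 16 * sqrt (sqrt ((a1 + a2) * (2 * n)) * R)
      + sqrt (sqrt (a1 * n) * R1) + sqrt (sqrt (a2 * n) * R2)
    \<le> sqrt (sqrt ((a1 + a2) * (2 * n)) * R)"
proof -
  define a where "a = a1 + a2"
  define s where "s = ((a1 - a2) / a)\<^sup>2"
  define x where "x = sqrt (a * (2 * n))"
  have a: "a > 0" using pos by (simp add: a_def)
  have s: "0 \<le> s" "s \<le> 1"
  proof -
    have "\<bar>a1 - a2\<bar> \<le> a" using pos by (simp add: a_def)
    then have "\<bar>(a1 - a2) / a\<bar> \<le> 1" using a by (simp add: abs_divide)
    then show "s \<le> 1" unfolding s_def by (simp add: abs_square_le_1)
  qed (simp add: s_def)
  have as: "a\<^sup>2 * s = (a1 - a2)\<^sup>2" using a by (simp add: s_def power_divide)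
  have "2 * sqrt (a1 * a2) = sqrt (a\<^sup>2 * (1 - s))"
  proof -
    have "a\<^sup>2 * (1 - s) = 2\<^sup>2 * (a1 * a2)"
      using as unfolding a_def by (simp add: power2_eq_square algebra_simps)
    then show ?thesis by (simp only: real_sqrt_mult) simp
  qed
  also have "\<dots> = a * sqrt (1 - s)" using a by (simp add: real_sqrt_mult)
  also have "\<dots> \<le> a * (1 - s / 2)"
    using a s by (intro mult_left_mono sqrt_one_minus_le) auto
  finally have g: "2 * sqrt (a1 * a2) \<le> a * (1 - s / 2)" .
  have "sqrt (a1 * n) + sqrt (a2 * n) \<le> sqrt ((a * (2 * n)) * (1 - s / 4))"
  proof (rule real_le_rsqrt)
    have "(sqrt (a1 * n) + sqrt (a2 * n))\<^sup>2 = a * n + n * (2 * sqrt (a1 * a2))"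
      using pos by (simp add: power2_sum real_sqrt_mult a_def algebra_simps)
    also have "\<dots> \<le> a * n + n * (a * (1 - s / 2))"
      using g pos by (intro add_left_mono mult_left_mono) auto
    finally show "(sqrt (a1 * n) + sqrt (a2 * n))\<^sup>2 \<le> a * (2 * n) * (1 - s / 4)"
      by (simp add: algebra_simps)
  qed
  also have "\<dots> = x * sqrt (1 - s / 4)" by (simp add: x_def real_sqrt_mult)
  also have "\<dots> \<le> x * (1 - s / 8)"
    using sqrt_one_minus_le[of "s / 4"] s a pos by (intro mult_left_mono) (auto simp: x_def)
  finally have x12: "sqrt (a1 * n) + sqrt (a2 * n) \<le> x * (1 - s / 8)" .
  have x: "0 \<le> x" using a pos by (simp add: x_def)
  have "sqrt (sqrt (a1 * n) * R1) + sqrt (sqrt (a2 * n) * R2)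
      \<le> sqrt ((sqrt (a1 * n) + sqrt (a2 * n)) * (R1 + R2))"
    using pos R by (intro sqrt_mult_add_le) auto
  also have "\<dots> \<le> sqrt ((x * (1 - s / 8)) * R)"
    using x12 R pos s x by (intro real_sqrt_le_mono mult_mono) auto
  also have "\<dots> = sqrt (x * R) * sqrt (1 - s / 8)" by (simp add: real_sqrt_mult)
  also have "\<dots> \<le> sqrt (x * R) * (1 - s / 16)"
    using sqrt_one_minus_le[of "s / 8"] s x R by (intro mult_left_mono) auto
  finally show ?thesis unfolding s_def x_def a_def by (simp add: algebra_simps)
qed

text \<open>\<open>X\<^sup>2 / V\<close> is jointly convex and homogeneous of degree one, hence
  subadditive. A quotient with denominator 0 has the value 0, which is the right value here because
  the numerator then vanishes as well.\<close>

lemma sum_sq_div_le: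
  fixes X1 X2 V V1 V2 :: real
  assumes "0 \<le> V1" "0 \<le> V2" "V1 + V2 \<le> V" "V1 = 0 \<Longrightarrow> X1 = 0" "V2 = 0 \<Longrightarrow> X2 = 0"
  shows "(X1 + X2)\<^sup>2 / V \<le> X1\<^sup>2 / V1 + X2\<^sup>2 / V2"
proof -
  have anti: "c / V \<le> c / z" if "0 \<le> c" "0 < z" "z \<le> V" for c z
    using that by (simp add: frac_le)
  consider "V1 = 0" "V2 = 0" | "V1 = 0" "0 < V2" | "V2 = 0" "0 < V1" | "0 < V1" "0 < V2"
    using assms(1,2) by linarith
  then show ?thesis
  proof cases
    case 4
    have "X1\<^sup>2 / V1 + X2\<^sup>2 / V2 - (X1 + X2)\<^sup>2 / (V1 + V2)
        = (X1 * V2 - X2 * V1)\<^sup>2 / (V1 * V2 * (V1 + V2))"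
      using 4 by (simp add: divide_simps) (simp add: power2_eq_square algebra_simps)
    also have "\<dots> \<ge> 0" using 4 by simp
    finally show ?thesis using anti[of "(X1 + X2)\<^sup>2" "V1 + V2"] 4 assms(3) by simp
  qed (use assms anti in auto)
qed

lemma superadditive_energy:
  assumes p: "loc_L2 p" and u: "loc_L2 u" and S: "superadditive S"
    and le: "\<And>A. A \<in> bsets \<Longrightarrow> mass (sq u) A \<le> S A"
  shows "superadditive (\<lambda>A. mass (sq p) A - (mass (\<lambda>x. p x * u x) A)\<^sup>2 / S A)"
  unfolding superadditive_def
proof (intro conjI ballI impI)
  have CS: "(mass (\<lambda>x. p x * u x) A)\<^sup>2 \<le> mass (sq p) A * S A" if "A \<in> bsets" for A
    by (rule order_trans[OF mass_Cauchy_Schwarz[OF p u that]])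
      (use le[OF that] in \<open>auto intro!: mult_left_mono mass_nonneg\<close>)
  fix A :: "(real^'a) set" assume A: "A \<in> bsets"
  have SA: "0 \<le> S A" if "A \<in> bsets" for A using S that by (auto simp: superadditive_def)
  show "0 \<le> mass (sq p) A - (mass (\<lambda>x. p x * u x) A)\<^sup>2 / S A"
    using CS[OF A] SA[OF A]
    by (cases "S A = 0") (auto simp: field_simps mass_nonneg less_le)
  fix B :: "(real^'a) set" assume B: "B \<in> bsets" and AB: "A \<inter> B = {}"
  have z: "S A = 0 \<Longrightarrow> mass (\<lambda>x. p x * u x) A = 0" if "A \<in> bsets" for A
    using CS[OF that] by simp
  have "(mass (\<lambda>x. p x * u x) A + mass (\<lambda>x. p x * u x) B)\<^sup>2 / S (A \<union> B)
    \<le> (mass (\<lambda>x. p x * u x) A)\<^sup>2 / S A + (mass (\<lambda>x. p x * u x) B)\<^sup>2 / S B"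
    by (rule sum_sq_div_le) (use SA A B z S AB in \<open>auto simp: superadditive_def\<close>)
  moreover have "mass (\<lambda>x. p x * u x) (A \<union> B) = mass (\<lambda>x. p x * u x) A + mass (\<lambda>x. p x * u x) B"
    "mass (sq p) (A \<union> B) = mass (sq p) A + mass (sq p) B"
    using p u A B AB by (auto intro!: mass_Un loc_L2_mult simp: loc_L2_def)
  ultimately show "mass (sq p) A - (mass (\<lambda>x. p x * u x) A)\<^sup>2 / S A
      + (mass (sq p) B - (mass (\<lambda>x. p x * u x) B)\<^sup>2 / S B)
      \<le> mass (sq p) (A \<union> B) - (mass (\<lambda>x. p x * u x) (A \<union> B))\<^sup>2 / S (A \<union> B)"
    by simp
qed

section \<open>Telescoping sums over a laminar family: jumps, weighted Bessel inequality, weighted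
  Carleson embedding\<close>

context laminar
begin

definition jump :: "((real^'n) \<Rightarrow> real) \<Rightarrow> 'k \<Rightarrow> real" where
  "jump a k = (mass a (P k) - mass a (N k)) / mass a (U k)"

text \<open>The loss in \<open>bellman_step\<close> comes from \<open>a\<close> alone, so the second
  factor \<open>R\<close> may be any superadditive function. The choice of \<open>R\<close> decides
  which power of the other weight accompanies the jump.\<close>

lemma sum_jump_bellman:
  assumes a: "locally_integrable a" "\<And>x. 0 < a x" and R: "superadditive R"
    and T: "finite T" "T \<subseteq> K" and A: "A \<in> bsets" "\<And>k. k \<in> T \<Longrightarrow> U k \<subseteq> A"
  shows "(\<Sum>k\<in>T. (jump a k)\<^sup>2 * sqrt (sqrt (mass a (U k) * vol (U k)) * R (U k)))
    \<le> 16 * sqrt (sqrt (mass a A * vol A) * R A)"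
proof -
  let ?\<Phi> = "\<lambda>A. sqrt (sqrt (mass a A * mass (\<lambda>_. 1) A) * R A)"
  have S: "superadditive ?\<Phi>"
    using a(1) less_imp_le[OF a(2)] R locally_integrable_const
    by (intro superadditive_sqrt superadditive_mass) auto
  have "(\<Sum>k\<in>T. (jump a k)\<^sup>2 / 16 * ?\<Phi> (U k)) \<le> ?\<Phi> A"
  proof (rule sum_le_superadditive[OF S T _ A])
    fix k assume "k \<in> T"
    then have k: "k \<in> K" using T by auto
    have R12: "0 \<le> R (P k)" "0 \<le> R (N k)" "R (P k) + R (N k) \<le> R (U k)"
      using R P_bsets[OF k] N_bsets[OF k] disj[OF k] by (auto simp: superadditive_def U_def)
    have "0 < mass a (P k)" "0 < mass a (N k)"
      using a k by (auto intro!: mass_pos P_bsets N_bsets P_pos N_pos)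
    from bellman_step[OF this P_pos[OF k] R12]
    show "(jump a k)\<^sup>2 / 16 * ?\<Phi> (U k) + ?\<Phi> (P k) + ?\<Phi> (N k) \<le> ?\<Phi> (U k)"
      using k a(1)
      by (simp add: jump_def mass_U mass_const U_bsets P_bsets N_bsets measure_U halves)
  qed
  then show ?thesis using A T
    by (simp add: mass_const U_bsets subset_iff sum_divide_distrib[symmetric] cong: sum.cong)
qed

text \<open>Each summand is exactly the decrease of the energy when \<open>U k\<close> is split into
  its halves, so the sum telescopes.\<close>

lemma weighted_bessel:
  assumes p: "loc_L2 p" and u: "loc_L2 u" "\<And>x. 0 < u x"
    and T: "finite T" "T \<subseteq> K" and A: "A \<in> bsets" "\<And>k. k \<in> T \<Longrightarrow> U k \<subseteq> A"
  defines "v \<equiv> mass (sq u)" and "X \<equiv> mass (\<lambda>x. p x * u x)"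
  shows "(\<Sum>k\<in>T. (X (P k) * v (N k) - X (N k) * v (P k))\<^sup>2 / (v (P k) * v (N k) * v (U k)))
    \<le> mass (sq p) A"
proof -
  let ?\<Phi> = "\<lambda>A. mass (sq p) A - (X A)\<^sup>2 / v A"
  have vs: "superadditive v"
    unfolding v_def by (rule superadditive_mass) (use u in \<open>auto simp: loc_L2_def\<close>)
  have S: "superadditive ?\<Phi>"
    unfolding X_def by (rule superadditive_energy[OF p u(1) vs]) (simp add: v_def)
  have "(\<Sum>k\<in>T. (X (P k) * v (N k) - X (N k) * v (P k))\<^sup>2 / (v (P k) * v (N k) * v (U k))) \<le> ?\<Phi> A"
  proof (rule sum_le_superadditive[OF S T _ A])
    fix k assume "k \<in> T"
    then have k: "k \<in> K" using T by auto
    have v: "0 < v (P k)" "0 < v (N k)"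
      unfolding v_def using u k
      by (auto intro!: mass_pos P_bsets N_bsets P_pos N_pos simp: loc_L2_def less_imp_neq[symmetric])
    have U: "v (U k) = v (P k) + v (N k)" "X (U k) = X (P k) + X (N k)"
      "mass (sq p) (U k) = mass (sq p) (P k) + mass (sq p) (N k)"
      unfolding v_def X_def using u p k by (auto intro!: mass_U loc_L2_mult simp: loc_L2_def)
    have "(X (P k) * v (N k) - X (N k) * v (P k))\<^sup>2 / (v (P k) * v (N k) * v (U k))
        = (X (P k))\<^sup>2 / v (P k) + (X (N k))\<^sup>2 / v (N k) - (X (U k))\<^sup>2 / v (U k)"
      using v unfolding U by (simp add: divide_simps) (simp add: power2_eq_square algebra_simps)
    then show "(X (P k) * v (N k) - X (N k) * v (P k))\<^sup>2 / (v (P k) * v (N k) * v (U k))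
       + ?\<Phi> (P k) + ?\<Phi> (N k) \<le> ?\<Phi> (U k)" using U(3) by simp
  qed
  also have "\<dots> \<le> mass (sq p) A"
    using vs A by (simp add: superadditive_def)
  finally show ?thesis .
qed

text \<open>The Bellman function of the Carleson embedding theorem: the energy with denominator
  \<open>v + m\<close>, where \<open>m\<close> is the part of the Carleson mass that lies inside the
  set. The Carleson condition keeps \<open>v + m\<close> between \<open>v\<close> and
  \<open>2 * v\<close>, and the two factors 2 give the constant 4.\<close>

lemma weighted_carleson:
  assumes p: "loc_L2 p" and u: "loc_L2 u" "\<And>x. 0 < u x"
    and T: "finite T" "T \<subseteq> K" and A: "A \<in> bsets" "\<And>k. k \<in> T \<Longrightarrow> U k \<subseteq> A"
    and \<mu>: "\<And>k. k \<in> T \<Longrightarrow> 0 \<le> \<mu> k"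
      "\<And>k. k \<in> T \<Longrightarrow> (\<Sum>l\<in>{l\<in>T. U l \<subseteq> U k}. \<mu> l) \<le> mass (sq u) (U k)"
  shows "(\<Sum>k\<in>T. \<mu> k * (mass (\<lambda>x. p x * u x) (U k) / mass (sq u) (U k))\<^sup>2)
    \<le> 4 * mass (sq p) A"
proof -
  define v where "v = mass (sq u)"
  define X where "X = mass (\<lambda>x. p x * u x)"
  define m where "m A = (\<Sum>l\<in>{l\<in>T. U l \<subseteq> A}. \<mu> l)" for A
  let ?\<Phi> = "\<lambda>A. mass (sq p) A - (X A)\<^sup>2 / (v A + m A)"
  have ne: "U l \<noteq> {}" if "l \<in> T" for l using U_pos[of l] that T by auto
  have m0: "0 \<le> m A" for A unfolding m_def using \<mu> by (intro sum_nonneg) auto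
  have m_Un: "m A + m B \<le> m (A \<union> B)" if "A \<inter> B = {}" for A B
  proof -
    have "m A + m B = (\<Sum>l\<in>{l\<in>T. U l \<subseteq> A} \<union> {l\<in>T. U l \<subseteq> B}. \<mu> l)"
      unfolding m_def
    proof (rule sum.union_disjoint[symmetric])
      show "{l\<in>T. U l \<subseteq> A} \<inter> {l\<in>T. U l \<subseteq> B} = {}" using ne that by blast
    qed (use T in auto)
    also have "\<dots> \<le> m (A \<union> B)"
      unfolding m_def by (rule sum_mono2) (use T \<mu> in auto)
    finally show ?thesis .
  qed
  have vL: "locally_integrable (sq u)" using u by (simp add: loc_L2_def)
  have vs: "superadditive (\<lambda>A. v A + m A)"
    using superadditive_mass[OF vL] m0 m_Un unfolding superadditive_def v_def
    by (auto simp: add_nonneg_nonneg) (smt (verit))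
  have S: "superadditive ?\<Phi>"
    unfolding X_def by (rule superadditive_energy[OF p u(1) vs]) (simp add: v_def m0)
  have "(\<Sum>k\<in>T. \<mu> k * (X (U k) / v (U k))\<^sup>2 / 4) \<le> ?\<Phi> A"
  proof (rule sum_le_superadditive[OF S T _ A])
    fix k assume kT: "k \<in> T"
    then have k: "k \<in> K" using T by auto
    have v: "0 < v (P k)" "0 < v (N k)"
      unfolding v_def using u k
      by (auto intro!: mass_pos P_bsets N_bsets P_pos N_pos simp: loc_L2_def less_imp_neq[symmetric])
    have U: "v (U k) = v (P k) + v (N k)" "X (U k) = X (P k) + X (N k)"
      "mass (sq p) (U k) = mass (sq p) (P k) + mass (sq p) (N k)"
      unfolding v_def X_def using u p k by (auto intro!: mass_U loc_L2_mult simp: loc_L2_def)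
    have sub: "\<not> U k \<subseteq> P k" "\<not> U k \<subseteq> N k"
      using disj[OF k] P_pos[OF k] N_pos[OF k] by (auto simp: U_def) (metis disjoint_iff_not_equal
        empty_subsetI inf.orderE inf_commute less_irrefl measure_empty)+
    \<comment> \<open>\<open>U k\<close> lies in neither half, so \<open>\<mu> k\<close> counts in
      \<open>m (U k)\<close> but neither in \<open>m (P k)\<close> nor in
      \<open>m (N k)\<close>.\<close>
    have mU: "m (P k) + m (N k) + \<mu> k \<le> m (U k)"
    proof -
      have "m (P k) + m (N k) + \<mu> k
          = (\<Sum>l\<in>insert k ({l\<in>T. U l \<subseteq> P k} \<union> {l\<in>T. U l \<subseteq> N k}). \<mu> l)"
        unfolding m_def using T sub disj[OF k] ne
        by (subst sum.insert) (auto simp: sum.union_disjoint[symmetric] disjoint_iff subset_iff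
            intro!: sum.union_disjoint[symmetric])
      also have "\<dots> \<le> m (U k)"
        unfolding m_def by (rule sum_mono2) (use T \<mu> kT in \<open>auto simp: U_def\<close>)
      finally show ?thesis .
    qed
    \<comment> \<open>\<open>s\<close> is the denominator before \<open>\<mu> k\<close> is added.
      Splitting the set is free at the level \<open>s\<close>; the gain is the difference between
      the denominators \<open>s\<close> and \<open>s + \<mu> k\<close>.\<close>
    define s where "s = v (U k) + m (U k) - \<mu> k"
    have mv: "m (U k) \<le> v (U k)" using \<mu>(2)[OF kT] by (simp add: m_def v_def)
    have s: "0 < s" "s \<le> 2 * v (U k)" "s + \<mu> k \<le> 2 * v (U k)" "s + \<mu> k = v (U k) + m (U k)"
      using v mU mv \<mu>(1)[OF kT] m0[of "P k"] m0[of "N k"] U(1) unfolding s_def by linarith+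
    have e: "(X (U k))\<^sup>2 / s
        \<le> (X (P k))\<^sup>2 / (v (P k) + m (P k)) + (X (N k))\<^sup>2 / (v (N k) + m (N k))"
      unfolding U(2)
    proof (rule sum_sq_div_le)
      show "v (P k) + m (P k) + (v (N k) + m (N k)) \<le> s" using mU U(1) by (simp add: s_def)
    qed (use v m0[of "P k"] m0[of "N k"] in auto)
    have "\<mu> k * (X (U k))\<^sup>2 / (4 * (v (U k))\<^sup>2) \<le> \<mu> k * (X (U k))\<^sup>2 / (s * (s + \<mu> k))"
    proof (rule divide_left_mono)
      have "s * (s + \<mu> k) \<le> (2 * v (U k)) * (2 * v (U k))"
        using s \<mu>(1)[OF kT] by (intro mult_mono) auto
      then show "s * (s + \<mu> k) \<le> 4 * (v (U k))\<^sup>2" by (simp add: power2_eq_square)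
    qed (use s \<mu>(1)[OF kT] v U(1) in auto)
    also have "\<dots> = (X (U k))\<^sup>2 / s - (X (U k))\<^sup>2 / (s + \<mu> k)"
    proof -
      have "x / s - x / (s + y) = y * x / (s * (s + y))" if "0 \<le> y" for x y
        using s(1) that by (simp add: divide_simps) (simp add: algebra_simps)
      from this[OF \<mu>(1)[OF kT]] show ?thesis by simp
    qed
    finally have "\<mu> k * (X (U k) / v (U k))\<^sup>2 / 4 + (X (U k))\<^sup>2 / (v (U k) + m (U k)) \<le> (X (U k))\<^sup>2 / s"
      using s by (simp add: power_divide)
    then show "\<mu> k * (X (U k) / v (U k))\<^sup>2 / 4 + ?\<Phi> (P k) + ?\<Phi> (N k) \<le> ?\<Phi> (U k)"
      using e U(3) by simp
  qed
  also have "\<dots> \<le> mass (sq p) A"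
    using vs A by (simp add: superadditive_def)
  finally show ?thesis by (simp add: sum_divide_distrib[symmetric] v_def X_def)
qed

end
section \<open>Maximal functions and Carleson sequences\<close>

lemma sum_superadditive_le:
  assumes "superadditive \<Phi>" "finite T" "\<And>l. l \<in> T \<Longrightarrow> D l \<in> bsets" "disjoint_family_on D T"
    "\<And>l. l \<in> T \<Longrightarrow> D l \<subseteq> A" "A \<in> bsets"
  shows "(\<Sum>l\<in>T. \<Phi> (D l)) \<le> \<Phi> A"
  using assms(2-)
proof (induction T arbitrary: A rule: finite_induct)
  case empty
  then show ?case using assms(1) by (simp add: superadditive_def)
next
  case (insert x T)
  have dx: "D x \<in> bsets" "A - D x \<in> bsets" using insert.prems by (simp_all add: bsets_Diff)
  have "(\<Sum>l\<in>T. \<Phi> (D l)) \<le> \<Phi> (A - D x)"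
  proof (rule insert.IH)
    fix l assume l: "l \<in> T"
    then have "D l \<inter> D x = {}"
      using insert.prems(2) insert.hyps(2) by (auto simp: disjoint_family_on_def)
    then show "D l \<subseteq> A - D x" using insert.prems(3) l by auto
  qed (use insert.prems dx in \<open>auto simp: disjoint_family_on_def\<close>)
  then have "(\<Sum>l\<in>insert x T. \<Phi> (D l)) \<le> \<Phi> (D x) + \<Phi> (A - D x)" using insert.hyps by simp
  also have "\<dots> \<le> \<Phi> (D x \<union> (A - D x))"
    using assms(1) dx unfolding superadditive_def by blast
  also have "D x \<union> (A - D x) = A" using insert.prems by auto
  finally show ?case .
qed

text \<open>The sets are added in order of decreasing \<open>F\<close>, each keeping only what the
  earlier ones left over. A point therefore ends up in a piece whose value is the largest among the
  sets that contain it.\<close>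

lemma disjointify_by_rank:
  fixes F :: "'k \<Rightarrow> real"
  assumes "finite T" "\<And>k. k \<in> T \<Longrightarrow> U k \<in> bsets"
  obtains D where "\<And>k. k \<in> T \<Longrightarrow> D k \<in> bsets" "\<And>k. k \<in> T \<Longrightarrow> D k \<subseteq> U k"
    "disjoint_family_on D T" "\<And>k x. k \<in> T \<Longrightarrow> x \<in> U k \<Longrightarrow> \<exists>l\<in>T. x \<in> D l \<and> F k \<le> F l"
proof -
  have "\<exists>D. (\<forall>k\<in>T. D k \<in> bsets \<and> D k \<subseteq> U k) \<and> disjoint_family_on D T \<and>
    (\<forall>k\<in>T. \<forall>x\<in>U k. \<exists>l\<in>T. x \<in> D l \<and> F k \<le> F l)"
    using assms
  proof (induction T rule: finite_ranking_induct[where f = "\<lambda>k. - F k"])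
    case empty
    then show ?case by (auto simp: disjoint_family_on_def)
  next
    case (insert k S)
    then obtain D where D: "\<forall>k\<in>S. D k \<in> bsets \<and> D k \<subseteq> U k" "disjoint_family_on D S"
      "\<forall>k\<in>S. \<forall>x\<in>U k. \<exists>l\<in>S. x \<in> D l \<and> F k \<le> F l" by auto
    show ?case
    proof (cases "k \<in> S")
      case True
      then show ?thesis using D by (auto simp: insert_absorb)
    next
      case False
      define D' where "D' = D(k := U k - (\<Union>l\<in>S. D l))"
      have D'S: "D' l = D l" if "l \<in> S" for l using that False by (auto simp: D'_def)
      have 1: "\<forall>j\<in>insert k S. D' j \<in> bsets \<and> D' j \<subseteq> U j"
        using D(1) insert.prems insert.hyps(1) D'S
        by (auto simp: D'_def intro!: bsets_Diff bsets_UN)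
      have 2: "disjoint_family_on D' (insert k S)"
        using D(2) D'S unfolding disjoint_family_on_def by (auto simp: D'_def)
      have 3: "\<exists>l\<in>insert k S. x \<in> D' l \<and> F j \<le> F l" if j: "j \<in> insert k S" "x \<in> U j" for j x
      proof (cases "j = k \<and> x \<notin> (\<Union>l\<in>S. D l)")
        case True
        then show ?thesis using j by (intro bexI[of _ k]) (auto simp: D'_def)
      next
        case c: False
        show ?thesis
        proof (cases "j = k")
          case True
          then obtain l where "l \<in> S" "x \<in> D l" using c by auto
          then show ?thesis using insert.hyps(2)[of l] True D'S by (intro bexI[of _ l]) auto
        next
          case False
          then show ?thesis using j D(3) D'S by (metis insert_iff)
        qed
      qed
      show ?thesis using 1 2 3 by blast
    qed
  qed
  then show ?thesis using that by blast
qed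

lemma sum_mult_indicator_disjoint:
  assumes "finite T" "disjoint_family_on D T" "l \<in> T" "x \<in> D l"
  shows "(\<Sum>i\<in>T. f i * indicator (D i) x) = (f l :: real)"
proof -
  have "(\<Sum>i\<in>T. f i * indicator (D i) x) = (\<Sum>i\<in>T. if i = l then f i else 0)"
    using assms by (intro sum.cong) (auto simp: disjoint_family_on_def indicator_def)
  then show ?thesis using assms by simp
qed

context laminar
begin

text \<open>\<open>M\<close> is the linearised maximal function: on the piece \<open>D l\<close> it
  equals the average over \<open>U l\<close>. Since the pieces are disjoint and \<open>D l\<close>
  lies in \<open>U l\<close>, the masses of \<open>sq u\<close> on them satisfy the Carleson
  condition with constant one, and the bound is an instance of \<open>weighted_carleson\<close>. No
  doubling of the weight enters, so the constant 4 is universal.\<close>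

lemma maximal_function:
  assumes p: "loc_L2 p" "\<And>x. 0 \<le> p x" and u: "loc_L2 u" "\<And>x. 0 < u x"
    and T: "finite T" "T \<subseteq> K" and B: "B \<in> bsets" "\<And>k. k \<in> T \<Longrightarrow> U k \<subseteq> B"
  obtains M where "M \<in> borel_measurable lebesgue" "\<And>x. 0 \<le> M x" "loc_L2 (\<lambda>x. u x * M x)"
    "loc_L2 M"
    "\<And>k x. k \<in> T \<Longrightarrow> x \<in> U k \<Longrightarrow>
      mass (\<lambda>x. p x * u x) (U k) / mass (sq u) (U k) \<le> M x"
    "mass (\<lambda>x. (u x * M x)\<^sup>2) B \<le> 4 * mass (sq p) B"
proof -
  define F where "F k = mass (\<lambda>x. p x * u x) (U k) / mass (sq u) (U k)" for k
  obtain D where D: "\<And>k. k \<in> T \<Longrightarrow> D k \<in> bsets" "\<And>k. k \<in> T \<Longrightarrow> D k \<subseteq> U k"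
    "disjoint_family_on D T" "\<And>k x. k \<in> T \<Longrightarrow> x \<in> U k \<Longrightarrow> \<exists>l\<in>T. x \<in> D l \<and> F k \<le> F l"
    using disjointify_by_rank[OF T(1), of U F] U_bsets T(2) by blast
  define M where "M x = (\<Sum>l\<in>T. F l * indicator (D l) x)" for x
  have vL: "locally_integrable (sq u)" using u by (simp add: loc_L2_def)
  have F0: "0 \<le> F k" for k
    unfolding F_def by (intro divide_nonneg_nonneg mass_nonneg)
      (use p u less_imp_le in \<open>auto intro!: mult_nonneg_nonneg\<close>)
  have M_meas: "M \<in> borel_measurable lebesgue"
    unfolding M_def using D(1) bsets_sets
    by (intro borel_measurable_sum borel_measurable_times borel_measurable_const
        borel_measurable_indicator) auto
  have M0: "0 \<le> M x" for x unfolding M_def using F0 by (intro sum_nonneg) auto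
  have "M x \<le> (\<Sum>l\<in>T. F l)" for x
    unfolding M_def using F0 by (intro sum_mono) (auto simp: indicator_def)
  then have Mb: "\<bar>M x\<bar> \<le> (\<Sum>l\<in>T. F l)" for x using M0[of x] by simp
  have ge: "F k \<le> M x" if kx: "k \<in> T" "x \<in> U k" for k x
  proof -
    obtain l where l: "l \<in> T" "x \<in> D l" "F k \<le> F l" using D(4)[OF kx] by blast
    then show ?thesis
      unfolding M_def using sum_mult_indicator_disjoint[OF T(1) D(3), of l x F] by simp
  qed
  have sq: "(M x)\<^sup>2 = (\<Sum>l\<in>T. (F l)\<^sup>2 * indicator (D l) x)" for x
  proof (cases "\<exists>l\<in>T. x \<in> D l")
    case True
    then obtain l where l: "l \<in> T" "x \<in> D l" by auto
    show ?thesis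
      unfolding M_def using sum_mult_indicator_disjoint[OF T(1) D(3) l, of F]
        sum_mult_indicator_disjoint[OF T(1) D(3) l, of "\<lambda>l. (F l)\<^sup>2"] by simp
  next
    case False
    then show ?thesis by (simp add: M_def)
  qed
  have "mass (\<lambda>x. (u x * M x)\<^sup>2) B
      = (LINT x|lebesgue. (\<Sum>l\<in>T. (F l)\<^sup>2 * (indicator (D l) x *\<^sub>R (u x)\<^sup>2)))"
    unfolding set_lebesgue_integral_def
  proof (rule Bochner_Integration.integral_cong[OF refl])
    fix x
    have "indicat_real B x * indicator (D l) x = indicator (D l) x" if "l \<in> T" for l
      using D(2) B(2) that by (auto simp: indicator_def)
    then show "indicat_real B x *\<^sub>R (u x * M x)\<^sup>2
        = (\<Sum>l\<in>T. (F l)\<^sup>2 * (indicator (D l) x *\<^sub>R (u x)\<^sup>2))"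
      by (auto simp: power_mult_distrib sq sum_distrib_left intro!: sum.cong)
  qed
  also have "\<dots> = (\<Sum>l\<in>T. (F l)\<^sup>2 * mass (sq u) (D l))"
    using locally_integrable_set[OF vL D(1)]
    by (subst Bochner_Integration.integral_sum)
      (auto simp: set_integrable_def set_lebesgue_integral_def)
  also have "\<dots> = (\<Sum>l\<in>T. mass (sq u) (D l) * (F l)\<^sup>2)" by (simp add: mult.commute)
  also have "\<dots> \<le> 4 * mass (sq p) B"
    unfolding F_def
  proof (rule weighted_carleson[OF p(1) u T B])
    fix k assume k: "k \<in> T"
    show "(\<Sum>l\<in>{l\<in>T. U l \<subseteq> U k}. mass (sq u) (D l)) \<le> mass (sq u) (U k)"
    proof (rule sum_superadditive_le[OF superadditive_mass[OF vL]])
      show "D l \<subseteq> U k" if "l \<in> {l\<in>T. U l \<subseteq> U k}" for l using that D(2)[of l] by blast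
    qed (use T k U_bsets D in \<open>auto simp: disjoint_family_on_def\<close>)
  qed (auto intro: mass_nonneg)
  finally show ?thesis
    using that[OF M_meas M0 loc_L2_bounded_mult[OF u(1) M_meas Mb]
        loc_L2_bounded_mult[OF loc_L2_one M_meas Mb, simplified]] ge
    unfolding F_def by blast
qed

definition carleson :: "('k \<Rightarrow> real) \<Rightarrow> real \<Rightarrow> 'k set \<Rightarrow> bool" where
  "carleson lam C T \<longleftrightarrow> (\<forall>k\<in>T. 0 \<le> lam k \<and>
     (\<Sum>l\<in>{l\<in>T. U l \<subseteq> U k}. lam l) \<le> C * vol (U k))"

lemma carleson_subset:
  assumes "carleson lam C T" "finite T" "S \<subseteq> T"
  shows "carleson lam C S"
  unfolding carleson_def
proof
  fix k assume k: "k \<in> S"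
  have "(\<Sum>l\<in>{l\<in>S. U l \<subseteq> U k}. lam l) \<le> (\<Sum>l\<in>{l\<in>T. U l \<subseteq> U k}. lam l)"
    by (rule sum_mono2) (use assms in \<open>auto simp: carleson_def\<close>)
  then show "0 \<le> lam k \<and> (\<Sum>l\<in>{l\<in>S. U l \<subseteq> U k}. lam l) \<le> C * vol (U k)"
    using assms k by (auto simp: carleson_def intro: order_trans)
qed

lemma carleson_scale:
  assumes "carleson lam C T" "0 \<le> s" "\<And>k. k \<in> T \<Longrightarrow> 0 \<le> lam' k \<and> lam' k \<le> s * lam k"
  shows "carleson lam' (s * C) T"
  unfolding carleson_def
proof
  fix k assume k: "k \<in> T"
  have "(\<Sum>l\<in>{l\<in>T. U l \<subseteq> U k}. lam' l) \<le> s * (\<Sum>l\<in>{l\<in>T. U l \<subseteq> U k}. lam l)"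
    unfolding sum_distrib_left using assms by (intro sum_mono) auto
  also have "\<dots> \<le> s * (C * vol (U k))"
    using assms k by (intro mult_left_mono) (auto simp: carleson_def)
  finally show "0 \<le> lam' k \<and> (\<Sum>l\<in>{l\<in>T. U l \<subseteq> U k}. lam' l) \<le> s * C * vol (U k)"
    using assms k by simp
qed

text \<open>The Carleson condition tests single members only. It passes to unions because a largest
  member absorbs everything that meets it and leaves a family disjoint from it.\<close>

lemma carleson_union:
  assumes "finite T" "T \<subseteq> K" "carleson lam C T"
  shows "sum lam T \<le> C * vol (\<Union>k\<in>T. U k)"
  using assms
proof (induction "card T" arbitrary: T rule: less_induct)
  case less
  show ?case
  proof (cases "T = {}")
    case False
    from largest[OF \<open>finite T\<close> False] obtain k
      where k: "k \<in> T" and le: "\<And>l. l \<in> T \<Longrightarrow> vol (U l) \<le> vol (U k)" by blast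
    have kK: "k \<in> K" using k less.prems by auto
    define T1 where "T1 = {l\<in>T. U l \<subseteq> U k}"
    define T2 where "T2 = {l\<in>T. \<not> U l \<subseteq> U k}"
    have T: "T = T1 \<union> T2" "T1 \<inter> T2 = {}" "k \<in> T1" "k \<notin> T2"
      using k by (auto simp: T1_def T2_def)
    have fin: "finite T1" "finite T2" using less.prems by (auto simp: T1_def T2_def)
    have cd: "card T2 < card T"
      using less.prems T by (intro psubset_card_mono) auto
    have O: "(\<Union>l\<in>T2. U l) \<in> bsets" "U k \<in> bsets"
      using fin less.prems U_bsets k by (auto intro!: bsets_UN simp: T2_def)
    have dj: "U k \<inter> (\<Union>l\<in>T2. U l) = {}"
    proof -
      have "U k \<inter> U l = {}" if "l \<in> T2" for l
        using nested_of_measure_le[OF kK, of l] le[of l] that less.prems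
        by (auto simp: T2_def U_def)
      then show ?thesis by blast
    qed
    have UT: "(\<Union>l\<in>T. U l) = U k \<union> (\<Union>l\<in>T2. U l)" using k by (auto simp: T2_def)
    have "sum lam T = sum lam T1 + sum lam T2"
      unfolding T(1) using fin T(2) by (simp add: sum.union_disjoint)
    also have "\<dots> \<le> C * vol (U k) + C * vol (\<Union>l\<in>T2. U l)"
      using less.hyps[OF cd fin(2)] less.prems k carleson_subset[OF less.prems(3,1), of T2]
      by (intro add_mono) (auto simp: carleson_def T1_def T2_def)
    also have "\<dots> = C * vol (\<Union>l\<in>T. U l)"
      using mass_Un[OF locally_integrable_const[of 1] O(2,1) dj] O bsets_Un[OF O(2,1)]
      unfolding UT by (simp add: mass_const distrib_left)
    finally show ?thesis .
  qed simp
qed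

text \<open>A discrete layer-cake argument. The least value \<open>c0\<close> is subtracted from all
  \<open>c k\<close> and from \<open>a\<close>; the removed layer costs
  \<open>c0 * sum lam T\<close>, which \<open>carleson_union\<close> bounds, and the indices that
  attain \<open>c0\<close> drop out. Lower bounds for \<open>a\<close> are asked only on the sets
  \<open>U k\<close>, so that \<open>a - c0\<close> can be used in the induction.\<close>

lemma carleson_embedding:
  assumes "finite T" "T \<subseteq> K" "carleson lam C T" "locally_integrable a"
    "\<And>k x. k \<in> T \<Longrightarrow> x \<in> U k \<Longrightarrow> c k \<le> a x" "\<And>k. k \<in> T \<Longrightarrow> 0 \<le> c k" "0 \<le> C"
  shows "(\<Sum>k\<in>T. lam k * c k) \<le> C * mass a (\<Union>k\<in>T. U k)"
  using assms(1-6)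
proof (induction "card T" arbitrary: T a c rule: less_induct)
  case less
  show ?case
  proof (cases "T = {}")
    case True
    then show ?thesis by (simp add: set_lebesgue_integral_def)
  next
    case False
    define c0 where "c0 = Min (c ` T)"
    have "c0 \<in> c ` T" unfolding c0_def using less.prems False by (intro Min_in) auto
    then obtain k0 where k0: "k0 \<in> T" "c0 = c k0" by auto
    have c0: "c0 \<le> c k" if "k \<in> T" for k
      unfolding c0_def using that less.prems by (intro Min_le) auto
    have c0n: "0 \<le> c0" using k0 less.prems by auto
    define T' where "T' = {k\<in>T. c0 < c k}"
    define O' where "O' = (\<Union>k\<in>T'. U k)"
    define Q where "Q = (\<Union>k\<in>T. U k)"
    have T': "T' \<subseteq> T" "finite T'" "T' \<subseteq> K" using less.prems by (auto simp: T'_def)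
    have cd: "card T' < card T"
      using k0 less.prems by (intro psubset_card_mono) (auto simp: T'_def)
    have O: "O' \<in> bsets" "Q \<in> bsets" "O' \<subseteq> Q"
      unfolding O'_def Q_def using T' less.prems U_bsets by (auto intro!: bsets_UN)
    have li: "locally_integrable (\<lambda>x. a x - c0)"
      using locally_integrable_add[OF less.prems(4) locally_integrable_const[of "- c0"]] by simp
    have "(\<Sum>k\<in>T. lam k * (c k - c0)) = (\<Sum>k\<in>T'. lam k * (c k - c0))"
      using less.prems c0 by (intro sum.mono_neutral_right) (force simp: T'_def)+
    also have "\<dots> \<le> C * mass (\<lambda>x. a x - c0) O'"
      unfolding O'_def
    proof (rule less.hyps[OF cd T'(2,3) carleson_subset[OF less.prems(3,1) T'(1)] li])
      fix k x assume kx: "k \<in> T'" "x \<in> U k"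
      then have "c k \<le> a x" using less.prems(5) T' by auto
      then show "c k - c0 \<le> a x - c0" by simp
    qed (use T'_def in auto)
    also have "\<dots> \<le> C * mass (\<lambda>x. a x - c0) Q"
    proof (intro mult_left_mono[OF _ \<open>0 \<le> C\<close>] mass_mono_set[OF li O])
      fix x assume "x \<in> Q"
      then obtain k where "k \<in> T" "x \<in> U k" by (auto simp: Q_def)
      then show "0 \<le> a x - c0" using less.prems(5)[of k x] c0[of k] by auto
    qed
    also have "mass (\<lambda>x. a x - c0) Q = mass a Q - c0 * vol Q"
      using mass_add[OF less.prems(4) locally_integrable_const[of "- c0"] O(2)] O(2)
      by (simp add: mass_const)
    finally have 1: "(\<Sum>k\<in>T. lam k * (c k - c0)) \<le> C * (mass a Q - c0 * vol Q)" .
    have "c0 * sum lam T \<le> c0 * (C * vol Q)"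
      unfolding Q_def using carleson_union[OF less.prems(1-3)] c0n by (intro mult_left_mono)
    moreover have "(\<Sum>k\<in>T. lam k * c k) = c0 * sum lam T + (\<Sum>k\<in>T. lam k * (c k - c0))"
      by (simp add: sum_distrib_left sum.distrib[symmetric] algebra_simps)
    ultimately show ?thesis using 1 unfolding Q_def by (simp add: algebra_simps)
  qed
qed

end
section \<open>Two-weight estimates\<close>

lemma superadditive_measure: "superadditive (vol)"
  using superadditive_mass[OF locally_integrable_const[of 1]]
  by (auto simp: superadditive_def mass_const bsets_Un)

lemma sum_mult_le_sqrt:
  fixes a b :: "'k \<Rightarrow> real"
  assumes "(\<Sum>k\<in>T. (a k)\<^sup>2) \<le> A" "(\<Sum>k\<in>T. (b k)\<^sup>2) \<le> B"
  shows "(\<Sum>k\<in>T. a k * b k) \<le> sqrt A * sqrt B"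
proof -
  have "(\<Sum>k\<in>T. a k * b k) \<le> (\<Sum>k\<in>T. \<bar>a k\<bar> * \<bar>b k\<bar>)"
    by (intro sum_mono) (metis abs_ge_self abs_mult)
  also have "\<dots> \<le> L2_set a T * L2_set b T" by (rule L2_set_mult_ineq)
  also have "\<dots> \<le> sqrt A * sqrt B"
    unfolding L2_set_def using assms
    by (intro mult_mono) (auto intro!: sum_nonneg order_trans[OF sum_nonneg assms(1)])
  finally show ?thesis .
qed

lemma sqrt_mult_self_left: "0 \<le> m \<Longrightarrow> sqrt (x * m * m) = m * sqrt x"
  by (simp add: real_sqrt_mult)

context laminar
begin

definition av :: "((real^'n) \<Rightarrow> real) \<Rightarrow> 'k \<Rightarrow> real" where
  "av f k = mass f (U k) / vol (U k)"

text \<open>The last factor, here and in \<open>osc\<close>, is what the Haar normalisation leaves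
  behind once masses have been turned into averages.\<close>

definition carl :: "((real^'n) \<Rightarrow> real) \<Rightarrow> ((real^'n) \<Rightarrow> real) \<Rightarrow> 'k \<Rightarrow> real" where
  "carl u p k = \<bar>jump (sq u) k\<bar> * av (sq u) k *
     (mass (\<lambda>x. p x * u x) (U k) / mass (sq u) (U k)) * sqrt (vol (U k))"

definition osc :: "((real^'n) \<Rightarrow> real) \<Rightarrow> ((real^'n) \<Rightarrow> real) \<Rightarrow> 'k \<Rightarrow> real" where
  "osc u p k = \<bar>jump u k\<bar> * av u k * av p k * sqrt (vol (U k))"

lemma mass_av: "k \<in> K \<Longrightarrow> mass f (U k) = av f k * vol (U k)"
  using U_pos[of k] by (simp add: av_def)

lemma av_nonneg: "(\<And>x. 0 \<le> f x) \<Longrightarrow> 0 \<le> av f k"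
  unfolding av_def by (intro divide_nonneg_nonneg mass_nonneg) auto

lemma av_pos: "locally_integrable f \<Longrightarrow> (\<And>x. 0 < f x) \<Longrightarrow> k \<in> K \<Longrightarrow> 0 < av f k"
  unfolding av_def by (intro divide_pos_pos mass_pos U_pos U_bsets) auto

lemma av_Cauchy_Schwarz:
  assumes "loc_L2 f" "loc_L2 g" "k \<in> K"
  shows "(av (\<lambda>x. f x * g x) k)\<^sup>2 \<le> av (sq f) k * av (sq g) k"
  using mass_Cauchy_Schwarz[OF assms(1,2) U_bsets[OF assms(3)]] U_pos[OF assms(3)]
  by (simp add: av_def power_divide divide_simps power2_eq_square)

end

section \<open>Two functions with product one: their Carleson sequences and weighted square
  sums\<close>

locale two_weight = laminar P N K
  for P N :: "'k \<Rightarrow> (real^'n) set" and K :: "'k set" +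
  fixes h g :: "(real^'n) \<Rightarrow> real" and Q :: real and T :: "'k set" and B :: "(real^'n) set"
  assumes h_L2: "loc_L2 h" and g_L2: "loc_L2 g"
    and h_pos: "0 < h x" and g_pos: "0 < g x" and h_g: "h x * g x = 1"
    and A2_bound: "k \<in> K \<Longrightarrow> av (sq h) k * av (sq g) k \<le> Q"
    and Q_ge_1: "1 \<le> Q"
    and T_finite: "finite T" and T_K: "T \<subseteq> K" and B_bsets: "B \<in> bsets"
    and T_B: "k \<in> T \<Longrightarrow> P k \<union> N k \<subseteq> B"
begin

text \<open>The hypotheses are symmetric, so every estimate is also available with \<open>h\<close>
  and \<open>g\<close> exchanged.\<close>

lemma swap: "two_weight P N K g h Q T B"
  using laminar_axioms h_L2 g_L2 h_pos g_pos h_g A2_bound Q_ge_1 T_finite T_K B_bsets T_B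
  by (intro two_weight.intro two_weight_axioms.intro) (auto simp: mult.commute)

abbreviation "V \<equiv> av (sq h)"
abbreviation "W \<equiv> av (sq g)"
abbreviation "m k \<equiv> vol (U k)"

lemma U_B: "k \<in> T \<Longrightarrow> U k \<subseteq> B"
  using T_B by (simp add: U_def)

lemma h2_int: "locally_integrable (sq h)" and g2_int: "locally_integrable (sq g)"
  using h_L2 g_L2 by (auto simp: loc_L2_def)

lemma h2_pos: "0 < (h x)\<^sup>2" and g2_pos: "0 < (g x)\<^sup>2"
  using h_pos[of x] g_pos[of x] by auto

lemma V_pos: "k \<in> K \<Longrightarrow> 0 < V k" and W_pos: "k \<in> K \<Longrightarrow> 0 < W k"
  by (auto intro: av_pos h2_int g2_int h2_pos g2_pos)

lemma H_pos: "k \<in> K \<Longrightarrow> 0 < av h k"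
  by (auto intro: av_pos h_pos loc_L2_locally_integrable h_L2)

lemma H_sq_le: "k \<in> K \<Longrightarrow> (av h k)\<^sup>2 \<le> V k"
  using av_Cauchy_Schwarz[OF h_L2 loc_L2_one, of k] U_pos[of k]
  by (simp add: av_def mass_const U_bsets)

lemma one_le_VW: "k \<in> K \<Longrightarrow> 1 \<le> V k * W k"
  using av_Cauchy_Schwarz[OF h_L2 g_L2, of k] U_pos[of k]
  by (simp add: h_g) (simp add: av_def mass_const U_bsets)

text \<open>With \<open>R\<close> the geometric mean of the mass of \<open>sq g\<close> and the
  volume, the Bellman function becomes the volume times the fourth root of \<open>V k * W k\<close>.
  It is superadditive and at most the fourth root of \<open>Q\<close> times the volume, which is the
  Carleson condition.\<close>

lemma carleson_jump_sq:
  "carleson (\<lambda>k. (jump (sq h) k)\<^sup>2 * (sqrt (sqrt (V k * W k)) * m k)) (16 * sqrt (sqrt Q)) T"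
  unfolding carleson_def
proof
  fix k assume kT: "k \<in> T"
  then have k: "k \<in> K" using T_K by auto
  define R where "R A = sqrt (mass (sq g) A * vol A)" for A
  have R: "superadditive R"
    unfolding R_def
    by (intro superadditive_sqrt superadditive_mass superadditive_measure g2_int) auto
  have e: "sqrt (sqrt (mass (sq h) (U l) * m l) * R (U l)) = sqrt (sqrt (V l * W l)) * m l"
    if "l \<in> K" for l
  proof -
    have "sqrt (mass (sq h) (U l) * m l) * R (U l) = sqrt (V l * W l) * m l * m l"
      by (simp add: R_def mass_av that sqrt_mult_self_left) (simp add: real_sqrt_mult)
    then show ?thesis by (simp add: sqrt_mult_self_left)
  qed
  have "(\<Sum>l\<in>{l\<in>T. U l \<subseteq> U k}. (jump (sq h) l)\<^sup>2 * (sqrt (sqrt (V l * W l)) * m l))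
      = (\<Sum>l\<in>{l\<in>T. U l \<subseteq> U k}. (jump (sq h) l)\<^sup>2 *
          sqrt (sqrt (mass (sq h) (U l) * m l) * R (U l)))"
    using T_K by (intro sum.cong refl) (auto simp: e)
  also have "\<dots> \<le> 16 * sqrt (sqrt (mass (sq h) (U k) * m k) * R (U k))"
    by (rule sum_jump_bellman[OF h2_int h2_pos R]) (use T_finite T_K U_bsets k in auto)
  also have "\<dots> = 16 * (sqrt (sqrt (V k * W k)) * m k)" using k by (simp add: e)
  also have "\<dots> \<le> 16 * sqrt (sqrt Q) * m k"
    using A2_bound[OF k] by (simp add: mult_right_mono)
  finally show "0 \<le> (jump (sq h) k)\<^sup>2 * (sqrt (sqrt (V k * W k)) * m k) \<and>
      (\<Sum>l\<in>{l\<in>T. U l \<subseteq> U k}. (jump (sq h) l)\<^sup>2 * (sqrt (sqrt (V l * W l)) * m l))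
        \<le> 16 * sqrt (sqrt Q) * m k"
    using V_pos[OF k] W_pos[OF k] by simp
qed

text \<open>The jump is now that of \<open>h\<close> itself, so the mean of \<open>h\<close>
  replaces \<open>V\<close> in the Bellman function. One more root inside \<open>R\<close> makes the
  exponents \<open>1/4\<close> for that mean and \<open>1/8\<close> for \<open>W\<close>; their
  product is the eighth root of \<open>(av h k)\<^sup>2 * W k\<close>, bounded through
  \<open>H_sq_le\<close> and the bound on \<open>V k * W k\<close>.\<close>

lemma carleson_jump:
  "carleson (\<lambda>k. (jump h k)\<^sup>2 * (sqrt (sqrt (sqrt ((av h k)\<^sup>2 * W k))) * m k))
     (16 * sqrt (sqrt (sqrt Q))) T"
  unfolding carleson_def
proof
  fix k assume kT: "k \<in> T"
  then have k: "k \<in> K" using T_K by auto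
  define R where
    "R A = sqrt (vol A * sqrt (mass (sq g) A * vol A))" for A
  have R: "superadditive R"
    unfolding R_def
    by (intro superadditive_sqrt superadditive_mass superadditive_measure g2_int) auto
  have e: "sqrt (sqrt (mass h (U l) * m l) * R (U l)) = sqrt (sqrt (sqrt ((av h l)\<^sup>2 * W l))) * m l"
    if l: "l \<in> K" for l
  proof -
    have "R (U l) = sqrt (m l * (m l * sqrt (W l)))"
      by (simp only: R_def mass_av[OF l] sqrt_mult_self_left[OF measure_nonneg])
    also have "m l * (m l * sqrt (W l)) = sqrt (W l) * m l * m l" by (simp only: mult_ac)
    finally have "R (U l) = sqrt (sqrt (W l) * m l * m l)" .
    then have "R (U l) = m l * sqrt (sqrt (W l))" by (simp add: sqrt_mult_self_left)
    moreover have "sqrt ((av h l)\<^sup>2 * W l) = av h l * sqrt (W l)"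
      using H_pos[OF l] by (simp add: real_sqrt_mult)
    ultimately have "sqrt (mass h (U l) * m l) * R (U l)
        = sqrt (sqrt ((av h l)\<^sup>2 * W l)) * m l * m l"
      by (simp add: mass_av l sqrt_mult_self_left) (simp add: real_sqrt_mult)
    then show ?thesis by (simp add: sqrt_mult_self_left)
  qed
  have "(\<Sum>l\<in>{l\<in>T. U l \<subseteq> U k}. (jump h l)\<^sup>2 * (sqrt (sqrt (sqrt ((av h l)\<^sup>2 * W l))) * m l))
      = (\<Sum>l\<in>{l\<in>T. U l \<subseteq> U k}. (jump h l)\<^sup>2 * sqrt (sqrt (mass h (U l) * m l) * R (U l)))"
    using T_K by (intro sum.cong refl) (auto simp: e)
  also have "\<dots> \<le> 16 * sqrt (sqrt (mass h (U k) * m k) * R (U k))"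
    by (rule sum_jump_bellman[OF loc_L2_locally_integrable[OF h_L2] h_pos R])
      (use T_finite T_K U_bsets k in auto)
  also have "\<dots> = 16 * (sqrt (sqrt (sqrt ((av h k)\<^sup>2 * W k))) * m k)" using k by (simp add: e)
  also have "\<dots> \<le> 16 * sqrt (sqrt (sqrt Q)) * m k"
  proof -
    have "(av h k)\<^sup>2 * W k \<le> Q"
      using mult_right_mono[OF H_sq_le[OF k], of "W k"] W_pos[OF k] A2_bound[OF k] by linarith
    then show ?thesis by (simp add: mult_right_mono)
  qed
  finally show "0 \<le> (jump h k)\<^sup>2 * (sqrt (sqrt (sqrt ((av h k)\<^sup>2 * W k))) * m k) \<and>
      (\<Sum>l\<in>{l\<in>T. U l \<subseteq> U k}. (jump h l)\<^sup>2 * (sqrt (sqrt (sqrt ((av h l)\<^sup>2 * W l))) * m l))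
        \<le> 16 * sqrt (sqrt (sqrt Q)) * m k"
    using W_pos[OF k] by simp
qed

text \<open>\<open>x k ^ Suc j\<close> is at most \<open>q ^ j * x k\<close>. The small exponents
  forced by concavity are thereby raised to the ones needed, and the constant is the same power of
  \<open>q\<close> as if the larger exponent had been admissible from the start.\<close>

lemma carleson_power:
  assumes C: "carleson (\<lambda>k. (a k)\<^sup>2 * (x k * m k)) C T"
    and x: "\<And>k. k \<in> T \<Longrightarrow> 0 \<le> x k" "\<And>k. k \<in> T \<Longrightarrow> x k \<le> q" and q: "0 \<le> q"
  shows "carleson (\<lambda>k. (a k)\<^sup>2 * (x k ^ Suc j * m k)) (q ^ j * C) T"
proof (rule carleson_scale[OF C])
  fix k assume k: "k \<in> T"
  have "x k ^ j * ((a k)\<^sup>2 * (x k * m k)) \<le> q ^ j * ((a k)\<^sup>2 * (x k * m k))"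
    using x(1,2)[OF k] by (intro mult_right_mono power_mono) auto
  then show "0 \<le> (a k)\<^sup>2 * (x k ^ Suc j * m k) \<and>
      (a k)\<^sup>2 * (x k ^ Suc j * m k) \<le> q ^ j * ((a k)\<^sup>2 * (x k * m k))"
    using x(1)[OF k] by (simp add: mult_ac)
qed (use q in simp)

lemma sqrt_sqrt_power:
  assumes "0 \<le> t"
  shows "sqrt (sqrt t) ^ Suc 1 = sqrt t" "sqrt (sqrt t) ^ Suc 3 = t"
    "sqrt (sqrt (sqrt t)) ^ Suc 3 = sqrt t" "sqrt (sqrt (sqrt t)) ^ Suc 7 = t"
  using assms by (simp_all add: numeral_eq_Suc mult.assoc[symmetric])

lemma carleson_jump_sq_half:
    "carleson (\<lambda>k. (jump (sq h) k)\<^sup>2 * (sqrt (V k * W k) * m k)) (16 * sqrt Q) T" (is ?half)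
  and carleson_jump_sq_full:
    "carleson (\<lambda>k. (jump (sq h) k)\<^sup>2 * (V k * W k * m k)) (16 * Q) T" (is ?full)
proof -
  define q where "q = sqrt (sqrt Q)"
  have t: "0 \<le> V k * W k" for k by (intro mult_nonneg_nonneg av_nonneg) auto
  have "sqrt (sqrt (V k * W k)) \<le> q" if "k \<in> T" for k
    using A2_bound T_K that by (auto simp: q_def)
  moreover have "0 \<le> sqrt (sqrt (V k * W k))" for k using t by simp
  moreover have q: "0 \<le> q" "q ^ Suc 1 = sqrt Q" "q ^ Suc 3 = Q"
    using sqrt_sqrt_power[of Q] Q_ge_1 by (auto simp: q_def simp del: power_Suc)
  ultimately have P: "carleson (\<lambda>k. (jump (sq h) k)\<^sup>2 * (sqrt (sqrt (V k * W k)) ^ Suc j * m k))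
      (q ^ j * (16 * q)) T" for j
    unfolding q_def by (intro carleson_power[OF carleson_jump_sq])
  have "q ^ j * (16 * q) = 16 * q ^ Suc j" for j by (simp only: power_Suc mult_ac)
  from this[of 1] this[of 3] have e: "q ^ 1 * (16 * q) = 16 * sqrt Q" "q ^ 3 * (16 * q) = 16 * Q"
    unfolding q .
  show ?half ?full
    using P[of 1] P[of 3] unfolding sqrt_sqrt_power[OF t] e .
qed

lemma carleson_jump_half:
    "carleson (\<lambda>k. (jump h k)\<^sup>2 * (sqrt ((av h k)\<^sup>2 * W k) * m k)) (16 * sqrt Q) T" (is ?half)
  and carleson_jump_full:
    "carleson (\<lambda>k. (jump h k)\<^sup>2 * ((av h k)\<^sup>2 * W k * m k)) (16 * Q) T" (is ?full)
proof -
  \<comment> \<open>An eighth root, so the exponents \<open>Suc 3\<close> and \<open>Suc 7\<close>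
    yield \<open>sqrt Q\<close> and \<open>Q\<close>.\<close>
  define q where "q = sqrt (sqrt (sqrt Q))"
  have t: "0 \<le> (av h k)\<^sup>2 * W k" for k by (intro mult_nonneg_nonneg av_nonneg) auto
  have "sqrt (sqrt (sqrt ((av h k)\<^sup>2 * W k))) \<le> q" if "k \<in> T" for k
  proof -
    have k: "k \<in> K" using that T_K by auto
    have "(av h k)\<^sup>2 * W k \<le> Q"
      using mult_right_mono[OF H_sq_le[OF k], of "W k"] W_pos[OF k] A2_bound[OF k] by linarith
    then show ?thesis by (simp add: q_def)
  qed
  moreover have "0 \<le> sqrt (sqrt (sqrt ((av h k)\<^sup>2 * W k)))" for k using t by simp
  moreover have q: "0 \<le> q" "q ^ Suc 3 = sqrt Q" "q ^ Suc 7 = Q"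
    using sqrt_sqrt_power[of Q] Q_ge_1 by (auto simp: q_def simp del: power_Suc)
  ultimately have P: "carleson (\<lambda>k. (jump h k)\<^sup>2 * (sqrt (sqrt (sqrt ((av h k)\<^sup>2 * W k))) ^ Suc j * m k))
      (q ^ j * (16 * q)) T" for j
    unfolding q_def by (intro carleson_power[OF carleson_jump])
  have "q ^ j * (16 * q) = 16 * q ^ Suc j" for j by (simp only: power_Suc mult_ac)
  from this[of 3] this[of 7] have e: "q ^ 3 * (16 * q) = 16 * sqrt Q" "q ^ 7 * (16 * q) = 16 * Q"
    unfolding q .
  show ?half ?full
    using P[of 3] P[of 7] unfolding sqrt_sqrt_power[OF t] e .
qed

lemma embedding_B:
  assumes "carleson lam C T" "0 \<le> C" "locally_integrable a" "\<And>x. 0 \<le> a x"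
    "\<And>k x. k \<in> T \<Longrightarrow> x \<in> U k \<Longrightarrow> c k \<le> a x" "\<And>k. k \<in> T \<Longrightarrow> 0 \<le> c k"
  shows "(\<Sum>k\<in>T. lam k * c k) \<le> C * mass a B"
proof -
  have "(\<Union>k\<in>T. U k) \<in> bsets" using T_finite T_K U_bsets by (auto intro!: bsets_UN)
  then have "mass a (\<Union>k\<in>T. U k) \<le> mass a B"
    using assms B_bsets U_B by (intro mass_mono_set) blast+
  then show ?thesis
    using carleson_embedding[OF T_finite T_K assms(1,3,5,6,2)] assms(2)
    by (meson mult_left_mono order_trans)
qed

text \<open>The unweighted maximal function dominates \<open>av p k\<close> on all of
  \<open>U k\<close>, so Carleson embedding applies with its square; the factor 4 is the maximal
  bound.\<close>

lemma osc_bound: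
  assumes p: "loc_L2 p" "\<And>x. 0 \<le> p x" and lam: "carleson lam C T" "0 \<le> C"
  shows "(\<Sum>k\<in>T. lam k * (av p k)\<^sup>2) \<le> 4 * C * mass (sq p) B"
proof -
  obtain M where M: "M \<in> borel_measurable lebesgue" "\<And>x. 0 \<le> M x" "loc_L2 (\<lambda>x. 1 * M x)"
    "loc_L2 M" "\<And>k x. k \<in> T \<Longrightarrow> x \<in> U k \<Longrightarrow> mass (\<lambda>x. p x * 1) (U k) / mass (\<lambda>x. 1\<^sup>2) (U k) \<le> M x"
    "mass (\<lambda>x. (1 * M x)\<^sup>2) B \<le> 4 * mass (sq p) B"
    by (rule maximal_function[OF p loc_L2_one zero_less_one T_finite T_K B_bsets U_B], assumption)
      (rule that; assumption)
  have le: "av p k \<le> M x" if "k \<in> T" "x \<in> U k" for k x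
    using M(5)[OF that] that T_K U_bsets[of k] by (simp add: av_def mass_const subset_iff)
  have "(\<Sum>k\<in>T. lam k * (av p k)\<^sup>2) \<le> C * mass (\<lambda>x. (M x)\<^sup>2) B"
  proof (rule embedding_B[OF lam])
    show "locally_integrable (\<lambda>x. (M x)\<^sup>2)" using M(4) by (simp add: loc_L2_def)
    show "(av p k)\<^sup>2 \<le> (M x)\<^sup>2" if "k \<in> T" "x \<in> U k" for k x
      using le[OF that] by (intro power_mono av_nonneg p(2))
  qed simp_all
  also have "\<dots> \<le> C * (4 * mass (sq p) B)"
    using M(6) lam(2) by (intro mult_left_mono) auto
  finally show ?thesis by simp
qed

lemma sum_osc:
  assumes p: "loc_L2 p" "\<And>x. 0 \<le> p x"
  shows "(\<Sum>k\<in>T. (sqrt (W k) * osc h p k)\<^sup>2) \<le> 64 * Q * mass (sq p) B"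
proof -
  have "(\<Sum>k\<in>T. (sqrt (W k) * osc h p k)\<^sup>2)
      = (\<Sum>k\<in>T. (jump h k)\<^sup>2 * ((av h k)\<^sup>2 * W k * m k) * (av p k)\<^sup>2)"
    using W_pos T_K less_imp_le by (intro sum.cong refl)
      (auto simp: osc_def power_mult_distrib subset_iff mult_ac)
  also have "\<dots> \<le> 4 * (16 * Q) * mass (sq p) B"
    by (rule osc_bound[OF p carleson_jump_full]) (use Q_ge_1 in auto)
  finally show ?thesis by simp
qed

text \<open>The weight is chosen so that, with the roles of \<open>h\<close> and \<open>g\<close>
  exchanged, it cancels the one in \<open>sum_carl_half\<close>. It gains half a power of
  \<open>Q\<close>: for \<open>r = (av h k)\<^sup>2 * W k\<close>, which is at most
  \<open>V k * W k\<close>, the quotient \<open>r / sqrt (V k * W k)\<close> is at most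
  \<open>sqrt r\<close>.\<close>

lemma sum_osc_half:
  assumes p: "loc_L2 p" "\<And>x. 0 \<le> p x"
  shows "(\<Sum>k\<in>T. (osc h p k * sqrt (W k / sqrt (V k * W k)))\<^sup>2)
    \<le> 64 * sqrt Q * mass (sq p) B"
proof -
  have "(\<Sum>k\<in>T. (osc h p k * sqrt (W k / sqrt (V k * W k)))\<^sup>2)
      \<le> (\<Sum>k\<in>T. (jump h k)\<^sup>2 * (sqrt ((av h k)\<^sup>2 * W k) * m k) * (av p k)\<^sup>2)"
  proof (rule sum_mono)
    fix k assume "k \<in> T"
    then have k: "k \<in> K" using T_K by auto
    define r where "r = (av h k)\<^sup>2 * W k"
    have r: "0 < r" "r \<le> V k * W k"
      using H_pos[OF k] W_pos[OF k] H_sq_le[OF k] by (auto simp: r_def intro: mult_right_mono)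
    have "r / sqrt (V k * W k) \<le> r / sqrt r"
      using r by (intro divide_left_mono) auto
    also have "\<dots> = sqrt r" using r(1) by (simp add: real_div_sqrt)
    finally have le: "(av h k)\<^sup>2 * (W k / sqrt (V k * W k)) \<le> sqrt ((av h k)\<^sup>2 * W k)"
      by (simp add: r_def)
    have "(osc h p k * sqrt (W k / sqrt (V k * W k)))\<^sup>2
        = (osc h p k)\<^sup>2 * (W k / sqrt (V k * W k))"
      using W_pos[OF k] V_pos[OF k] by (simp add: power_mult_distrib)
    also have "\<dots> = ((jump h k)\<^sup>2 * (av p k)\<^sup>2 * m k) * ((av h k)\<^sup>2 * (W k / sqrt (V k * W k)))"
      by (simp add: osc_def power_mult_distrib mult_ac)
    also have "\<dots> \<le> ((jump h k)\<^sup>2 * (av p k)\<^sup>2 * m k) * sqrt ((av h k)\<^sup>2 * W k)"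
      by (intro mult_left_mono le) auto
    finally show "(osc h p k * sqrt (W k / sqrt (V k * W k)))\<^sup>2
        \<le> (jump h k)\<^sup>2 * (sqrt ((av h k)\<^sup>2 * W k) * m k) * (av p k)\<^sup>2"
      by (simp add: mult_ac)
  qed
  also have "\<dots> \<le> 4 * (16 * sqrt Q) * mass (sq p) B"
    by (rule osc_bound[OF p carleson_jump_half]) (use Q_ge_1 in auto)
  finally show ?thesis by simp
qed

lemma wav_nonneg:
  assumes "\<And>x. 0 \<le> p x"
  shows "0 \<le> mass (\<lambda>x. p x * h x) (U k) / mass (sq h) (U k)"
  using assms h_pos less_imp_le
  by (intro divide_nonneg_nonneg mass_nonneg) (auto intro!: mult_nonneg_nonneg)

lemma maximal_h:
  assumes p: "loc_L2 p" "\<And>x. 0 \<le> p x"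
  obtains M where "M \<in> borel_measurable lebesgue" "\<And>x. 0 \<le> M x" "loc_L2 (\<lambda>x. h x * M x)"
    "loc_L2 M"
    "\<And>k x. k \<in> T \<Longrightarrow> x \<in> U k \<Longrightarrow>
      mass (\<lambda>x. p x * h x) (U k) / mass (sq h) (U k) \<le> M x"
    "mass (\<lambda>x. (h x * M x)\<^sup>2) B \<le> 4 * mass (sq p) B"
  by (rule maximal_function[OF p h_L2 h_pos T_finite T_K B_bsets U_B], assumption)
    (rule that; assumption)

text \<open>Because \<open>h * g\<close> is one, \<open>M1 * M2\<close> is the product of
  \<open>h * M1\<close> and \<open>g * M2\<close>, and Cauchy--Schwarz pairs the two weighted norms
  without any loss in \<open>Q\<close>.\<close>

lemma mass_mult_weights:
  assumes "loc_L2 (\<lambda>x. h x * M1 x)" "loc_L2 (\<lambda>x. g x * M2 x)"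
    "mass (\<lambda>x. (h x * M1 x)\<^sup>2) B \<le> a" "mass (\<lambda>x. (g x * M2 x)\<^sup>2) B \<le> b"
  shows "mass (\<lambda>x. M1 x * M2 x) B \<le> sqrt (a * b)" "locally_integrable (\<lambda>x. M1 x * M2 x)"
proof -
  have e: "(h x * M1 x) * (g x * M2 x) = M1 x * M2 x" for x
  proof -
    have "(h x * M1 x) * (g x * M2 x) = (h x * g x) * (M1 x * M2 x)" by (simp only: mult_ac)
    then show ?thesis by (simp only: h_g mult_1)
  qed
  have "(mass (\<lambda>x. M1 x * M2 x) B)\<^sup>2 \<le> mass (\<lambda>x. (h x * M1 x)\<^sup>2) B * mass (\<lambda>x. (g x * M2 x)\<^sup>2) B"
    using mass_Cauchy_Schwarz[OF assms(1,2) B_bsets] by (simp add: e)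
  also have "\<dots> \<le> a * b"
    using assms(3,4) mass_nonneg[of B "\<lambda>x. (h x * M1 x)\<^sup>2"]
    by (intro mult_mono) (auto intro!: mass_nonneg)
  finally show "mass (\<lambda>x. M1 x * M2 x) B \<le> sqrt (a * b)" by (rule real_le_rsqrt)
  show "locally_integrable (\<lambda>x. M1 x * M2 x)"
    using loc_L2_mult[OF assms(1,2)] by (simp add: e)
qed

text \<open>The averages are controlled by two iterated weighted maximal functions, as in proofs of
  the sharp weighted maximal bound. \<open>M1\<close> dominates the average \<open>F k\<close> on
  \<open>U k\<close>, hence \<open>F k\<close> is at most the mean of \<open>M1\<close>; replacing
  \<open>V k\<close> by \<open>Q / W k\<close> turns that mean into an average of \<open>M1\<close>
  against \<open>sq g\<close>, which \<open>M2\<close> dominates. So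
  \<open>V k * (F k)\<^sup>2\<close> is at most \<open>Q * (M1 x * M2 x)\<close> on
  \<open>U k\<close>. The remaining \<open>sqrt Q\<close> is the constant of
  \<open>carleson_jump_sq_half\<close>.\<close>

lemma sum_carl_half:
  assumes p: "loc_L2 p" "\<And>x. 0 \<le> p x"
  shows "(\<Sum>k\<in>T. (carl h p k * sqrt (sqrt (V k * W k) / V k))\<^sup>2)
    \<le> 128 * (Q * sqrt Q) * mass (sq p) B"
proof -
  define F where "F k = mass (\<lambda>x. p x * h x) (U k) / mass (sq h) (U k)" for k
  define n where "n = mass (sq p) B"
  have n: "0 \<le> n" unfolding n_def by (intro mass_nonneg) auto
  obtain M1 where M1: "M1 \<in> borel_measurable lebesgue" "\<And>x. 0 \<le> M1 x" "loc_L2 (\<lambda>x. h x * M1 x)"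
    "loc_L2 M1" "\<And>k x. k \<in> T \<Longrightarrow> x \<in> U k \<Longrightarrow> F k \<le> M1 x"
    "mass (\<lambda>x. (h x * M1 x)\<^sup>2) B \<le> 4 * n"
    unfolding F_def n_def by (rule maximal_h[OF p]) (rule that[unfolded F_def n_def]; assumption)
  have q0: "0 \<le> h x * M1 x" for x using h_pos M1(2) less_imp_le by (intro mult_nonneg_nonneg) auto
  have e: "h x * M1 x * g x = M1 x" for x
  proof -
    have "h x * M1 x * g x = (h x * g x) * M1 x" by (simp only: mult_ac)
    then show ?thesis by (simp only: h_g mult_1)
  qed
  \<comment> \<open>The maximal function for \<open>g\<close> is applied to \<open>h * M1\<close>,
    whose product with \<open>g\<close> is \<open>M1\<close>.\<close>
  obtain M2 where M2: "M2 \<in> borel_measurable lebesgue" "\<And>x. 0 \<le> M2 x" "loc_L2 (\<lambda>x. g x * M2 x)" "loc_L2 M2"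
    "\<And>k x. k \<in> T \<Longrightarrow> x \<in> U k \<Longrightarrow> mass M1 (U k) / mass (sq g) (U k) \<le> M2 x"
    "mass (\<lambda>x. (g x * M2 x)\<^sup>2) B \<le> 4 * mass (\<lambda>x. (h x * M1 x)\<^sup>2) B"
    by (rule two_weight.maximal_h[OF swap M1(3) q0, unfolded e]) (rule that; assumption)
  \<comment> \<open>Each maximal function costs a factor 4, and \<open>M2\<close> is built on top of
    \<open>M1\<close>, hence \<open>16 * n\<close>.\<close>
  have M12: "mass (\<lambda>x. M1 x * M2 x) B \<le> sqrt (4 * n * (16 * n))" "locally_integrable (\<lambda>x. M1 x * M2 x)"
    by (rule mass_mult_weights[OF M1(3) M2(3)]; use M1(6) M2(6) in simp)+
  have M12': "mass (\<lambda>x. M1 x * M2 x) B \<le> 8 * n"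
  proof -
    have "4 * n * (16 * n) = (8 * n)\<^sup>2" by (simp add: power2_eq_square)
    from M12(1)[unfolded this real_sqrt_abs] show ?thesis using n by simp
  qed
  have F0: "0 \<le> F k" for k unfolding F_def by (rule wav_nonneg[OF p(2)])
  have "(\<Sum>k\<in>T. (carl h p k * sqrt (sqrt (V k * W k) / V k))\<^sup>2)
      = (\<Sum>k\<in>T. (jump (sq h) k)\<^sup>2 * (sqrt (V k * W k) * m k) * (V k * (F k)\<^sup>2))"
  proof (rule sum.cong[OF refl])
    fix k assume "k \<in> T"
    then have k: "k \<in> K" using T_K by auto
    have "(carl h p k * sqrt (sqrt (V k * W k) / V k))\<^sup>2
        = (carl h p k)\<^sup>2 * (sqrt (V k * W k) / V k)"
      using V_pos[OF k] W_pos[OF k] by (simp add: power_mult_distrib)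
    also have "(carl h p k)\<^sup>2 = (jump (sq h) k)\<^sup>2 * (V k)\<^sup>2 * (F k)\<^sup>2 * m k"
      unfolding carl_def F_def[symmetric] by (simp add: power_mult_distrib)
    also have "\<dots> * (sqrt (V k * W k) / V k)
        = (jump (sq h) k)\<^sup>2 * (sqrt (V k * W k) * m k) * (V k * (F k)\<^sup>2)"
      using V_pos[OF k] by (simp add: field_simps power2_eq_square)
    finally show "(carl h p k * sqrt (sqrt (V k * W k) / V k))\<^sup>2
        = (jump (sq h) k)\<^sup>2 * (sqrt (V k * W k) * m k) * (V k * (F k)\<^sup>2)" .
  qed
  also have "\<dots> \<le> 16 * sqrt Q * mass (\<lambda>x. Q * (M1 x * M2 x)) B"
  proof (rule embedding_B[OF carleson_jump_sq_half])
    fix k x assume kx: "k \<in> T" "x \<in> U k"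
    then have k: "k \<in> K" using T_K by auto
    have Fm: "F k \<le> av M1 k"
    proof -
      have "mass (\<lambda>x. F k) (U k) \<le> mass M1 (U k)"
        using M1(4,5) kx k
        by (intro mass_mono locally_integrable_const loc_L2_locally_integrable U_bsets) auto
      then show ?thesis using U_pos[OF k] U_bsets[OF k] by (simp add: av_def mass_const field_simps)
    qed
    have "V k * F k \<le> Q / W k * F k"
      using A2_bound[OF k] W_pos[OF k] F0 by (intro mult_right_mono) (auto simp: field_simps)
    also have "\<dots> \<le> Q / W k * av M1 k"
      using Fm Q_ge_1 W_pos[OF k] by (intro mult_left_mono) auto
    also have "\<dots> = Q * (mass M1 (U k) / mass (sq g) (U k))"
      using U_pos[OF k] by (simp add: av_def)
    also have "\<dots> \<le> Q * M2 x" using M2(5)[OF kx] Q_ge_1 by (intro mult_left_mono) auto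
    finally have "V k * F k \<le> Q * M2 x" .
    from mult_mono[OF this M1(5)[OF kx]]
    have "(V k * F k) * F k \<le> (Q * M2 x) * M1 x" using F0[of k] Q_ge_1 M2(2)[of x] by simp
    then show "V k * (F k)\<^sup>2 \<le> Q * (M1 x * M2 x)" by (simp add: power2_eq_square mult_ac)
  qed (use Q_ge_1 M1(2) M2(2) M12(2) in
        \<open>auto intro!: locally_integrable_cmult mult_nonneg_nonneg av_nonneg\<close>)
  also have "\<dots> \<le> 16 * sqrt Q * (Q * (8 * n))"
    using M12' Q_ge_1 by (simp add: mult_left_mono)
  finally show ?thesis by (simp add: n_def mult_ac)
qed

text \<open>\<open>W k\<close> equals \<open>V k * W k / V k\<close>, and one of the two factors
  \<open>sqrt (V k * W k)\<close> is replaced by \<open>sqrt Q\<close>.\<close>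

lemma sum_carl:
  assumes p: "loc_L2 p" "\<And>x. 0 \<le> p x"
  shows "(\<Sum>k\<in>T. (sqrt (W k) * carl h p k)\<^sup>2) \<le> 128 * Q\<^sup>2 * mass (sq p) B"
proof -
  have "(\<Sum>k\<in>T. (sqrt (W k) * carl h p k)\<^sup>2)
      \<le> (\<Sum>k\<in>T. sqrt Q * (carl h p k * sqrt (sqrt (V k * W k) / V k))\<^sup>2)"
  proof (rule sum_mono)
    fix k assume "k \<in> T"
    then have k: "k \<in> K" using T_K by auto
    note VW = V_pos[OF k] W_pos[OF k]
    have "W k = sqrt (V k * W k) * sqrt (V k * W k) / V k" using VW by simp
    also have "\<dots> \<le> sqrt Q * sqrt (V k * W k) / V k"
      using VW A2_bound[OF k] by (intro divide_right_mono mult_right_mono) auto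
    finally have "(carl h p k)\<^sup>2 * W k \<le> (carl h p k)\<^sup>2 * (sqrt Q * sqrt (V k * W k) / V k)"
      by (intro mult_left_mono) auto
    then show "(sqrt (W k) * carl h p k)\<^sup>2
        \<le> sqrt Q * (carl h p k * sqrt (sqrt (V k * W k) / V k))\<^sup>2"
      using VW by (simp add: power_mult_distrib mult_ac)
  qed
  also have "\<dots> \<le> sqrt Q * (128 * (Q * sqrt Q) * mass (sq p) B)"
    unfolding sum_distrib_left[symmetric] using sum_carl_half[OF p] Q_ge_1
    by (intro mult_left_mono) auto
  also have "\<dots> = 128 * Q\<^sup>2 * mass (sq p) B"
    using Q_ge_1 by (simp add: power2_eq_square mult_ac)
  finally show ?thesis .
qed

end

section \<open>Pairing the three terms for \<open>h\<close> with the three terms for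
  \<open>g\<close>\<close>

context two_weight
begin

text \<open>Bounding the square sums of the two factors separately would lose powers of
  \<open>Q\<close>. Instead the product of the two jumps is split by the arithmetic--geometric mean
  inequality, and each squared jump forms, with \<open>V k * W k * m k\<close>, a Carleson sequence
  of constant \<open>16 * Q\<close>. The two averages are dominated by
  \<open>M x * M' x\<close>.\<close>

lemma sum_carl_carl:
  assumes p: "loc_L2 p" "\<And>x. 0 \<le> p x" and p': "loc_L2 p'" "\<And>x. 0 \<le> p' x"
  shows "(\<Sum>k\<in>T. carl h p k * carl g p' k)
    \<le> 64 * Q * (sqrt (mass (sq p) B) * sqrt (mass (sq p') B))"
proof -
  interpret s: two_weight P N K g h Q T B by (rule swap)
  define F where "F k = mass (\<lambda>x. p x * h x) (U k) / mass (sq h) (U k)" for k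
  define F' where "F' k = mass (\<lambda>x. p' x * g x) (U k) / mass (sq g) (U k)" for k
  define n where "n = mass (sq p) B"
  define n' where "n' = mass (sq p') B"
  define jv where "jv = jump (sq h)"
  define jw where "jw = jump (sq g)"
  obtain M where M: "M \<in> borel_measurable lebesgue" "\<And>x. 0 \<le> M x" "loc_L2 (\<lambda>x. h x * M x)"
    "loc_L2 M" "\<And>k x. k \<in> T \<Longrightarrow> x \<in> U k \<Longrightarrow> F k \<le> M x"
    "mass (\<lambda>x. (h x * M x)\<^sup>2) B \<le> 4 * n"
    by (rule maximal_h[OF p]) (rule that[unfolded F_def n_def]; assumption)
  obtain M' where M': "M' \<in> borel_measurable lebesgue" "\<And>x. 0 \<le> M' x" "loc_L2 (\<lambda>x. g x * M' x)"
    "loc_L2 M'" "\<And>k x. k \<in> T \<Longrightarrow> x \<in> U k \<Longrightarrow> F' k \<le> M' x"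
    "mass (\<lambda>x. (g x * M' x)\<^sup>2) B \<le> 4 * n'"
    by (rule s.maximal_h[OF p']) (rule that[unfolded F'_def n'_def]; assumption)
  have F0: "0 \<le> F k" "0 \<le> F' k" for k
    unfolding F_def F'_def by (rule wav_nonneg[OF p(2)] s.wav_nonneg[OF p'(2)])+
  have li: "locally_integrable (\<lambda>x. M x * M' x)"
    and MM: "mass (\<lambda>x. M x * M' x) B \<le> 4 * (sqrt n * sqrt n')"
  proof -
    note mm = mass_mult_weights[OF M(3) M'(3) M(6) M'(6)]
    show "locally_integrable (\<lambda>x. M x * M' x)" by (rule mm(2))
    have "4 * n * (4 * n') = 4\<^sup>2 * (n * n')" by simp
    from mm(1)[unfolded this] show "mass (\<lambda>x. M x * M' x) B \<le> 4 * (sqrt n * sqrt n')"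
      by (simp add: real_sqrt_mult)
  qed
  have c: "F k * F' k \<le> M x * M' x" if "k \<in> T" "x \<in> U k" for k x
    using M(5)[OF that] M'(5)[OF that] F0 M(2) by (intro mult_mono) auto
  have MM0: "0 \<le> M x * M' x" for x using M(2) M'(2) by simp
  have FF0: "0 \<le> F k * F' k" for k using F0 by simp
  have "carl h p k * carl g p' k \<le> (jv k)\<^sup>2 * (V k * W k * m k) * (F k * F' k) / 2
      + (jw k)\<^sup>2 * (W k * V k * m k) * (F k * F' k) / 2" if "k \<in> T" for k
  proof -
    have k: "k \<in> K" using that T_K by auto
    have "2 * (\<bar>jv k\<bar> * \<bar>jw k\<bar>) \<le> (jv k)\<^sup>2 + (jw k)\<^sup>2"
      using sum_squares_bound[of "\<bar>jv k\<bar>" "\<bar>jw k\<bar>"] by simp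
    then have "(2 * (\<bar>jv k\<bar> * \<bar>jw k\<bar>)) * (V k * W k * m k * (F k * F' k) / 2)
        \<le> ((jv k)\<^sup>2 + (jw k)\<^sup>2) * (V k * W k * m k * (F k * F' k) / 2)"
      using V_pos[OF k] W_pos[OF k] FF0[of k] by (intro mult_right_mono) auto
    moreover have "carl h p k * carl g p' k
        = (\<bar>jv k\<bar> * \<bar>jw k\<bar>) * (V k * W k * (sqrt (m k) * sqrt (m k)) * (F k * F' k))"
      unfolding carl_def jv_def jw_def F_def F'_def by (simp only: mult_ac)
    ultimately show ?thesis by (simp add: algebra_simps)
  qed
  then have "(\<Sum>k\<in>T. carl h p k * carl g p' k)
      \<le> (\<Sum>k\<in>T. (jv k)\<^sup>2 * (V k * W k * m k) * (F k * F' k) / 2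
        + (jw k)\<^sup>2 * (W k * V k * m k) * (F k * F' k) / 2)" by (rule sum_mono)
  also have "\<dots> = (\<Sum>k\<in>T. (jv k)\<^sup>2 * (V k * W k * m k) * (F k * F' k)) / 2
      + (\<Sum>k\<in>T. (jw k)\<^sup>2 * (W k * V k * m k) * (F k * F' k)) / 2"
    by (simp add: sum.distrib sum_divide_distrib)
  also have "\<dots> \<le> (16 * Q * mass (\<lambda>x. M x * M' x) B) / 2 + (16 * Q * mass (\<lambda>x. M x * M' x) B) / 2"
    unfolding jv_def jw_def using Q_ge_1
    by (intro add_mono divide_right_mono embedding_B[OF carleson_jump_sq_full]
        embedding_B[OF s.carleson_jump_sq_full] li c FF0 MM0) simp_all
  also have "\<dots> = 16 * Q * mass (\<lambda>x. M x * M' x) B" by simp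
  also have "\<dots> \<le> 16 * Q * (4 * (sqrt n * sqrt n'))" using MM Q_ge_1 by (intro mult_left_mono) auto
  finally show ?thesis by (simp add: n_def n'_def)
qed

text \<open>Reciprocal weights are inserted before Cauchy--Schwarz, so that the square sums are of
  size \<open>Q * sqrt Q\<close> and \<open>sqrt Q\<close>. The unweighted choice would not balance
  them.\<close>

lemma sum_carl_osc:
  assumes p: "loc_L2 p" "\<And>x. 0 \<le> p x" and p': "loc_L2 p'" "\<And>x. 0 \<le> p' x"
  shows "(\<Sum>k\<in>T. carl h p k * osc g p' k)
    \<le> 91 * Q * (sqrt (mass (sq p) B) * sqrt (mass (sq p') B))"
proof -
  interpret s: two_weight P N K g h Q T B by (rule swap)
  define n where "n = mass (sq p) B"
  define n' where "n' = mass (sq p') B"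
  have n: "0 \<le> n" "0 \<le> n'" unfolding n_def n'_def by (intro mass_nonneg; simp)+
  have "(\<Sum>k\<in>T. carl h p k * osc g p' k) = (\<Sum>k\<in>T. (carl h p k * sqrt (sqrt (V k * W k) / V k)) *
      (osc g p' k * sqrt (V k / sqrt (W k * V k))))"
  proof (rule sum.cong[OF refl])
    fix k assume "k \<in> T"
    then have k: "k \<in> K" using T_K by auto
    have "sqrt (sqrt (V k * W k) / V k) * sqrt (V k / sqrt (W k * V k)) = 1"
      using V_pos[OF k] W_pos[OF k] by (simp add: real_sqrt_mult[symmetric] mult.commute)
    moreover have "(carl h p k * sqrt (sqrt (V k * W k) / V k)) * (osc g p' k * sqrt (V k / sqrt (W k * V k)))
      = (carl h p k * osc g p' k) * (sqrt (sqrt (V k * W k) / V k) * sqrt (V k / sqrt (W k * V k)))"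
      by (simp only: mult_ac)
    ultimately show "carl h p k * osc g p' k = (carl h p k * sqrt (sqrt (V k * W k) / V k)) *
      (osc g p' k * sqrt (V k / sqrt (W k * V k)))"
      by (simp only: mult_1_right)
  qed
  also have "\<dots> \<le> sqrt (128 * (Q * sqrt Q) * n) * sqrt (64 * sqrt Q * n')"
    unfolding n_def n'_def
    by (rule sum_mult_le_sqrt[OF sum_carl_half[OF p] s.sum_osc_half[OF p']])
  also have "\<dots> = sqrt ((128 * 64) * (Q * Q) * (n * n'))"
  proof -
    have "128 * (Q * sqrt Q) * n * (64 * sqrt Q * n') = (128 * 64) * (Q * (sqrt Q * sqrt Q)) * (n * n')"
      by (simp only: mult_ac)
    then show ?thesis using Q_ge_1 by (simp add: real_sqrt_mult[symmetric])
  qed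
  \<comment> \<open>\<open>128 * 64 = 8192\<close> is just below
    \<open>91\<^sup>2 = 8281\<close>.\<close>
  also have "\<dots> \<le> sqrt (91\<^sup>2 * Q\<^sup>2 * (n * n'))"
    using n by (intro real_sqrt_le_mono mult_right_mono) (auto simp: power2_eq_square)
  also have "\<dots> = 91 * Q * (sqrt n * sqrt n')" using Q_ge_1 by (simp add: real_sqrt_mult)
  finally show ?thesis by (simp add: n_def n'_def)
qed

text \<open>The lower bound \<open>one_le_VW\<close> allows the factor
  \<open>sqrt (W k) * sqrt (V k)\<close> to be inserted, which supplies each \<open>osc\<close> with
  the mean of the opposite weight.\<close>

lemma sum_osc_osc:
  assumes p: "loc_L2 p" "\<And>x. 0 \<le> p x" and p': "loc_L2 p'" "\<And>x. 0 \<le> p' x"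
  shows "(\<Sum>k\<in>T. osc h p k * osc g p' k)
    \<le> 64 * Q * (sqrt (mass (sq p) B) * sqrt (mass (sq p') B))"
proof -
  interpret s: two_weight P N K g h Q T B by (rule swap)
  have "(\<Sum>k\<in>T. osc h p k * osc g p' k) \<le> (\<Sum>k\<in>T. (sqrt (W k) * osc h p k) * (sqrt (V k) * osc g p' k))"
  proof (rule sum_mono)
    fix k assume "k \<in> T"
    then have k: "k \<in> K" using T_K by auto
    have "0 \<le> osc h p k * osc g p' k"
      using av_nonneg[OF p(2)] av_nonneg[OF p'(2)] H_pos[OF k] s.H_pos[OF k] by (simp add: osc_def)
    moreover have "1 \<le> sqrt (W k) * sqrt (V k)"
      using one_le_VW[OF k] by (simp add: real_sqrt_mult[symmetric] mult.commute)
    ultimately have "1 * (osc h p k * osc g p' k) \<le> (sqrt (W k) * sqrt (V k)) * (osc h p k * osc g p' k)"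
      by (intro mult_right_mono)
    then show "osc h p k * osc g p' k \<le> (sqrt (W k) * osc h p k) * (sqrt (V k) * osc g p' k)"
      by (simp only: mult_ac mult_1)
  qed
  also have "\<dots> \<le> sqrt (64 * Q * mass (sq p) B) * sqrt (64 * Q * mass (sq p') B)"
    by (rule sum_mult_le_sqrt[OF sum_osc[OF p] s.sum_osc[OF p']])
  also have "\<dots> = 64 * Q * (sqrt (mass (sq p) B) * sqrt (mass (sq p') B))"
    using Q_ge_1 by (simp add: real_sqrt_mult)
  finally show ?thesis .
qed

text \<open>A local term pairs with any \<open>Z\<close> whose square sum, weighted by
  \<open>V\<close>, grows at most like \<open>Q\<^sup>2\<close>; this serves all five pairs that
  contain a local term.\<close>

lemma sum_local:
  assumes D: "(\<Sum>k\<in>T. (D k)\<^sup>2) \<le> 4 * n" and Z: "(\<Sum>k\<in>T. (sqrt (V k) * Z k)\<^sup>2) \<le> c * Q\<^sup>2 * n'"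
    and n: "0 \<le> n" "0 \<le> n'" and c: "0 \<le> c"
  shows "(\<Sum>k\<in>T. D k * sqrt (V k) * Z k) \<le> 2 * sqrt c * Q * (sqrt n * sqrt n')"
proof -
  have "(\<Sum>k\<in>T. D k * sqrt (V k) * Z k) = (\<Sum>k\<in>T. D k * (sqrt (V k) * Z k))"
    by (simp add: mult.assoc)
  also have "\<dots> \<le> sqrt (4 * n) * sqrt (c * Q\<^sup>2 * n')" by (rule sum_mult_le_sqrt[OF D Z])
  also have "\<dots> = 2 * sqrt c * Q * (sqrt n * sqrt n')" using Q_ge_1 by (simp add: real_sqrt_mult)
  finally show ?thesis .
qed

lemma sum_bilinear:
  assumes p: "loc_L2 p" "\<And>x. 0 \<le> p x" and p': "loc_L2 p'" "\<And>x. 0 \<le> p' x"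
    and D: "(\<Sum>k\<in>T. (D k)\<^sup>2) \<le> 4 * mass (sq p) B"
      "(\<Sum>k\<in>T. (D' k)\<^sup>2) \<le> 4 * mass (sq p') B"
    and D0: "\<And>k. 0 \<le> D k" "\<And>k. 0 \<le> D' k"
  shows "(\<Sum>k\<in>T. (D k * sqrt (V k) + carl h p k + osc h p k)
      * (D' k * sqrt (W k) + carl g p' k + osc g p' k))
    \<le> 500 * Q * (sqrt (mass (sq p) B) * sqrt (mass (sq p') B))"
proof -
  interpret s: two_weight P N K g h Q T B by (rule swap)
  define n where "n = mass (sq p) B"
  define n' where "n' = mass (sq p') B"
  have n: "0 \<le> n" "0 \<le> n'" unfolding n_def n'_def by (intro mass_nonneg; simp)+
  define R where "R = Q * (sqrt n * sqrt n')"
  have R0: "0 \<le> R" using n Q_ge_1 by (simp add: R_def)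
  have QQ: "Q \<le> Q\<^sup>2" using Q_ge_1 by (simp add: power2_eq_square)
  have DD: "(\<Sum>k\<in>T. D k * sqrt (V k) * (D' k * sqrt (W k))) \<le> 4 * R"
  proof -
    have "(\<Sum>k\<in>T. (sqrt (V k) * (D' k * sqrt (W k)))\<^sup>2) \<le> (\<Sum>k\<in>T. Q * (D' k)\<^sup>2)"
    proof (rule sum_mono)
      fix k assume "k \<in> T"
      then have k: "k \<in> K" using T_K by auto
      have "(sqrt (V k) * (D' k * sqrt (W k)))\<^sup>2 = (V k * W k) * (D' k)\<^sup>2"
        using V_pos[OF k] W_pos[OF k] by (simp add: power_mult_distrib)
      also have "\<dots> \<le> Q * (D' k)\<^sup>2" by (intro mult_right_mono A2_bound k) simp
      finally show "(sqrt (V k) * (D' k * sqrt (W k)))\<^sup>2 \<le> Q * (D' k)\<^sup>2" .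
    qed
    also have "\<dots> \<le> Q * (4 * n')"
      unfolding sum_distrib_left[symmetric] using D(2) Q_ge_1 n'_def by (intro mult_left_mono) auto
    \<comment> \<open>The true growth is \<open>Q\<close>; it is enlarged to the form that
      \<open>sum_local\<close> expects.\<close>
    also have "\<dots> \<le> 4 * Q\<^sup>2 * n'" using QQ n mult_right_mono[OF QQ, of "4 * n'"] by simp
    finally have "(\<Sum>k\<in>T. D k * sqrt (V k) * (D' k * sqrt (W k))) \<le> 2 * sqrt 4 * Q * (sqrt n * sqrt n')"
      by (rule sum_local[OF D(1)[folded n_def] _ n]) simp
    then show ?thesis by (simp add: R_def)
  qed
  have sq: "2 * sqrt 128 \<le> (24::real)" "2 * sqrt 64 = (16::real)"
    using real_le_lsqrt[of 12 128] by auto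
  have DF: "(\<Sum>k\<in>T. D k * sqrt (V k) * carl g p' k) \<le> 24 * R"
  proof -
    have "(\<Sum>k\<in>T. D k * sqrt (V k) * carl g p' k) \<le> 2 * sqrt 128 * Q * (sqrt n * sqrt n')"
      by (rule sum_local[OF D(1)[folded n_def] s.sum_carl[OF p', folded n'_def] n]) simp
    also have "\<dots> \<le> 24 * R" unfolding R_def mult.assoc[of _ Q]
      by (rule mult_right_mono[OF sq(1) R0[unfolded R_def]])
    finally show ?thesis .
  qed
  have DH: "(\<Sum>k\<in>T. D k * sqrt (V k) * osc g p' k) \<le> 16 * R"
  proof -
    have "64 * Q * n' \<le> 64 * Q\<^sup>2 * n'" using QQ n by (intro mult_right_mono) auto
    with s.sum_osc[OF p', folded n'_def]
    have "(\<Sum>k\<in>T. (sqrt (V k) * osc g p' k)\<^sup>2) \<le> 64 * Q\<^sup>2 * n'" by linarith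
    from sum_local[OF D(1)[folded n_def] this n] show ?thesis by (simp add: R_def sq)
  qed
  have FD: "(\<Sum>k\<in>T. D' k * sqrt (W k) * carl h p k) \<le> 24 * R"
  proof -
    have "(\<Sum>k\<in>T. D' k * sqrt (W k) * carl h p k) \<le> 2 * sqrt 128 * Q * (sqrt n' * sqrt n)"
      by (rule s.sum_local[OF D(2)[folded n'_def] sum_carl[OF p, folded n_def] n(2,1)]) simp
    also have "\<dots> = (2 * sqrt 128) * R" by (simp add: R_def mult_ac)
    also have "\<dots> \<le> 24 * R" by (rule mult_right_mono[OF sq(1) R0])
    finally show ?thesis .
  qed
  have HD: "(\<Sum>k\<in>T. D' k * sqrt (W k) * osc h p k) \<le> 16 * R"
  proof -
    have "64 * Q * n \<le> 64 * Q\<^sup>2 * n" using QQ n by (intro mult_right_mono) auto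
    with sum_osc[OF p, folded n_def]
    have "(\<Sum>k\<in>T. (sqrt (W k) * osc h p k)\<^sup>2) \<le> 64 * Q\<^sup>2 * n" by linarith
    from s.sum_local[OF D(2)[folded n'_def] this n(2,1)] show ?thesis
      by (simp add: R_def sq mult_ac)
  qed
  have FF: "(\<Sum>k\<in>T. carl h p k * carl g p' k) \<le> 64 * R"
    and FH: "(\<Sum>k\<in>T. carl h p k * osc g p' k) \<le> 91 * R"
    and HH: "(\<Sum>k\<in>T. osc h p k * osc g p' k) \<le> 64 * R"
    using sum_carl_carl[OF p p'] sum_carl_osc[OF p p'] sum_osc_osc[OF p p']
    unfolding R_def n_def n'_def mult.assoc .
  have HF: "(\<Sum>k\<in>T. carl g p' k * osc h p k) \<le> 91 * R"
    using s.sum_carl_osc[OF p' p, folded n_def n'_def]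
    unfolding R_def mult.commute[of "sqrt n'"] mult.assoc .
  have nine: "(a + b + c) * (a' + b' + c') = a * a' + a * b' + a * c' + a' * b + a' * c + b * b'
      + b * c' + b' * c + c * c'" for a b c a' b' c' :: real
    by (simp add: algebra_simps)
  have "(\<Sum>k\<in>T. (D k * sqrt (V k) + carl h p k + osc h p k)
      * (D' k * sqrt (W k) + carl g p' k + osc g p' k))
    = (\<Sum>k\<in>T. D k * sqrt (V k) * (D' k * sqrt (W k))) + (\<Sum>k\<in>T. D k * sqrt (V k) * carl g p' k)
      + (\<Sum>k\<in>T. D k * sqrt (V k) * osc g p' k) + (\<Sum>k\<in>T. D' k * sqrt (W k) * carl h p k)
      + (\<Sum>k\<in>T. D' k * sqrt (W k) * osc h p k) + (\<Sum>k\<in>T. carl h p k * carl g p' k)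
      + (\<Sum>k\<in>T. carl h p k * osc g p' k) + (\<Sum>k\<in>T. carl g p' k * osc h p k)
      + (\<Sum>k\<in>T. osc h p k * osc g p' k)"
    by (simp only: nine sum.distrib)
  \<comment> \<open>The nine constants 4, 24, 16, 24, 16, 64, 91, 91, 64 add up to 394.\<close>
  also have "\<dots> \<le> 500 * R" using DD DF DH FD HD FF FH HF HH R0 by linarith
  finally show ?thesis by (simp add: R_def n_def n'_def mult.assoc)
qed

end
section \<open>Haar coefficients of complex functions\<close>

definition locally_cintegrable :: "((real^'n) \<Rightarrow> complex) \<Rightarrow> bool" where
  "locally_cintegrable F \<longleftrightarrow> F \<in> borel_measurable lebesgue \<and> locally_integrable (\<lambda>x. cmod (F x))"

definition loc_cL2 :: "((real^'n) \<Rightarrow> complex) \<Rightarrow> bool" where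
  "loc_cL2 F \<longleftrightarrow> F \<in> borel_measurable lebesgue \<and> loc_L2 (\<lambda>x. cmod (F x))"

abbreviation cmass :: "((real^'n) \<Rightarrow> complex) \<Rightarrow> (real^'n) set \<Rightarrow> complex" where
  "cmass f A \<equiv> (LINT x:A|lebesgue. f x)"

lemma locally_cintegrable_set:
  assumes "locally_cintegrable F" "A \<in> bsets"
  shows "set_integrable lebesgue A F"
proof -
  have "set_integrable lebesgue A (\<lambda>x. cmod (F x))"
    using assms by (auto simp: locally_cintegrable_def intro: locally_integrable_set)
  moreover have "set_borel_measurable lebesgue A F"
    using assms bsets_sets[of A] by (auto simp: locally_cintegrable_def set_borel_measurable_def)
  ultimately show ?thesis by (rule set_integrable_bound) simp
qed

lemma Re_cmass: "locally_cintegrable F \<Longrightarrow> A \<in> bsets \<Longrightarrow> Re (cmass F A) = mass (\<lambda>x. Re (F x)) A"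
  using integral_bounded_linear[OF bounded_linear_Re, of lebesgue "\<lambda>x. indicat_real A x *\<^sub>R F x"]
    locally_cintegrable_set[of F A] by (simp add: set_lebesgue_integral_def set_integrable_def)

lemma Im_cmass: "locally_cintegrable F \<Longrightarrow> A \<in> bsets \<Longrightarrow> Im (cmass F A) = mass (\<lambda>x. Im (F x)) A"
  using integral_bounded_linear[OF bounded_linear_Im, of lebesgue "\<lambda>x. indicat_real A x *\<^sub>R F x"]
    locally_cintegrable_set[of F A] by (simp add: set_lebesgue_integral_def set_integrable_def)

lemma cmod_cmass_le: "cmod (cmass F A) \<le> mass (\<lambda>x. cmod (F x)) A"
  using integral_norm_bound[of lebesgue "\<lambda>x. indicat_real A x *\<^sub>R F x"]
  by (simp add: set_lebesgue_integral_def)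

lemma cmass_Un:
  assumes "locally_cintegrable f" "A \<in> bsets" "B \<in> bsets" "A \<inter> B = {}"
  shows "cmass f (A \<union> B) = cmass f A + cmass f B"
  using assms by (intro set_integral_Un locally_cintegrable_set)

lemma loc_L2_bound:
  assumes "loc_L2 f" "g \<in> borel_measurable lebesgue" "\<And>x. \<bar>g x\<bar> \<le> \<bar>f x\<bar>"
  shows "loc_L2 g"
  unfolding loc_L2_def
proof
  show "locally_integrable (sq g)"
    by (rule locally_integrable_bound[of "\<lambda>x. (f x)\<^sup>2"])
      (use assms in \<open>auto simp: loc_L2_def abs_le_square_iff\<close>)
qed fact

lemma loc_cL2_Re: "loc_cL2 F \<Longrightarrow> loc_L2 (\<lambda>x. Re (F x))"
  and loc_cL2_Im: "loc_cL2 F \<Longrightarrow> loc_L2 (\<lambda>x. Im (F x))"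
  by (rule loc_L2_bound[of "\<lambda>x. cmod (F x)"]; auto simp: loc_cL2_def abs_Re_le_cmod abs_Im_le_cmod)+

lemma loc_cL2_mult_real:
  assumes "loc_cL2 F" "loc_L2 u"
  shows "locally_cintegrable (\<lambda>x. of_real (u x) * F x)"
  using loc_L2_mult[of "\<lambda>x. \<bar>u x\<bar>" "\<lambda>x. cmod (F x)"] assms
    loc_L2_bound[of u "\<lambda>x. \<bar>u x\<bar>"]
  by (auto simp: locally_cintegrable_def loc_cL2_def norm_mult loc_L2_def)

lemma loc_cL2_locally_cintegrable: "loc_cL2 F \<Longrightarrow> locally_cintegrable F"
  using loc_cL2_mult_real[OF _ loc_L2_one, of F] by simp

lemma mass_Re_Im:
  assumes "loc_cL2 F" "A \<in> bsets"
  shows "mass (\<lambda>x. (Re (F x))\<^sup>2) A + mass (\<lambda>x. (Im (F x))\<^sup>2) A = mass (\<lambda>x. (cmod (F x))\<^sup>2) A"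
  using mass_add[of "\<lambda>x. (Re (F x))\<^sup>2" "\<lambda>x. (Im (F x))\<^sup>2" A] assms loc_cL2_Re[of F] loc_cL2_Im[of F]
  by (simp add: loc_L2_def cmod_power2)

context laminar
begin

text \<open>Written with the masses of the two halves, so that it makes sense for functions that are
  only locally integrable, such as the square root of the weight.\<close>

definition haar_at :: "((real^'n) \<Rightarrow> complex) \<Rightarrow> 'k \<Rightarrow> complex" where
  "haar_at f k = (cmass f (P k) - cmass f (N k)) / of_real (sqrt (vol (U k)))"

definition cav :: "((real^'n) \<Rightarrow> complex) \<Rightarrow> 'k \<Rightarrow> complex" where
  "cav f k = cmass f (U k) / of_real (vol (U k))"

text \<open>
  The gain in the weighted Bessel inequality, that is the square of the coefficient of \<open>f / u\<close>
  for the Haar function adapted to the measure \<open>u\<^sup>2 dx\<close>.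
\<close>

definition gain :: "((real^'n) \<Rightarrow> real) \<Rightarrow> ((real^'n) \<Rightarrow> real) \<Rightarrow> 'k \<Rightarrow> real" where
  "gain u f k = (mass (\<lambda>x. f x * u x) (P k) * mass (sq u) (N k)
      - mass (\<lambda>x. f x * u x) (N k) * mass (sq u) (P k))\<^sup>2 /
    (mass (sq u) (P k) * mass (sq u) (N k) * mass (sq u) (U k))"

text \<open>The weighted Bessel inequality is proved for real functions; the real and imaginary
  parts are added.\<close>

definition cgain :: "((real^'n) \<Rightarrow> real) \<Rightarrow> ((real^'n) \<Rightarrow> complex) \<Rightarrow> 'k \<Rightarrow> real" where
  "cgain u f k = gain u (\<lambda>x. Re (f x)) k + gain u (\<lambda>x. Im (f x)) k"

definition dominant :: "((real^'n) \<Rightarrow> real) \<Rightarrow> ((real^'n) \<Rightarrow> complex) \<Rightarrow> 'k \<Rightarrow> real" where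
  "dominant u f k = (sqrt (cgain u f k) + cmod (haar_at f k)) * sqrt (av (sq u) k)
     + carl u (\<lambda>x. cmod (f x)) k + osc u (\<lambda>x. cmod (f x)) k"

lemma gain_nonneg: "0 \<le> gain u f k"
  unfolding gain_def by (intro divide_nonneg_nonneg mult_nonneg_nonneg mass_nonneg) auto

lemma cgain_nonneg: "0 \<le> cgain u f k"
  unfolding cgain_def by (simp add: gain_nonneg)

lemma sum_cgain:
  assumes f: "loc_cL2 f" and u: "loc_L2 u" "\<And>x. 0 < u x"
    and T: "finite T" "T \<subseteq> K" and A: "A \<in> bsets" "\<And>k. k \<in> T \<Longrightarrow> U k \<subseteq> A"
  shows "(\<Sum>k\<in>T. cgain u f k) \<le> mass (\<lambda>x. (cmod (f x))\<^sup>2) A"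
  using weighted_bessel[OF loc_cL2_Re[OF f] u T A] weighted_bessel[OF loc_cL2_Im[OF f] u T A]
  unfolding cgain_def gain_def sum.distrib mass_Re_Im[OF f A(1), symmetric] by (intro add_mono)

text \<open>For \<open>u = 1\<close> the adapted Haar function is the ordinary one, so the
  unweighted Bessel inequality becomes a case of \<open>sum_cgain\<close>.\<close>

lemma cmod_haar_at_sq:
  assumes f: "loc_cL2 f" and k: "k \<in> K"
  shows "(cmod (haar_at f k))\<^sup>2 = cgain (\<lambda>x. 1) f k"
proof -
  have g: "gain (\<lambda>x. 1) F k = ((mass F (P k) - mass F (N k)) / sqrt (vol (U k)))\<^sup>2" for F
  proof -
    define n where "n = vol (N k)"
    have n: "n > 0" "vol (P k) = n" "vol (U k) = 2 * n"
      using N_pos[OF k] halves[OF k] measure_U[OF k] by (auto simp: n_def)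
    have "gain (\<lambda>x. 1) F k = (mass F (P k) * n - mass F (N k) * n)\<^sup>2 / (n * n * (2 * n))"
      using n by (simp add: gain_def mass_const P_bsets N_bsets U_bsets k n_def[symmetric])
    also have "\<dots> = (mass F (P k) - mass F (N k))\<^sup>2 / (2 * n)"
      using n(1) by (simp add: left_diff_distrib[symmetric] power_mult_distrib power2_eq_square)
    finally show ?thesis using n by (simp add: power_divide)
  qed
  note ci = loc_cL2_locally_cintegrable[OF f]
  show ?thesis
    unfolding cmod_power2 cgain_def g haar_at_def
    using ci P_bsets[OF k] N_bsets[OF k] by (simp add: Re_cmass Im_cmass)
qed

lemma sum_dominant_local:
  assumes f: "loc_cL2 f" and u: "loc_L2 u" "\<And>x. 0 < u x"
    and T: "finite T" "T \<subseteq> K" and A: "A \<in> bsets" "\<And>k. k \<in> T \<Longrightarrow> U k \<subseteq> A"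
  shows "(\<Sum>k\<in>T. (sqrt (cgain u f k) + cmod (haar_at f k))\<^sup>2) \<le> 4 * mass (\<lambda>x. (cmod (f x))\<^sup>2) A"
proof -
  have "(\<Sum>k\<in>T. (sqrt (cgain u f k) + cmod (haar_at f k))\<^sup>2)
      \<le> (\<Sum>k\<in>T. 2 * cgain u f k + 2 * cgain (\<lambda>x. 1) f k)"
  proof (rule sum_mono)
    fix k assume "k \<in> T"
    then have k: "k \<in> K" using T by auto
    have "(sqrt (cgain u f k) + cmod (haar_at f k))\<^sup>2
        \<le> 2 * (sqrt (cgain u f k))\<^sup>2 + 2 * (cmod (haar_at f k))\<^sup>2"
      using sum_squares_bound[of "sqrt (cgain u f k)" "cmod (haar_at f k)"]
      by (simp add: power2_sum)
    then show "(sqrt (cgain u f k) + cmod (haar_at f k))\<^sup>2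
        \<le> 2 * cgain u f k + 2 * cgain (\<lambda>x. 1) f k"
      using cgain_nonneg[of u f k] by (simp add: cmod_haar_at_sq[OF f k])
  qed
  also have "\<dots> \<le> 2 * mass (\<lambda>x. (cmod (f x))\<^sup>2) A + 2 * mass (\<lambda>x. (cmod (f x))\<^sup>2) A"
    unfolding sum.distrib sum_distrib_left[symmetric]
    using sum_cgain[OF f u T A] sum_cgain[OF f loc_L2_one zero_less_one T A]
    by (intro add_mono mult_left_mono) auto
  finally show ?thesis by simp
qed

lemma carl_nonneg: "(\<And>x. 0 \<le> p x) \<Longrightarrow> (\<And>x. 0 < u x) \<Longrightarrow> 0 \<le> carl u p k"
  unfolding carl_def
  by (intro mult_nonneg_nonneg divide_nonneg_nonneg mass_nonneg av_nonneg) (auto intro: less_imp_le)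

lemma osc_nonneg: "(\<And>x. 0 \<le> p x) \<Longrightarrow> (\<And>x. 0 < u x) \<Longrightarrow> 0 \<le> osc u p k"
  unfolding osc_def by (intro mult_nonneg_nonneg av_nonneg) (auto intro: less_imp_le)

text \<open>The Haar function is written as a multiple of the Haar function adapted to
  \<open>u\<^sup>2 dx\<close> plus a multiple of the indicator of its support. The first part is the
  gain of the weighted Bessel inequality; the second carries the relative jump of
  \<open>sq u\<close> and becomes \<open>carl\<close>.\<close>

lemma haar_at_mult_le:
  assumes f: "loc_cL2 f" and u: "loc_L2 u" "\<And>x. 0 < u x" and k: "k \<in> K"
  shows "cmod (haar_at (\<lambda>x. of_real (u x) * f x) k)
    \<le> sqrt (cgain u f k) * sqrt (av (sq u) k) + carl u (\<lambda>x. cmod (f x)) k"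
proof -
  define m where "m = vol (U k)"
  define v1 where "v1 = mass (sq u) (P k)"
  define v2 where "v2 = mass (sq u) (N k)"
  define v where "v = mass (sq u) (U k)"
  define X1 where "X1 = cmass (\<lambda>x. of_real (u x) * f x) (P k)"
  define X2 where "X2 = cmass (\<lambda>x. of_real (u x) * f x) (N k)"
  define Y where "Y = mass (\<lambda>x. cmod (f x) * u x) (U k)"
  define e where "e = (X1 * of_real v2 - X2 * of_real v1) / of_real v"
  have ci: "locally_cintegrable (\<lambda>x. of_real (u x) * f x)"
    by (rule loc_cL2_mult_real[OF f u(1)])
  have u2: "locally_integrable (sq u)" "\<And>x. 0 < (u x)\<^sup>2"
    using u(1) less_imp_neq[OF u(2)] by (auto simp: loc_L2_def)
  have v: "0 < v1" "0 < v2" "v = v1 + v2"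
    unfolding v1_def v2_def v_def
    by (auto intro!: mass_pos mass_U u2 k P_bsets N_bsets P_pos N_pos)
  have m: "0 < m" using U_pos[OF k] by (simp add: m_def)
  have X: "cmod (X1 + X2) \<le> Y"
  proof -
    have "X1 + X2 = cmass (\<lambda>x. of_real (u x) * f x) (U k)"
      unfolding X1_def X2_def U_def using ci k by (simp add: cmass_Un P_bsets N_bsets disj)
    also have "cmod \<dots> \<le> mass (\<lambda>x. cmod (of_real (u x) * f x)) (U k)" by (rule cmod_cmass_le)
    also have "(\<lambda>x. cmod (of_real (u x) * f x)) = (\<lambda>x. cmod (f x) * u x)"
      using u(2) by (auto simp: norm_mult abs_of_pos)
    finally show ?thesis by (simp add: Y_def)
  qed
  \<comment> \<open>\<open>e\<close> is the unnormalised adapted coefficient; the last summand is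
    the projection onto the indicator.\<close>
  have split: "X1 - X2 = 2 * e + of_real ((v1 - v2) / v) * (X1 + X2)"
  proof -
    have v0: "complex_of_real v \<noteq> 0" using v by (simp del: of_real_add)
    have "of_real v * (2 * e + of_real ((v1 - v2) / v) * (X1 + X2))
        = 2 * (of_real v * e) + of_real (v1 - v2) * (X1 + X2)"
      using v0 by (simp add: distrib_left)
    also have "of_real v * e = X1 * of_real v2 - X2 * of_real v1" using v0 by (simp add: e_def)
    also have "2 * (X1 * of_real v2 - X2 * of_real v1) + of_real (v1 - v2) * (X1 + X2)
        = of_real v * (X1 - X2)"
      unfolding v(3) by (simp add: algebra_simps)
    finally have "of_real v * (2 * e + of_real ((v1 - v2) / v) * (X1 + X2)) = of_real v * (X1 - X2)" .
    with v0 show ?thesis by (metis mult_left_cancel)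
  qed
  have ReIm: "Re X1 = mass (\<lambda>x. Re (f x) * u x) (P k)" "Re X2 = mass (\<lambda>x. Re (f x) * u x) (N k)"
    "Im X1 = mass (\<lambda>x. Im (f x) * u x) (P k)" "Im X2 = mass (\<lambda>x. Im (f x) * u x) (N k)"
    unfolding X1_def X2_def Re_cmass[OF ci P_bsets[OF k]] Re_cmass[OF ci N_bsets[OF k]]
      Im_cmass[OF ci P_bsets[OF k]] Im_cmass[OF ci N_bsets[OF k]]
    by (simp_all add: mult.commute)
  have e2: "(cmod (2 * e))\<^sup>2 \<le> cgain u f k * v"
  proof -
    have v0: "v \<noteq> 0" using v by simp
    define r where "r = (Re X1 * v2 - Re X2 * v1)\<^sup>2 + (Im X1 * v2 - Im X2 * v1)\<^sup>2"
    have "cgain u f k * v = r / (v1 * v2)"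
      unfolding cgain_def gain_def v1_def[symmetric] v2_def[symmetric] v_def[symmetric]
        ReIm[symmetric] r_def using v0 by (simp add: distrib_right add_divide_distrib)
    moreover have "(cmod e)\<^sup>2 = r / v\<^sup>2"
      unfolding cmod_power2 r_def e_def by (simp add: power_divide add_divide_distrib)
    then have "(cmod (2 * e))\<^sup>2 = 4 * (r / v\<^sup>2)"
      by (simp add: norm_mult power_mult_distrib)
    moreover have "4 * (r / v\<^sup>2) = r / (v\<^sup>2 / 4)" by simp
    \<comment> \<open>The inequality \<open>4 * v1 * v2 <= v\<^sup>2\<close> absorbs the factor 2 of
      \<open>2 * e\<close>.\<close>
    moreover have "r / (v\<^sup>2 / 4) \<le> r / (v1 * v2)"
    proof (rule divide_left_mono)
      have "0 \<le> (v1 - v2)\<^sup>2" by simp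
      then show "v1 * v2 \<le> v\<^sup>2 / 4" unfolding v(3) by (simp add: power2_eq_square algebra_simps)
    qed (use v in \<open>auto simp: r_def\<close>)
    ultimately show ?thesis by argo
  qed
  have "cmod (X1 - X2) \<le> cmod (2 * e) + \<bar>(v1 - v2) / v\<bar> * cmod (X1 + X2)"
    unfolding split using norm_triangle_ineq[of "2 * e" "of_real ((v1 - v2) / v) * (X1 + X2)"]
    by (simp only: norm_mult norm_of_real)
  also have "\<dots> \<le> sqrt (cgain u f k * v) + \<bar>(v1 - v2) / v\<bar> * Y"
    using real_le_rsqrt[OF e2] X by (intro add_mono mult_left_mono) auto
  finally have "cmod (X1 - X2) / sqrt m \<le> (sqrt (cgain u f k * v) + \<bar>(v1 - v2) / v\<bar> * Y) / sqrt m"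
    using m by (intro divide_right_mono) auto
  also have "\<dots> = sqrt (cgain u f k) * sqrt (v / m) + \<bar>(v1 - v2) / v\<bar> * Y / sqrt m"
    by (simp add: add_divide_distrib real_sqrt_mult real_sqrt_divide)
  also have "\<bar>(v1 - v2) / v\<bar> * Y / sqrt m = \<bar>(v1 - v2) / v\<bar> * (v / m) * (Y / v) * sqrt m"
  proof -
    have "1 / sqrt m = sqrt m / m" using m by (simp add: real_div_sqrt divide_simps)
    then have "Y / sqrt m = Y * (sqrt m / m)" by (metis times_divide_eq_right mult_1_right)
    also have "\<dots> = (v / m) * (Y / v) * sqrt m" using v by simp
    finally show ?thesis by (simp only: times_divide_eq_right[symmetric] mult.assoc)
  qed
  finally show ?thesis
    unfolding haar_at_def carl_def jump_def av_def X1_def[symmetric] X2_def[symmetric]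
      v1_def[symmetric] v2_def[symmetric] v_def[symmetric] m_def[symmetric] Y_def[symmetric]
    using m by (simp add: norm_divide)
qed

lemma av_mult_haar_at_le:
  assumes u: "loc_L2 u" "\<And>x. 0 < u x" and k: "k \<in> K"
  shows "cmod (of_real (av u k) * haar_at f k) \<le> cmod (haar_at f k) * sqrt (av (sq u) k)"
proof -
  have "(av u k)\<^sup>2 \<le> av (sq u) k"
    using av_Cauchy_Schwarz[OF u(1) loc_L2_one k] U_pos[OF k]
    by (simp add: av_def mass_const U_bsets k)
  then have "av u k \<le> sqrt (av (sq u) k)" by (rule real_le_rsqrt)
  moreover have "0 \<le> av u k" using u(2) less_imp_le by (intro av_nonneg) auto
  ultimately show ?thesis
    using mult_left_mono[of "av u k" "sqrt (av (sq u) k)" "cmod (haar_at f k)"]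
    by (simp add: norm_mult mult.commute)
qed

lemma haar_at_mult_cav_le:
  assumes f: "loc_cL2 f" and u: "loc_L2 u" "\<And>x. 0 < u x" and k: "k \<in> K"
  shows "cmod (haar_at (\<lambda>x. of_real (u x)) k * cav f k) \<le> osc u (\<lambda>x. cmod (f x)) k"
proof -
  define m where "m = vol (U k)"
  have m: "0 < m" using U_pos[OF k] by (simp add: m_def)
  have H: "0 < mass u (U k)"
    by (intro mass_pos loc_L2_locally_integrable u U_bsets U_pos k)
  have "haar_at (\<lambda>x. of_real (u x)) k = of_real ((mass u (P k) - mass u (N k)) / sqrt m)"
    by (simp add: haar_at_def m_def set_lebesgue_integral_def scaleR_conv_of_real
        of_real_mult[symmetric] del: of_real_mult)
  also have "(mass u (P k) - mass u (N k)) / sqrt m = jump u k * av u k * sqrt m"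
  proof -
    have "jump u k * av u k * sqrt m = (mass u (P k) - mass u (N k)) * (sqrt m / m)"
      using H by (simp add: jump_def av_def m_def[symmetric])
    also have "sqrt m / m = 1 / sqrt m" using m by (simp add: real_div_sqrt divide_simps)
    finally show ?thesis by simp
  qed
  finally have "cmod (haar_at (\<lambda>x. of_real (u x)) k) = \<bar>jump u k * av u k * sqrt m\<bar>"
    by (simp only: norm_of_real)
  then have 1: "cmod (haar_at (\<lambda>x. of_real (u x)) k) = \<bar>jump u k\<bar> * av u k * sqrt m"
    using H m by (simp add: abs_mult av_def m_def[symmetric])
  have "cmod (cav f k) \<le> av (\<lambda>x. cmod (f x)) k"
    using cmod_cmass_le[of "U k" f] m
    by (simp add: cav_def av_def norm_divide divide_right_mono)
  then have "cmod (haar_at (\<lambda>x. of_real (u x)) k) * cmod (cav f k)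
      \<le> (\<bar>jump u k\<bar> * av u k * sqrt m) * av (\<lambda>x. cmod (f x)) k"
    unfolding 1 using H m by (intro mult_left_mono) (auto simp: av_def m_def[symmetric])
  then show ?thesis by (simp add: norm_mult osc_def m_def mult_ac)
qed

text \<open>The expression in the third bound is the coefficient of the paraproduct of type
  \<open>(1, 0)\<close>, as the product formula shows. The triangle inequality uses each of the
  three elementary bounds once, which is how \<open>dominant\<close> was assembled.\<close>

lemma dominant_bounds:
  assumes f: "loc_cL2 f" and u: "loc_L2 u" "\<And>x. 0 < u x" and k: "k \<in> K"
  shows "cmod (of_real (av u k) * haar_at f k) \<le> dominant u f k"
    and "cmod (haar_at (\<lambda>x. of_real (u x)) k * cav f k) \<le> dominant u f k"
    and "cmod (haar_at (\<lambda>x. of_real (u x) * f x) k - of_real (av u k) * haar_at f k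
          - haar_at (\<lambda>x. of_real (u x)) k * cav f k) \<le> dominant u f k"
proof -
  let ?S = "sqrt (av (sq u) k)"
  have nn: "0 \<le> sqrt (cgain u f k) * ?S" "0 \<le> cmod (haar_at f k) * ?S"
    "0 \<le> carl u (\<lambda>x. cmod (f x)) k" "0 \<le> osc u (\<lambda>x. cmod (f x)) k"
    using cgain_nonneg u(2) by (auto intro!: mult_nonneg_nonneg av_nonneg carl_nonneg osc_nonneg)
  note b = haar_at_mult_le[OF f u k] av_mult_haar_at_le[OF u k, of f] haar_at_mult_cav_le[OF f u k]
  have e: "dominant u f k = sqrt (cgain u f k) * ?S + cmod (haar_at f k) * ?S
      + carl u (\<lambda>x. cmod (f x)) k + osc u (\<lambda>x. cmod (f x)) k"
    by (simp add: dominant_def distrib_right)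
  show "cmod (of_real (av u k) * haar_at f k) \<le> dominant u f k"
    "cmod (haar_at (\<lambda>x. of_real (u x)) k * cav f k) \<le> dominant u f k"
    using b nn unfolding e by linarith+
  have tri: "cmod (a - b - c) \<le> cmod a + cmod b + cmod c" for a b c :: complex
    using norm_triangle_ineq4[of "a - b" c] norm_triangle_ineq4[of a b] by simp
  show "cmod (haar_at (\<lambda>x. of_real (u x) * f x) k - of_real (av u k) * haar_at f k
          - haar_at (\<lambda>x. of_real (u x)) k * cav f k) \<le> dominant u f k"
    using tri[of "haar_at (\<lambda>x. of_real (u x) * f x) k" "of_real (av u k) * haar_at f k"
        "haar_at (\<lambda>x. of_real (u x)) k * cav f k"] b nn unfolding e by linarith
qed

end

lemma (in two_weight) sum_dominant:
  assumes f: "loc_cL2 f" and f': "loc_cL2 f'"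
  shows "(\<Sum>k\<in>T. dominant h f k * dominant g f' k)
    \<le> 500 * Q * (sqrt (mass (\<lambda>x. (cmod (f x))\<^sup>2) B) * sqrt (mass (\<lambda>x. (cmod (f' x))\<^sup>2) B))"
  unfolding dominant_def
  by (rule sum_bilinear) (use f f' cgain_nonneg in \<open>auto simp: loc_cL2_def intro!:
     sum_dominant_local h_L2 g_L2 h_pos g_pos T_finite B_bsets add_nonneg_nonneg
     subsetD[OF T_K] subsetD[OF U_B]\<close>)
section \<open>Orthonormal families in \<open>L\<^sup>2\<close>\<close>

lemma L2_measurable: "f \<in> L2 \<Longrightarrow> f \<in> borel_measurable lebesgue"
  and L2_integrable: "f \<in> L2 \<Longrightarrow> integrable lebesgue (\<lambda>x. (cmod (f x))\<^sup>2)"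
  by (auto simp: L2_def)

lemma L2_inner_integrable:
  assumes "f \<in> L2" "g \<in> L2"
  shows "integrable lebesgue (\<lambda>x. f x * cnj (g x))"
proof (rule Bochner_Integration.integrable_bound)
  show "integrable lebesgue (\<lambda>x. (cmod (f x))\<^sup>2 + (cmod (g x))\<^sup>2)"
    using L2_integrable[OF assms(1)] L2_integrable[OF assms(2)] by (rule Bochner_Integration.integrable_add)
  show "(\<lambda>x. f x * cnj (g x)) \<in> borel_measurable lebesgue"
    using assms[THEN L2_measurable] measurable_compose[OF _ borel_measurable_continuous_onI[OF continuous_on_cnj[OF continuous_on_id]]]
    by (intro borel_measurable_times) auto
  have "cmod (f x * cnj (g x)) \<le> (cmod (f x))\<^sup>2 + (cmod (g x))\<^sup>2" for x
  proof -
    have "2 * (cmod (f x) * cmod (g x)) \<le> (cmod (f x))\<^sup>2 + (cmod (g x))\<^sup>2"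
      using sum_squares_bound[of "cmod (f x)" "cmod (g x)"] by simp
    moreover have "0 \<le> cmod (f x) * cmod (g x)" by simp
    ultimately have "cmod (f x) * cmod (g x) \<le> (cmod (f x))\<^sup>2 + (cmod (g x))\<^sup>2" by linarith
    then show ?thesis by (simp add: norm_mult)
  qed
  then show "AE x in lebesgue. norm (f x * cnj (g x)) \<le> norm ((cmod (f x))\<^sup>2 + (cmod (g x))\<^sup>2)"
    by simp
qed

lemma L2_cmult: "f \<in> L2 \<Longrightarrow> (\<lambda>x. c * f x) \<in> L2"
  by (auto simp: L2_def norm_mult power_mult_distrib)

lemma L2_diff: "f \<in> L2 \<Longrightarrow> g \<in> L2 \<Longrightarrow> (\<lambda>x. f x - g x) \<in> L2"
  using L2_add_bound(1)[OF _ L2_uminus, of f g] by simp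

lemma L2_inner_cmult: "L2_inner (\<lambda>x. c * f x) g = c * L2_inner f g"
  by (simp add: L2_inner_def mult.assoc)

lemma L2_inner_sum:
  assumes "\<And>i. i \<in> S \<Longrightarrow> F i \<in> L2" "g \<in> L2"
  shows "L2_inner (\<lambda>x. \<Sum>i\<in>S. F i x) g = (\<Sum>i\<in>S. L2_inner (F i) g)"
  unfolding L2_inner_def sum_distrib_right
  by (rule Bochner_Integration.integral_sum) (use assms in \<open>auto intro: L2_inner_integrable\<close>)

lemma L2_inner_diff:
  assumes "f \<in> L2" "f' \<in> L2" "g \<in> L2"
  shows "L2_inner (\<lambda>x. f x - f' x) g = L2_inner f g - L2_inner f' g"
  unfolding L2_inner_def left_diff_distrib
  using L2_inner_integrable[OF assms(1,3)] L2_inner_integrable[OF assms(2,3)]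
  by (rule Bochner_Integration.integral_diff)

lemma L2_inner_commute: "L2_inner g f = cnj (L2_inner f g)"
  unfolding L2_inner_def Bochner_Integration.integral_cnj[symmetric] by (simp add: mult.commute)

lemma L2_norm_sq: "(L2_norm f)\<^sup>2 = (LINT x|lebesgue. (cmod (f x))\<^sup>2)"
  by (simp add: L2_norm_def)

lemma L2_norm_nonneg: "0 \<le> L2_norm f"
  by (simp add: L2_norm_def)

lemma L2_inner_self: "L2_inner f f = of_real ((L2_norm f)\<^sup>2)"
  unfolding L2_norm_sq L2_inner_def by (simp add: complex_norm_square[symmetric] del: of_real_power)

lemma L2_Cauchy_Schwarz:
  assumes "f \<in> L2" "g \<in> L2"
  shows "cmod (L2_inner f g) \<le> L2_norm f * L2_norm g"
proof -
  have i: "integrable lebesgue (\<lambda>x. cmod (f x) * cmod (g x))"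
    using integrable_norm[OF L2_inner_integrable[OF assms]] by (simp add: norm_mult)
  note i2 = L2_integrable[OF assms(1)] L2_integrable[OF assms(2)]
  have "(LINT x|lebesgue. cmod (f x) * cmod (g x))\<^sup>2 \<le> (L2_norm f)\<^sup>2 * (L2_norm g)\<^sup>2"
  proof (rule discriminant_bound)
    fix s :: real
    have "0 \<le> (LINT x|lebesgue. (s * cmod (f x) + cmod (g x))\<^sup>2)" by simp
    also have "\<dots> = (LINT x|lebesgue. s\<^sup>2 * (cmod (f x))\<^sup>2 + 2 * s * (cmod (f x) * cmod (g x)) + (cmod (g x))\<^sup>2)"
    proof -
      have "(s * a + b)\<^sup>2 = s\<^sup>2 * a\<^sup>2 + 2 * s * (a * b) + b\<^sup>2" for a b :: real
        by (simp add: power2_sum power_mult_distrib)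
      then show ?thesis by (simp only:)
    qed
    also have "\<dots> = (L2_norm f)\<^sup>2 * s\<^sup>2 + 2 * (LINT x|lebesgue. cmod (f x) * cmod (g x)) * s + (L2_norm g)\<^sup>2"
      unfolding L2_norm_sq using i i2 by simp
    finally show "0 \<le> (L2_norm f)\<^sup>2 * s\<^sup>2 + 2 * (LINT x|lebesgue. cmod (f x) * cmod (g x)) * s
        + (L2_norm g)\<^sup>2" .
  qed simp
  then have "(LINT x|lebesgue. cmod (f x) * cmod (g x)) \<le> L2_norm f * L2_norm g"
    by (auto simp: power_mult_distrib L2_norm_nonneg
        intro: power2_le_imp_le[of _ "L2_norm f * L2_norm g"])
  moreover have "cmod (L2_inner f g) \<le> (LINT x|lebesgue. cmod (f x) * cmod (g x))"
    unfolding L2_inner_def using integral_norm_bound[of lebesgue "\<lambda>x. f x * cnj (g x)"]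
    by (simp add: norm_mult)
  ultimately show ?thesis by simp
qed

lemma L2_has_sum_inner:
  assumes "L2_has_sum F A g" "u \<in> L2"
  shows "((\<lambda>S. \<Sum>i\<in>S. L2_inner (F i) u) \<longlongrightarrow> L2_inner g u) (finite_subsets_at_top A)"
proof -
  let ?N = "\<lambda>S. L2_norm (\<lambda>x. (\<Sum>i\<in>S. F i x) - g x)"
  have F: "\<And>i. i \<in> A \<Longrightarrow> F i \<in> L2" "g \<in> L2" and t: "(?N \<longlongrightarrow> 0) (finite_subsets_at_top A)"
    using assms by (auto simp: L2_has_sum_def)
  have "((\<lambda>S. (\<Sum>i\<in>S. L2_inner (F i) u) - L2_inner g u) \<longlongrightarrow> 0) (finite_subsets_at_top A)"
  proof (rule Lim_null_comparison)
    show "((\<lambda>S. ?N S * L2_norm u) \<longlongrightarrow> 0) (finite_subsets_at_top A)"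
      using tendsto_mult_right[OF t, of "L2_norm u"] by simp
    have "norm ((\<Sum>i\<in>S. L2_inner (F i) u) - L2_inner g u) \<le> ?N S * L2_norm u"
      if S: "finite S" "S \<subseteq> A" for S
    proof -
      have s: "(\<lambda>x. \<Sum>i\<in>S. F i x) \<in> L2" using S F by (intro L2_setsum) auto
      have "(\<Sum>i\<in>S. L2_inner (F i) u) - L2_inner g u = L2_inner (\<lambda>x. (\<Sum>i\<in>S. F i x) - g x) u"
        using S F assms(2) s by (subst L2_inner_diff) (auto simp: L2_inner_sum subset_iff)
      also have "norm \<dots> \<le> ?N S * L2_norm u"
        by (rule L2_Cauchy_Schwarz[OF L2_diff[OF s F(2)] assms(2)])
      finally show ?thesis .
    qed
    then show "\<forall>\<^sub>F S in finite_subsets_at_top A.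
        norm ((\<Sum>i\<in>S. L2_inner (F i) u) - L2_inner g u) \<le> ?N S * L2_norm u"
      by (intro eventually_finite_subsets_at_top_weakI) auto
  qed
  then show ?thesis by (simp add: LIM_zero_iff)
qed

lemma L2_has_sum_inner_finite:
  assumes "L2_has_sum F A g" "u \<in> L2" "finite S" "S \<subseteq> A"
    "\<And>i. i \<in> A - S \<Longrightarrow> L2_inner (F i) u = 0"
  shows "L2_inner g u = (\<Sum>i\<in>S. L2_inner (F i) u)"
proof -
  have "\<forall>\<^sub>F R in finite_subsets_at_top A. (\<Sum>i\<in>R. L2_inner (F i) u) = (\<Sum>i\<in>S. L2_inner (F i) u)"
    unfolding eventually_finite_subsets_at_top
  proof (intro exI[of _ S] conjI allI impI)
    fix R assume "finite R \<and> S \<subseteq> R \<and> R \<subseteq> A"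
    then show "(\<Sum>i\<in>R. L2_inner (F i) u) = (\<Sum>i\<in>S. L2_inner (F i) u)"
      using assms by (intro sum.mono_neutral_right) auto
  qed (use assms in auto)
  then have "((\<lambda>R. \<Sum>i\<in>R. L2_inner (F i) u) \<longlongrightarrow> (\<Sum>i\<in>S. L2_inner (F i) u)) (finite_subsets_at_top A)"
    by (rule tendsto_eventually)
  from tendsto_unique[OF finite_subsets_at_top_neq_bot L2_has_sum_inner[OF assms(1,2)] this]
  show ?thesis .
qed

lemma L2_has_sum_finite:
  assumes "\<And>i. i \<in> A \<Longrightarrow> F i \<in> L2" "finite S" "S \<subseteq> A" "\<And>i x. i \<in> A - S \<Longrightarrow> F i x = 0"
  shows "L2_has_sum F A (\<lambda>x. \<Sum>i\<in>S. F i x)"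
  unfolding L2_has_sum_def
proof (intro conjI ballI)
  have "\<forall>\<^sub>F R in finite_subsets_at_top A. L2_norm (\<lambda>x. (\<Sum>i\<in>R. F i x) - (\<Sum>i\<in>S. F i x)) = 0"
    unfolding eventually_finite_subsets_at_top
  proof (intro exI[of _ S] conjI allI impI)
    fix R assume R: "finite R \<and> S \<subseteq> R \<and> R \<subseteq> A"
    have "(\<Sum>i\<in>R. F i x) = (\<Sum>i\<in>S. F i x)" for x
      using R assms by (intro sum.mono_neutral_right) auto
    then show "L2_norm (\<lambda>x. (\<Sum>i\<in>R. F i x) - (\<Sum>i\<in>S. F i x)) = 0" by (simp add: L2_norm_def)
  qed (use assms in auto)
  then show "((\<lambda>R. L2_norm (\<lambda>x. (\<Sum>i\<in>R. F i x) - (\<Sum>i\<in>S. F i x))) \<longlongrightarrow> 0) (finite_subsets_at_top A)"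
    by (rule tendsto_eventually)
qed (use assms in \<open>auto intro!: L2_setsum\<close>)

lemma L2_has_sum_L2_sum: "L2_has_sum F A g \<Longrightarrow> L2_has_sum F A (L2_sum F A)"
  unfolding L2_sum_def by (rule someI[of "L2_has_sum F A"])

section \<open>Bessel's inequality and the Riesz--Fischer theorem\<close>

locale orthonormal =
  fixes e :: "'k \<Rightarrow> (real^'n) \<Rightarrow> complex" and K :: "'k set"
  assumes e_L2: "k \<in> K \<Longrightarrow> e k \<in> L2"
    and e_inner: "j \<in> K \<Longrightarrow> k \<in> K \<Longrightarrow> L2_inner (e j) (e k) = (if j = k then 1 else 0)"
begin

lemma comb_L2: "finite S \<Longrightarrow> S \<subseteq> K \<Longrightarrow> (\<lambda>x. \<Sum>k\<in>S. c k * e k x) \<in> L2"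
  using e_L2 by (intro L2_setsum L2_cmult) auto

lemma inner_comb:
  assumes "finite S" "S \<subseteq> K" "j \<in> K"
  shows "L2_inner (\<lambda>x. \<Sum>k\<in>S. c k * e k x) (e j) = (if j \<in> S then c j else 0)"
proof -
  have "L2_inner (\<lambda>x. \<Sum>k\<in>S. c k * e k x) (e j) = (\<Sum>k\<in>S. L2_inner (\<lambda>x. c k * e k x) (e j))"
    using assms e_L2 by (intro L2_inner_sum L2_cmult) auto
  also have "\<dots> = (\<Sum>k\<in>S. if j = k then c k else 0)"
    using assms e_inner by (intro sum.cong) (auto simp: L2_inner_cmult)
  finally show ?thesis using assms by simp
qed

lemma norm_comb:
  assumes "finite S" "S \<subseteq> K"
  shows "(L2_norm (\<lambda>x. \<Sum>k\<in>S. c k * e k x))\<^sup>2 = (\<Sum>k\<in>S. (cmod (c k))\<^sup>2)"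
proof -
  let ?f = "\<lambda>x. \<Sum>k\<in>S. c k * e k x"
  have "of_real ((L2_norm ?f)\<^sup>2) = (\<Sum>k\<in>S. L2_inner (\<lambda>x. c k * e k x) ?f)"
    unfolding L2_inner_self[symmetric]
    using assms e_L2 comb_L2[OF assms] by (intro L2_inner_sum L2_cmult) auto
  also have "\<dots> = (\<Sum>k\<in>S. c k * cnj (c k))"
    using assms by (intro sum.cong refl)
      (simp add: L2_inner_cmult L2_inner_commute[of "e _"] inner_comb subset_iff)
  also have "\<dots> = of_real (\<Sum>k\<in>S. (cmod (c k))\<^sup>2)" by (simp only: of_real_sum complex_norm_square)
  finally show ?thesis by (simp only: of_real_eq_iff)
qed

lemma bessel:
  assumes "f \<in> L2" "finite S" "S \<subseteq> K"
  shows "(\<Sum>k\<in>S. (cmod (L2_inner f (e k)))\<^sup>2) \<le> (L2_norm f)\<^sup>2"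
proof -
  let ?c = "\<lambda>k. L2_inner f (e k)"
  let ?s = "\<lambda>x. \<Sum>k\<in>S. ?c k * e k x"
  let ?q = "\<Sum>k\<in>S. (cmod (?c k))\<^sup>2"
  have "L2_inner ?s f = (\<Sum>k\<in>S. L2_inner (\<lambda>x. ?c k * e k x) f)"
    using assms e_L2 by (intro L2_inner_sum L2_cmult) auto
  also have "\<dots> = of_real ?q"
    by (simp only: L2_inner_cmult L2_inner_commute[of "e _" f] of_real_sum complex_norm_square)
  finally have "cmod (L2_inner ?s f) = ?q" by (simp add: sum_nonneg del: of_real_sum)
  then have "?q \<le> L2_norm ?s * L2_norm f"
    using L2_Cauchy_Schwarz[OF comb_L2[OF assms(2,3)] assms(1), of ?c] by simp
  moreover have "2 * (L2_norm ?s * L2_norm f) \<le> (L2_norm ?s)\<^sup>2 + (L2_norm f)\<^sup>2"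
    using sum_squares_bound[of "L2_norm ?s" "L2_norm f"] by simp
  ultimately show ?thesis using norm_comb[OF assms(2,3), of ?c] by linarith
qed

text \<open>The sets \<open>F n\<close> almost exhaust the supremum of the square sums, so any
  finite set disjoint from \<open>F n\<close> carries at most \<open>(1/4)^n\<close>. The partial
  sums over \<open>F n\<close> then converge almost everywhere along the sequence itself, and
  Fatou's lemma turns this into convergence along the net of finite sets.\<close>

lemma riesz_fischer:
  assumes bdd: "\<And>S. finite S \<Longrightarrow> S \<subseteq> K \<Longrightarrow> (\<Sum>k\<in>S. (cmod (c k))\<^sup>2) \<le> C"
  obtains g where "L2_has_sum (\<lambda>k x. c k * e k x) K g"
proof -
  define s where "s S x = (\<Sum>k\<in>S. c k * e k x)" for S x
  define q where "q S = (\<Sum>k\<in>S. (cmod (c k))\<^sup>2)" for S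
  define \<Q> where "\<Q> = q ` {S. finite S \<and> S \<subseteq> K}"
  have ne: "\<Q> \<noteq> {}" unfolding \<Q>_def by auto
  have bd: "bdd_above \<Q>" unfolding \<Q>_def bdd_above_def q_def using bdd by auto
  have "\<exists>F. finite F \<and> F \<subseteq> K \<and> Sup \<Q> - (1/4)^n < q F" for n :: nat
    using less_cSup_iff[OF ne bd, of "Sup \<Q> - (1/4)^n"] by (auto simp: \<Q>_def)
  then obtain F where F: "\<And>n::nat. finite (F n)" "\<And>n. F n \<subseteq> K"
    "\<And>n. Sup \<Q> - (1/4)^n < q (F n)" by metis
  have tail: "q G \<le> (1/4)^n" if G: "finite G" "G \<subseteq> K" "G \<inter> F n = {}" for G n
  proof -
    have "q (G \<union> F n) \<le> Sup \<Q>"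
      using G F bd by (intro cSup_upper) (auto simp: \<Q>_def)
    moreover have "q (G \<union> F n) = q G + q (F n)"
      unfolding q_def using G F by (intro sum.union_disjoint) auto
    ultimately show ?thesis using F(3)[of n] by simp
  qed
  have sL2: "s S \<in> L2" if "finite S" "S \<subseteq> K" for S
    unfolding s_def by (rule comb_L2[OF that])
  have dist: "(L2_norm (\<lambda>x. s S x - s R x))\<^sup>2 = q (S - R) + q (R - S)"
    if "finite S" "S \<subseteq> K" "finite R" "R \<subseteq> K" for S R
  proof -
    define c' where "c' k = (if k \<in> S then c k else - c k)" for k
    have u: "S \<union> R = (S - R) \<union> (R - S) \<union> (S \<inter> R)" by auto
    have "s S x - s R x = (\<Sum>k\<in>(S - R) \<union> (R - S). c' k * e k x)" for x
    proof -
      have "s S x = (\<Sum>k\<in>S - R. c k * e k x) + (\<Sum>k\<in>S \<inter> R. c k * e k x)"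
        unfolding s_def using that by (subst sum.union_disjoint[symmetric]) (auto intro: sum.cong)
      moreover have "s R x = (\<Sum>k\<in>R - S. c k * e k x) + (\<Sum>k\<in>S \<inter> R. c k * e k x)"
        unfolding s_def using that by (subst sum.union_disjoint[symmetric]) (auto intro: sum.cong)
      moreover have "(\<Sum>k\<in>(S - R) \<union> (R - S). c' k * e k x)
          = (\<Sum>k\<in>S - R. c' k * e k x) + (\<Sum>k\<in>R - S. c' k * e k x)"
        using that by (subst sum.union_disjoint) auto
      moreover have "(\<Sum>k\<in>S - R. c' k * e k x) = (\<Sum>k\<in>S - R. c k * e k x)"
        "(\<Sum>k\<in>R - S. c' k * e k x) = - (\<Sum>k\<in>R - S. c k * e k x)"
        by (auto simp: c'_def sum_negf[symmetric] intro!: sum.cong)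
      ultimately show ?thesis by simp
    qed
    then have "(L2_norm (\<lambda>x. s S x - s R x))\<^sup>2 = (\<Sum>k\<in>(S - R) \<union> (R - S). (cmod (c' k))\<^sup>2)"
      using that by (simp add: norm_comb le_supI1 subset_iff)
    also have "\<dots> = (\<Sum>k\<in>(S - R) \<union> (R - S). (cmod (c k))\<^sup>2)"
      by (intro sum.cong) (auto simp: c'_def)
    also have "\<dots> = q (S - R) + q (R - S)"
      unfolding q_def using that by (intro sum.union_disjoint) auto
    finally show ?thesis .
  qed
  have nn: "(\<integral>\<^sup>+x. ennreal ((cmod (f x))\<^sup>2) \<partial>lebesgue) = ennreal ((L2_norm f)\<^sup>2)"
    if "f \<in> L2" for f :: "(real^'n) \<Rightarrow> complex"
    unfolding L2_norm_sq using L2_integrable[OF that] by (intro nn_integral_eq_integral) auto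
  define t where "t n = s (F n)" for n
  have tL2: "t n \<in> L2" for n unfolding t_def by (rule sL2[OF F(1,2)])
  have tm[measurable]: "t n \<in> borel_measurable lebesgue" for n by (rule L2_measurable[OF tL2])
  have step: "(L2_norm (\<lambda>x. t (Suc n) x - t n x))\<^sup>2 \<le> 2 * (1/4)^n" for n
  proof -
    \<comment> \<open>The sets \<open>F n\<close> need not increase, so both differences occur; each
      avoids one of the two sets and is a tail.\<close>
    have "q (F n - F (Suc n)) \<le> (1/4)^Suc n" "q (F (Suc n) - F n) \<le> (1/4)^n"
      by (rule tail; use F(1)[of n] F(2)[of n] F(1)[of "Suc n"] F(2)[of "Suc n"] in auto)+
    moreover have "0 \<le> q (F n - F (Suc n))" unfolding q_def by (rule sum_nonneg) simp
    ultimately show ?thesis unfolding t_def dist[OF F(1,2) F(1,2)] by simp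
  qed
  have AE_conv: "AE x in lebesgue. convergent (\<lambda>n. t n x)"
  proof -
    \<comment> \<open>The weight \<open>2^n\<close> still leaves a convergent series of integrals,
      and finiteness of \<open>D x\<close> makes the increments decay geometrically with ratio
      \<open>sqrt (1/2)\<close>.\<close>
    define D where "D x = (\<Sum>n. ennreal (2^n * (cmod (t (Suc n) x - t n x))\<^sup>2))" for x
    have "(\<integral>\<^sup>+x. D x \<partial>lebesgue) = (\<Sum>n. \<integral>\<^sup>+x. ennreal (2^n * (cmod (t (Suc n) x - t n x))\<^sup>2) \<partial>lebesgue)"
      unfolding D_def by (rule nn_integral_suminf) measurable
    also have "\<dots> \<le> (\<Sum>n. ennreal (2 * (1/2)^n))"
    proof (intro suminf_le allI)
      fix n
      have "(\<integral>\<^sup>+x. ennreal (2^n * (cmod (t (Suc n) x - t n x))\<^sup>2) \<partial>lebesgue)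
          = ennreal (2^n) * (\<integral>\<^sup>+x. ennreal ((cmod (t (Suc n) x - t n x))\<^sup>2) \<partial>lebesgue)"
        by (subst nn_integral_cmult[symmetric]) (measurable, simp add: ennreal_mult)
      also have "\<dots> = ennreal (2^n * (L2_norm (\<lambda>x. t (Suc n) x - t n x))\<^sup>2)"
        by (subst nn[OF L2_diff[OF tL2 tL2]]) (simp add: ennreal_mult)
      also have "\<dots> \<le> ennreal (2^n * (2 * (1/4)^n))"
        by (intro ennreal_leI mult_left_mono step) simp
      also have "2^n * (2 * (1/4)^n) = (2 * (2 * (1/4))^n :: real)"
        unfolding power_mult_distrib by simp
      also have "2 * (1/4) = (1/2 :: real)" by simp
      finally show "(\<integral>\<^sup>+x. ennreal (2^n * (cmod (t (Suc n) x - t n x))\<^sup>2) \<partial>lebesgue)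
          \<le> ennreal (2 * (1/2)^n)" .
    qed auto
    also have "\<dots> < \<infinity>"
    proof -
      have "summable (\<lambda>n. 2 * (1/2)^n :: real)" by (intro summable_mult summable_geometric) simp
      then show ?thesis by (subst suminf_ennreal2) auto
    qed
    finally have "(\<integral>\<^sup>+x. D x \<partial>lebesgue) \<noteq> \<infinity>" by simp
    moreover have "D \<in> borel_measurable lebesgue" unfolding D_def by measurable
    ultimately have "AE x in lebesgue. D x \<noteq> \<infinity>" by (rule nn_integral_PInf_AE[rotated])
    then show ?thesis
    proof eventually_elim
      case (elim x)
      define b where "b = sqrt (enn2real (D x))"
      have "cmod (t (Suc n) x - t n x) \<le> b * (sqrt (1/2))^n" for n
      proof -
        have "ennreal (2^n * (cmod (t (Suc n) x - t n x))\<^sup>2) \<le> D x"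
        proof -
          define dd where "dd i = ennreal (2^i * (cmod (t (Suc i) x - t i x))\<^sup>2)" for i
          have "dd n = sum dd {n}" by simp
          also have "\<dots> \<le> suminf dd" by (rule sum_le_suminf) auto
          also have "suminf dd = D x" unfolding D_def dd_def ..
          finally show ?thesis by (simp only: dd_def)
        qed
        moreover have "D x < top" using elim by (simp only: infinity_ennreal_def less_top)
        ultimately have "enn2real (ennreal (2^n * (cmod (t (Suc n) x - t n x))\<^sup>2)) \<le> enn2real (D x)"
          by (rule enn2real_mono)
        then have "2^n * (cmod (t (Suc n) x - t n x))\<^sup>2 \<le> enn2real (D x)"
          by (subst (asm) enn2real_ennreal) auto
        then have "(1/2)^n * (2^n * (cmod (t (Suc n) x - t n x))\<^sup>2) \<le> (1/2)^n * enn2real (D x)"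
          by (intro mult_left_mono) auto
        moreover have "(1/2)^n * (2^n * z) = z" for z :: real
          by (simp add: power_divide)
        ultimately have "(cmod (t (Suc n) x - t n x))\<^sup>2 \<le> enn2real (D x) * (1/2)^n"
          by (simp only: mult.commute)
        then have "cmod (t (Suc n) x - t n x) \<le> sqrt (enn2real (D x) * (1/2)^n)"
          by (rule real_le_rsqrt)
        then show ?thesis by (simp only: b_def real_sqrt_mult real_sqrt_power)
      qed
      moreover have "summable (\<lambda>n. b * (sqrt (1/2))^n)"
        by (intro summable_mult summable_geometric) (simp add: real_sqrt_lt_1_iff)
      ultimately have "summable (\<lambda>n. t (Suc n) x - t n x)"
        by (rule summable_comparison_test'[of "\<lambda>n. b * (sqrt (1/2))^n" 0, rotated])
      then have "convergent (\<lambda>n. \<Sum>i<n. t (Suc i) x - t i x)"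
        by (simp only: summable_iff_convergent)
      then have "convergent (\<lambda>n. t n x - t 0 x)" by (simp only: sum_lessThan_telescope[of "\<lambda>i. t i x"])
      from convergent_add[OF this convergent_const[of "t 0 x"]] show ?case
        by (simp only: diff_add_cancel)
    qed
  qed
  define g where "g x = lim (\<lambda>n. t n x)" for x
  have gm[measurable]: "g \<in> borel_measurable lebesgue"
    unfolding g_def by (rule borel_measurable_lim_metric) measurable
  have AE_lim: "AE x in lebesgue. (\<lambda>n. t n x) \<longlonglongrightarrow> g x"
    using AE_conv by eventually_elim (simp add: g_def convergent_LIMSEQ_iff)
  \<comment> \<open>Fatou is applied in \<open>n\<close> with \<open>S\<close> fixed: for
    \<open>n >= N\<close> both \<open>S - F n\<close> and \<open>F n - S\<close> are tails of size
    at most \<open>(1/4)^N\<close>.\<close>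
  have fatou: "(\<integral>\<^sup>+x. ennreal ((cmod (s S x - g x))\<^sup>2) \<partial>lebesgue) \<le> ennreal (2 * (1/4)^N)"
    if S: "finite S" "S \<subseteq> K" "F N \<subseteq> S" for S N
  proof -
    have sm[measurable]: "s S \<in> borel_measurable lebesgue" by (rule L2_measurable[OF sL2[OF S(1,2)]])
    have "AE x in lebesgue. ennreal ((cmod (s S x - g x))\<^sup>2)
        \<le> liminf (\<lambda>n. ennreal ((cmod (s S x - t n x))\<^sup>2))"
      using AE_lim
    proof eventually_elim
      case (elim x)
      have "(\<lambda>n. ennreal ((cmod (s S x - t n x))\<^sup>2)) \<longlonglongrightarrow> ennreal ((cmod (s S x - g x))\<^sup>2)"
        by (intro tendsto_intros elim)
      from lim_imp_Liminf[OF sequentially_bot this] show ?case by (simp only: order_refl)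
    qed
    then have "(\<integral>\<^sup>+x. ennreal ((cmod (s S x - g x))\<^sup>2) \<partial>lebesgue)
        \<le> (\<integral>\<^sup>+x. liminf (\<lambda>n. ennreal ((cmod (s S x - t n x))\<^sup>2)) \<partial>lebesgue)"
      by (rule nn_integral_mono_AE)
    also have "\<dots> \<le> liminf (\<lambda>n. \<integral>\<^sup>+x. ennreal ((cmod (s S x - t n x))\<^sup>2) \<partial>lebesgue)"
      by (rule nn_integral_liminf) measurable
    also have "\<dots> \<le> ennreal (2 * (1/4)^N)"
    proof (rule Liminf_le)
      show "\<forall>\<^sub>F n in sequentially. (\<integral>\<^sup>+x. ennreal ((cmod (s S x - t n x))\<^sup>2) \<partial>lebesgue) \<le> ennreal (2 * (1/4)^N)"
        using eventually_ge_at_top[of N]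
      proof eventually_elim
        case (elim n)
        have "q (S - F n) \<le> (1/4)^n" by (rule tail) (use S in auto)
        also have "\<dots> \<le> (1/4)^N" using elim by (intro power_decreasing) auto
        finally have "q (S - F n) \<le> (1/4)^N" .
        moreover have "q (F n - S) \<le> (1/4)^N"
          by (rule tail) (use S F(1)[of n] F(2)[of n] in auto)
        ultimately have "(L2_norm (\<lambda>x. s S x - t n x))\<^sup>2 \<le> 2 * (1/4)^N"
          unfolding t_def dist[OF S(1,2) F(1,2)] by simp
        then show ?case
          using nn[OF L2_diff[OF sL2[OF S(1,2)] tL2, of n]] by (simp add: ennreal_leI)
      qed
    qed simp
    finally show ?thesis .
  qed
  have diffL2: "(\<lambda>x. s S x - g x) \<in> L2" if S: "finite S" "S \<subseteq> K" "F N \<subseteq> S" for S N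
  proof -
    have sm[measurable]: "s S \<in> borel_measurable lebesgue" by (rule L2_measurable[OF sL2[OF S(1,2)]])
    have "integrable lebesgue (\<lambda>x. (cmod (s S x - g x))\<^sup>2)"
      using le_less_trans[OF fatou[OF S] ennreal_less_top] by (intro integrableI_bounded) auto
    then show ?thesis by (simp add: L2_def)
  qed
  have gL2: "g \<in> L2"
  proof -
    have "(\<lambda>x. s (F 0) x - (s (F 0) x - g x)) \<in> L2"
      by (rule L2_diff[OF sL2[OF F(1,2)] diffL2[OF F(1,2) order_refl]])
    then show ?thesis by simp
  qed
  have small: "L2_norm (\<lambda>x. s S x - g x) \<le> sqrt 2 * (1/2)^N"
    if S: "finite S" "S \<subseteq> K" "F N \<subseteq> S" for S N
  proof -
    have "(L2_norm (\<lambda>x. s S x - g x))\<^sup>2 \<le> 2 * (1/4)^N"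
      using fatou[OF S] unfolding nn[OF diffL2[OF S]] by (subst (asm) ennreal_le_iff) auto
    also have "2 * (1/4)^N = (sqrt 2 * (1/2)^N)\<^sup>2"
    proof -
      have "((1/2)^N)\<^sup>2 = (((1/2)\<^sup>2)^N :: real)"
        by (simp only: power_mult[symmetric] mult.commute)
      then show ?thesis by (simp add: power_divide power_mult_distrib)
    qed
    finally show ?thesis by (rule power2_le_imp_le) simp
  qed
  have "((\<lambda>S. L2_norm (\<lambda>x. s S x - g x)) \<longlongrightarrow> 0) (finite_subsets_at_top K)"
  proof (rule tendstoI)
    fix \<epsilon> :: real assume "0 < \<epsilon>"
    have "(\<lambda>N. sqrt 2 * (1/2)^N) \<longlonglongrightarrow> sqrt 2 * 0"
      by (intro tendsto_intros LIMSEQ_power_zero) simp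
    then have "\<forall>\<^sub>F N in sequentially. sqrt 2 * (1/2)^N < \<epsilon>"
      using \<open>0 < \<epsilon>\<close> by (intro order_tendstoD) auto
    then obtain N where N: "sqrt 2 * (1/2)^N < \<epsilon>" by (auto simp: eventually_sequentially)
    show "\<forall>\<^sub>F S in finite_subsets_at_top K. dist (L2_norm (\<lambda>x. s S x - g x)) 0 < \<epsilon>"
      unfolding eventually_finite_subsets_at_top
    proof (intro exI[of _ "F N"] conjI allI impI)
      fix S assume "finite S \<and> F N \<subseteq> S \<and> S \<subseteq> K"
      then show "dist (L2_norm (\<lambda>x. s S x - g x)) 0 < \<epsilon>"
        using small[of S N] N L2_norm_nonneg[of "\<lambda>x. s S x - g x"] by (simp add: dist_real_def)
    qed (use F in auto)
  qed
  then have "L2_has_sum (\<lambda>k x. c k * e k x) K g"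
    unfolding L2_has_sum_def s_def using gL2 e_L2 L2_cmult by blast
  then show ?thesis by (rule that)
qed

lemma inner_L2_sum:
  assumes bdd: "\<And>S. finite S \<Longrightarrow> S \<subseteq> K \<Longrightarrow> (\<Sum>k\<in>S. (cmod (c k))\<^sup>2) \<le> C"
  shows "L2_has_sum (\<lambda>k x. c k * e k x) K (L2_sum (\<lambda>k x. c k * e k x) K)"
    and "j \<in> K \<Longrightarrow> L2_inner (L2_sum (\<lambda>k x. c k * e k x) K) (e j) = c j"
proof -
  obtain g where "L2_has_sum (\<lambda>k x. c k * e k x) K g" by (rule riesz_fischer[OF bdd])
  then show h: "L2_has_sum (\<lambda>k x. c k * e k x) K (L2_sum (\<lambda>k x. c k * e k x) K)"
    by (rule L2_has_sum_L2_sum)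
  show "L2_inner (L2_sum (\<lambda>k x. c k * e k x) K) (e j) = c j" if "j \<in> K"
    using L2_has_sum_inner_finite[OF h e_L2[OF that], of "{j}"] that
    by (simp add: L2_inner_cmult e_inner)
qed

end
section \<open>Multiplication by a weight in the Haar basis\<close>

lemma L2_loc_cL2:
  assumes "f \<in> L2"
  shows "loc_cL2 f"
  unfolding loc_cL2_def loc_L2_def locally_integrable_def set_integrable_def
proof (intro conjI allI impI)
  fix K :: "(real^'a) set" assume "compact K"
  then have "K \<in> sets lebesgue" by (simp add: compact_imp_closed)
  then show "integrable lebesgue (\<lambda>x. indicat_real K x *\<^sub>R (cmod (f x))\<^sup>2)"
    using L2_integrable[OF assms] by (rule integrable_mult_indicator)
qed (use L2_measurable[OF assms] in auto)

lemma mass_le_L2_norm: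
  assumes "f \<in> L2" "A \<in> bsets"
  shows "mass (\<lambda>x. (cmod (f x))\<^sup>2) A \<le> (L2_norm f)\<^sup>2"
  unfolding L2_norm_sq set_lebesgue_integral_def
  by (rule integral_mono[OF integrable_mult_indicator[OF bsets_sets[OF assms(2)]
          L2_integrable[OF assms(1)]] L2_integrable[OF assms(1)]]) (simp add: indicator_def)

lemma cmass_of_real: "cmass (\<lambda>x. of_real (f x)) A = of_real (mass f A)"
  by (simp add: set_lebesgue_integral_def scaleR_conv_of_real of_real_mult[symmetric] del: of_real_mult)

lemma cmass_sum:
  assumes "\<And>i. i \<in> S \<Longrightarrow> locally_cintegrable (F i)" "A \<in> bsets"
  shows "cmass (\<lambda>x. \<Sum>i\<in>S. c i * F i x) A = (\<Sum>i\<in>S. c i * cmass (F i) A)"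
proof -
  have i: "set_integrable lebesgue A (F i)" if "i \<in> S" for i
    using assms that by (intro locally_cintegrable_set)
  have "cmass (\<lambda>x. \<Sum>i\<in>S. c i * F i x) A
      = (LINT x|lebesgue. (\<Sum>i\<in>S. c i * (indicat_real A x *\<^sub>R F i x)))"
    by (simp add: set_lebesgue_integral_def scaleR_sum_right)
  also have "\<dots> = (\<Sum>i\<in>S. LINT x|lebesgue. c i * (indicat_real A x *\<^sub>R F i x))"
    using i by (intro Bochner_Integration.integral_sum integrable_mult_right)
      (simp add: set_integrable_def)
  also have "\<dots> = (\<Sum>i\<in>S. c i * cmass (F i) A)"
    by (simp only: set_lebesgue_integral_def integral_mult_right_zero)
  finally show ?thesis .
qed

context laminar
begin

definition hf :: "'k \<Rightarrow> (real^'n) \<Rightarrow> complex" where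
  "hf k x = of_real ((indicator (P k) x - indicator (N k) x) / sqrt (vol (U k)))"

lemma haar_at_sum:
  assumes "\<And>i. i \<in> S \<Longrightarrow> locally_cintegrable (F i)" "k \<in> K"
  shows "haar_at (\<lambda>x. \<Sum>i\<in>S. c i * F i x) k = (\<Sum>i\<in>S. c i * haar_at (F i) k)"
  using assms by (simp add: haar_at_def cmass_sum P_bsets N_bsets sum_subtractf[symmetric]
      right_diff_distrib[symmetric] sum_divide_distrib)

lemma cav_sum:
  assumes "\<And>i. i \<in> S \<Longrightarrow> locally_cintegrable (F i)" "k \<in> K"
  shows "cav (\<lambda>x. \<Sum>i\<in>S. c i * F i x) k = (\<Sum>i\<in>S. c i * cav (F i) k)"
  using assms by (simp add: cav_def cmass_sum U_bsets sum_divide_distrib)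

lemma haar_at_of_real:
  "haar_at (\<lambda>x. of_real (u x)) k
    = of_real ((mass u (P k) - mass u (N k)) / sqrt (vol (U k)))"
  by (simp add: haar_at_def cmass_of_real)

lemma mult_hf_L2:
  assumes u: "loc_L2 u" and l: "l \<in> K"
  shows "(\<lambda>x. of_real (u x) * hf l x) \<in> L2"
proof -
  have [measurable]: "u \<in> borel_measurable lebesgue" using u by (simp add: loc_L2_def)
  have [measurable]: "P l \<in> sets lebesgue" "N l \<in> sets lebesgue"
    using P_bsets[OF l] N_bsets[OF l] by (auto dest: bsets_sets)
  have "set_integrable lebesgue (U l) (sq u)"
    using u l by (intro locally_integrable_set U_bsets) (auto simp: loc_L2_def)
  then have "integrable lebesgue (\<lambda>x. (indicator (U l) x *\<^sub>R (u x)\<^sup>2) / vol (U l))"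
    by (simp add: set_integrable_def)
  moreover have "(\<lambda>x. (indicator (U l) x *\<^sub>R (u x)\<^sup>2) / vol (U l))
      = (\<lambda>x. (cmod (of_real (u x) * hf l x))\<^sup>2)"
  proof
    fix x
    have "(indicator (P l) x - indicator (N l) x :: real)\<^sup>2 = indicator (U l) x"
      using disj[OF l] by (auto simp: U_def indicator_def)
    then show "(indicator (U l) x *\<^sub>R (u x)\<^sup>2) / vol (U l)
        = (cmod (of_real (u x) * hf l x))\<^sup>2"
      unfolding hf_def of_real_mult[symmetric] norm_of_real power2_abs
      by (simp add: power_mult_distrib power_divide mult.commute)
  qed
  ultimately show ?thesis by (simp add: L2_def hf_def)
qed

lemma hf_L2: "l \<in> K \<Longrightarrow> hf l \<in> L2"
  using mult_hf_L2[OF loc_L2_one] by simp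

lemma haar1_L2:
  assumes "l \<in> K"
  shows "haar1 (U l) \<in> L2"
proof -
  have [measurable]: "U l \<in> sets lebesgue" using assms U_bsets by (auto dest: bsets_sets)
  have "integrable lebesgue (indicator (U l) :: _ \<Rightarrow> real)"
    using bsets_lmeasurable[OF U_bsets[OF assms]] lmeasurable_iff_integrable by blast
  then have "integrable lebesgue (\<lambda>x. indicat_real (U l) x / (vol (U l))\<^sup>2)" by simp
  moreover have "(\<lambda>x. indicat_real (U l) x / (vol (U l))\<^sup>2) = (\<lambda>x. (cmod (haar1 (U l) x))\<^sup>2)"
    unfolding haar1_def norm_of_real power2_abs by (auto simp: power_divide indicator_def)
  ultimately show ?thesis by (simp add: L2_def haar1_def[abs_def])
qed

lemma cmass_mult_hf:
  assumes u: "loc_L2 u" and l: "l \<in> K" and A: "A \<in> bsets"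
  shows "cmass (\<lambda>x. of_real (u x) * hf l x) A
    = of_real ((mass u (A \<inter> P l) - mass u (A \<inter> N l)) / sqrt (vol (U l)))"
proof -
  have b: "A \<inter> P l \<in> bsets" "A \<inter> N l \<in> bsets"
    using A P_bsets[OF l] N_bsets[OF l] by (auto simp: bsets_def)
  note i = locally_integrable_set[OF loc_L2_locally_integrable[OF u] b(1)]
    locally_integrable_set[OF loc_L2_locally_integrable[OF u] b(2)]
  have "cmass (\<lambda>x. of_real (u x) * hf l x) A
      = of_real (mass (\<lambda>x. u x * ((indicator (P l) x - indicator (N l) x) / sqrt (vol (U l)))) A)"
    unfolding hf_def of_real_mult[symmetric] by (rule cmass_of_real)
  also have "mass (\<lambda>x. u x * ((indicator (P l) x - indicator (N l) x) / sqrt (vol (U l)))) A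
      = (LINT x|lebesgue. (indicat_real (A \<inter> P l) x *\<^sub>R u x - indicat_real (A \<inter> N l) x *\<^sub>R u x)
          / sqrt (vol (U l)))"
    unfolding set_lebesgue_integral_def
    by (intro Bochner_Integration.integral_cong) (auto simp: indicator_def)
  also have "\<dots> = (mass u (A \<inter> P l) - mass u (A \<inter> N l)) / sqrt (vol (U l))"
    using i unfolding set_integrable_def set_lebesgue_integral_def by simp
  finally show ?thesis .
qed

lemma cmass_haar1:
  assumes "l \<in> K" "A \<in> bsets"
  shows "cmass (haar1 (U l)) A = of_real (mass (\<lambda>x. 1) (U l \<inter> A) / vol (U l))"
proof -
  have "cmass (haar1 (U l)) A = of_real (mass (\<lambda>x. indicator (U l) x / vol (U l)) A)"
    unfolding haar1_def by (rule cmass_of_real)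
  also have "mass (\<lambda>x. indicator (U l) x / vol (U l)) A
      = (LINT x|lebesgue. (indicat_real (U l \<inter> A) x *\<^sub>R 1) / vol (U l))"
    unfolding set_lebesgue_integral_def
    by (intro Bochner_Integration.integral_cong) (auto simp: indicator_def)
  also have "\<dots> = mass (\<lambda>x. 1) (U l \<inter> A) / vol (U l)"
    unfolding set_lebesgue_integral_def by (rule Bochner_Integration.integral_divide_zero)
  finally show ?thesis .
qed

text \<open>The decomposition of multiplication by \<open>u\<close> into three paraproducts, tested
  on Haar functions. At most one summand is nonzero: the first if \<open>k = l\<close>; the second
  if \<open>U k\<close> lies in a half of \<open>U l\<close>, where \<open>hf l\<close> is constant;
  the third if \<open>U l\<close> lies in a half of \<open>U k\<close>, where \<open>hf k\<close> is
  constant. For disjoint supports everything vanishes.\<close>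

lemma haar_at_mult_hf:
  assumes u: "loc_L2 u" and k: "k \<in> K" and l: "l \<in> K"
  shows "haar_at (\<lambda>x. of_real (u x) * hf l x) k = (if k = l then of_real (av u k) else 0)
    + haar_at (\<lambda>x. of_real (u x)) k * cav (hf l) k
    + haar_at (\<lambda>x. of_real (u x)) l * haar_at (haar1 (U l)) k"
proof -
  define mk where "mk = vol (U k)"
  define ml where "ml = vol (U l)"
  define c where "c A = mass (\<lambda>x. 1::real) A" for A :: "(real^'n) set"
  have pos: "0 < mk" "0 < ml" using U_pos k l by (auto simp: mk_def ml_def)
  have e: "mass f {} = 0" for f :: "(real^'n) \<Rightarrow> real" by (simp add: set_lebesgue_integral_def)
  have c0: "c {} = 0" "c (P k) = c (N k)" "c (P l) = c (N l)" "c (U k) = mk" "c (U l) = ml"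
    using e k l by (simp_all add: c_def mass_const P_bsets N_bsets U_bsets halves mk_def ml_def)
  have uU: "mass u (U k) = mass u (P k) + mass u (N k)"
    by (rule mass_U[OF loc_L2_locally_integrable[OF u] k])
  have "((mass u (P k \<inter> P l) - mass u (P k \<inter> N l)) / sqrt ml
        - (mass u (N k \<inter> P l) - mass u (N k \<inter> N l)) / sqrt ml) / sqrt mk
    = (if k = l then mass u (U k) / mk else 0)
      + (mass u (P k) - mass u (N k)) / sqrt mk * ((c (U k \<inter> P l) - c (U k \<inter> N l)) / sqrt ml / mk)
      + (mass u (P l) - mass u (N l)) / sqrt ml * ((c (U l \<inter> P k) / ml - c (U l \<inter> N k) / ml) / sqrt mk)"
    (is "?L = ?R")
  proof (cases "k = l")
    case True
    have s: "P l \<inter> P l = P l" "N l \<inter> N l = N l" "P l \<inter> N l = {}" "N l \<inter> P l = {}"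
      "U l \<inter> P l = P l" "U l \<inter> N l = N l"
      using disj[OF l] by (auto simp: U_def)
    have mm: "ml = mk" using True by (simp add: ml_def mk_def)
    have "?L = (mass u (P l) + mass u (N l)) / (sqrt mk * sqrt mk)"
      unfolding True s e mm by (simp add: add_divide_distrib)
    also have "\<dots> = ?R" unfolding True s c0 using uU pos True by simp
    finally show ?thesis .
  next
    case False
    have pc: "c (P l) + c (N l) = ml" "c (P k) + c (N k) = mk"
      unfolding c_def ml_def mk_def
      using mass_U[OF locally_integrable_const[of 1] l] mass_U[OF locally_integrable_const[of 1] k]
      by (simp_all add: mass_const U_bsets k l)
    consider "U k \<subseteq> P l" | "U k \<subseteq> N l" | "U l \<subseteq> P k" | "U l \<subseteq> N k" | "U k \<inter> U l = {}"
      using nested[OF k l False] unfolding U_def by blast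
    then show ?thesis
    proof cases
      case 1
      have s: "P k \<inter> P l = P k" "P k \<inter> N l = {}" "N k \<inter> P l = N k" "N k \<inter> N l = {}"
        "U k \<inter> P l = U k" "U k \<inter> N l = {}" "U l \<inter> P k = P k" "U l \<inter> N k = N k"
        using 1 disj[OF l] by (auto simp: U_def)
      show ?thesis unfolding s c0 e using False pos by (simp add: diff_divide_distrib mult.commute)
    next
      case 2
      have s: "P k \<inter> P l = {}" "P k \<inter> N l = P k" "N k \<inter> P l = {}" "N k \<inter> N l = N k"
        "U k \<inter> P l = {}" "U k \<inter> N l = U k" "U l \<inter> P k = P k" "U l \<inter> N k = N k"
        using 2 disj[OF l] by (auto simp: U_def)
      show ?thesis unfolding s c0 e using False pos by (simp add: diff_divide_distrib mult.commute)
    next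
      case 3
      have s: "P k \<inter> P l = P l" "P k \<inter> N l = N l" "N k \<inter> P l = {}" "N k \<inter> N l = {}"
        "U k \<inter> P l = P l" "U k \<inter> N l = N l" "U l \<inter> P k = U l" "U l \<inter> N k = {}"
        using 3 disj[OF k] by (auto simp: U_def)
      show ?thesis unfolding s c0 e using False pos by (simp add: diff_divide_distrib mult.commute)
    next
      case 4
      have s: "P k \<inter> P l = {}" "P k \<inter> N l = {}" "N k \<inter> P l = P l" "N k \<inter> N l = N l"
        "U k \<inter> P l = P l" "U k \<inter> N l = N l" "U l \<inter> P k = {}" "U l \<inter> N k = U l"
        using 4 disj[OF k] by (auto simp: U_def)
      show ?thesis unfolding s c0 e using False pos by (simp add: diff_divide_distrib mult.commute)
    next
      case 5
      have s: "P k \<inter> P l = {}" "P k \<inter> N l = {}" "N k \<inter> P l = {}" "N k \<inter> N l = {}"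
        "U k \<inter> P l = {}" "U k \<inter> N l = {}" "U l \<inter> P k = {}" "U l \<inter> N k = {}"
        using 5 by (auto simp: U_def)
      show ?thesis unfolding s c0 e using False by simp
    qed
  qed
  note real = this
  have 1: "haar_at (\<lambda>x. of_real (u x) * hf l x) k = of_real ?L"
    unfolding haar_at_def cmass_mult_hf[OF u l P_bsets[OF k]] cmass_mult_hf[OF u l N_bsets[OF k]]
      mk_def ml_def by simp
  have 2: "cav (hf l) k = of_real ((c (U k \<inter> P l) - c (U k \<inter> N l)) / sqrt ml / mk)"
    using cmass_mult_hf[OF loc_L2_one l U_bsets[OF k]] by (simp add: cav_def c_def mk_def ml_def)
  have 3: "haar_at (haar1 (U l)) k = of_real ((c (U l \<inter> P k) / ml - c (U l \<inter> N k) / ml) / sqrt mk)"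
    unfolding haar_at_def cmass_haar1[OF l P_bsets[OF k]] cmass_haar1[OF l N_bsets[OF k]]
    by (simp add: c_def mk_def ml_def)
  show ?thesis
    unfolding 1 2 3 haar_at_of_real real mk_def[symmetric] ml_def[symmetric] av_def by simp
qed

lemma haar_at_one: "k \<in> K \<Longrightarrow> haar_at (\<lambda>x. 1) k = 0"
  using haar_at_of_real[of "\<lambda>x. 1" k] by (simp add: mass_const P_bsets N_bsets halves)

text \<open>Orthonormality is the product formula for \<open>u = 1\<close>, whose own Haar
  coefficients are zero.\<close>

lemma haar_at_hf:
  assumes "k \<in> K" "l \<in> K"
  shows "haar_at (hf l) k = (if k = l then 1 else 0)"
  using haar_at_mult_hf[OF loc_L2_one assms] U_pos[OF assms(2)]
  by (simp add: haar_at_one assms av_def mass_const U_bsets)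

lemma inner_hf:
  assumes "f \<in> L2" "k \<in> K"
  shows "L2_inner f (hf k) = haar_at f k"
proof -
  note ci = loc_cL2_locally_cintegrable[OF L2_loc_cL2[OF assms(1)]]
  have i: "set_integrable lebesgue (P k) f" "set_integrable lebesgue (N k) f"
    using assms(2) by (auto intro: locally_cintegrable_set ci P_bsets N_bsets)
  have "L2_inner f (hf k) = (LINT x|lebesgue. (indicat_real (P k) x *\<^sub>R f x - indicat_real (N k) x *\<^sub>R f x)
      / of_real (sqrt (vol (U k))))"
    unfolding L2_inner_def hf_def
    by (intro Bochner_Integration.integral_cong) (auto simp: indicator_def)
  also have "\<dots> = haar_at f k"
    using i unfolding set_integrable_def haar_at_def set_lebesgue_integral_def by simp
  finally show ?thesis .
qed

sublocale hf: orthonormal hf K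
proof
  show "hf k \<in> L2" if "k \<in> K" for k by (rule hf_L2[OF that])
  show "L2_inner (hf j) (hf k) = (if j = k then 1 else 0)" if "j \<in> K" "k \<in> K" for j k
    using that by (auto simp: inner_hf hf_L2 haar_at_hf)
qed

text \<open>The three types of paraproduct of a polynomial, in the order \<open>(0,0)\<close>, \<open>(0,1)\<close>, \<open>(1,0)\<close>.\<close>

definition para_sums ::
  "((real^'n) \<Rightarrow> real) \<Rightarrow> ((real^'n) \<Rightarrow> complex) \<Rightarrow> ((real^'n) \<Rightarrow> complex) set" where
  "para_sums u f =
     {L2_sum (\<lambda>k x. of_real (av u k) * haar_at f k * hf k x) K,
      L2_sum (\<lambda>k x. haar_at (\<lambda>x. of_real (u x)) k * cav f k * hf k x) K,
      L2_sum (\<lambda>k x. haar_at (\<lambda>x. of_real (u x)) k * haar_at f k * haar1 (U k) x) K}"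

text \<open>For a Haar polynomial the sums of type \<open>(0, 0)\<close> and \<open>(1, 0)\<close>
  have finitely many nonzero terms. The sum of type \<open>(0, 1)\<close> may be infinite; its
  coefficients are recognised as those of the product minus the two finite sums, an
  \<open>L2\<close> function, so they are square summable.\<close>

lemma para_sums_dominated:
  assumes u: "loc_L2 u" "\<And>x. 0 < u x" and S: "finite S" "S \<subseteq> K"
    and f: "f = (\<lambda>x. \<Sum>l\<in>S. c l * hf l x)" and p: "p \<in> para_sums u f"
  shows "p \<in> L2" and "k \<in> K \<Longrightarrow> cmod (haar_at p k) \<le> dominant u f k"
proof -
  let ?u = "\<lambda>x. complex_of_real (u x)"
  have SK: "l \<in> K" if "l \<in> S" for l using S that by auto
  have hf_ci: "locally_cintegrable (hf l)" if "l \<in> S" for l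
    by (rule loc_cL2_locally_cintegrable[OF L2_loc_cL2[OF hf_L2[OF SK[OF that]]]])
  have uhf_ci: "locally_cintegrable (\<lambda>x. ?u x * hf l x)" if "l \<in> S" for l
    by (rule loc_cL2_locally_cintegrable[OF L2_loc_cL2[OF mult_hf_L2[OF u(1) SK[OF that]]]])
  have fL2: "f \<in> L2" unfolding f by (rule hf.comb_L2[OF S])
  have fc: "loc_cL2 f" by (rule L2_loc_cL2[OF fL2])
  have f_at: "haar_at f k = (if k \<in> S then c k else 0)" if k: "k \<in> K" for k
    using hf.inner_comb[OF S k, of c] inner_hf[OF fL2 k] f by simp
  have uf: "(\<lambda>x. ?u x * f x) = (\<lambda>x. \<Sum>l\<in>S. c l * (?u x * hf l x))"
    unfolding f by (simp add: sum_distrib_left mult_ac)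
  have ufL2: "(\<lambda>x. ?u x * f x) \<in> L2"
    unfolding uf using S SK by (intro L2_setsum L2_cmult mult_hf_L2 u(1)) auto
  \<comment> \<open>The paraproduct of type \<open>(1, 0)\<close>: outside \<open>S\<close> the Haar
    coefficients of \<open>f\<close> vanish.\<close>
  define r where "r x = (\<Sum>l\<in>S. (haar_at ?u l * haar_at f l) * haar1 (U l) x)" for x
  have rL2: "r \<in> L2" unfolding r_def using S SK by (intro L2_setsum L2_cmult haar1_L2) auto
  have r_at: "haar_at r k = (\<Sum>l\<in>S. (haar_at ?u l * haar_at f l) * haar_at (haar1 (U l)) k)"
    if k: "k \<in> K" for k
    unfolding r_def using SK k
    by (intro haar_at_sum loc_cL2_locally_cintegrable L2_loc_cL2 haar1_L2)
  have prod: "haar_at (\<lambda>x. ?u x * f x) k = of_real (av u k) * haar_at f k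
      + haar_at ?u k * cav f k + haar_at r k" if k: "k \<in> K" for k
  proof -
    have "haar_at (\<lambda>x. ?u x * f x) k = (\<Sum>l\<in>S. c l * haar_at (\<lambda>x. ?u x * hf l x) k)"
      unfolding uf by (rule haar_at_sum[OF uhf_ci k])
    also have "\<dots> = (\<Sum>l\<in>S. of_real (av u k) * (c l * (if k = l then 1 else 0))
        + haar_at ?u k * (c l * cav (hf l) k)
        + (haar_at ?u l * haar_at f l) * haar_at (haar1 (U l)) k)"
      using SK k by (intro sum.cong refl)
        (simp add: haar_at_mult_hf[OF u(1)] f_at distrib_left mult_ac)
    also have "\<dots> = of_real (av u k) * haar_at f k + haar_at ?u k * (\<Sum>l\<in>S. c l * cav (hf l) k)
        + haar_at r k"
    proof -
      have "(\<Sum>l\<in>S. c l * (if k = l then 1 else 0)) = (\<Sum>l\<in>S. if k = l then c l else 0)"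
        by (intro sum.cong) auto
      also have "\<dots> = haar_at f k" using f_at[OF k] S(1) by simp
      finally show ?thesis unfolding sum.distrib sum_distrib_left[symmetric] r_at[OF k] by simp
    qed
    also have "(\<Sum>l\<in>S. c l * cav (hf l) k) = cav f k"
      unfolding f by (rule cav_sum[OF hf_ci k, symmetric])
    finally show ?thesis .
  qed
  define s where "s x = (\<Sum>l\<in>S. (of_real (av u l) * haar_at f l) * hf l x)" for x
  have sL2: "s \<in> L2" unfolding s_def by (rule hf.comb_L2[OF S])
  have s_at: "haar_at s k = of_real (av u k) * haar_at f k" if k: "k \<in> K" for k
  proof -
    have "haar_at s k = (if k \<in> S then of_real (av u k) * haar_at f k else 0)"
      unfolding inner_hf[OF sL2 k, symmetric] s_def by (rule hf.inner_comb[OF S k])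
    then show ?thesis using f_at[OF k] by auto
  qed
  \<comment> \<open>The candidate for the paraproduct of type \<open>(0, 1)\<close>, with the
    required coefficients by \<open>prod\<close>.\<close>
  define q where "q x = (?u x * f x - s x) - r x" for x
  have qL2: "q \<in> L2" unfolding q_def by (intro L2_diff ufL2 sL2 rL2)
  have q_at: "haar_at q k = haar_at ?u k * cav f k" if k: "k \<in> K" for k
  proof -
    have "haar_at q k = haar_at (\<lambda>x. ?u x * f x) k - haar_at s k - haar_at r k"
      unfolding inner_hf[OF qL2 k, symmetric] inner_hf[OF ufL2 k, symmetric]
        inner_hf[OF sL2 k, symmetric] inner_hf[OF rL2 k, symmetric] q_def
      by (subst L2_inner_diff; (intro L2_diff ufL2 sL2 rL2 hf_L2 k)?)
        (subst L2_inner_diff; (intro L2_diff ufL2 sL2 rL2 hf_L2 k refl)?)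
    then show ?thesis using prod[OF k] s_at[OF k] by simp
  qed
  note dom = dominant_bounds[OF fc u]
  \<comment> \<open>Coefficients of some \<open>L2\<close> function pass Bessel's inequality, so the
    Haar series built from them converges and has the same coefficients.\<close>
  have coeff_sum: "L2_sum (\<lambda>k x. d k * hf k x) K \<in> L2 \<and>
      (\<forall>k\<in>K. haar_at (L2_sum (\<lambda>k x. d k * hf k x) K) k = d k)"
    if g: "g \<in> L2" "\<And>k. k \<in> K \<Longrightarrow> haar_at g k = d k" for g d
  proof -
    have bd: "(\<Sum>k\<in>R. (cmod (d k))\<^sup>2) \<le> (L2_norm g)\<^sup>2" if R: "finite R" "R \<subseteq> K" for R
    proof -
      have "(\<Sum>k\<in>R. (cmod (d k))\<^sup>2) = (\<Sum>k\<in>R. (cmod (L2_inner g (hf k)))\<^sup>2)"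
        using R g by (intro sum.cong) (auto simp: inner_hf subset_iff)
      then show ?thesis using hf.bessel[OF g(1) R] by simp
    qed
    have L: "L2_sum (\<lambda>k x. d k * hf k x) K \<in> L2"
      using hf.inner_L2_sum(1)[OF bd] by (simp add: L2_has_sum_def)
    moreover have "haar_at (L2_sum (\<lambda>k x. d k * hf k x) K) k = d k" if k: "k \<in> K" for k
      using hf.inner_L2_sum(2)[OF bd k] inner_hf[OF L k] by simp
    ultimately show ?thesis by blast
  qed
  consider "p = L2_sum (\<lambda>k x. (of_real (av u k) * haar_at f k) * hf k x) K"
    | "p = L2_sum (\<lambda>k x. (haar_at ?u k * cav f k) * hf k x) K"
    | "p = L2_sum (\<lambda>k x. (haar_at ?u k * haar_at f k) * haar1 (U k) x) K"
    using p unfolding para_sums_def by blast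
  then have "p \<in> L2 \<and> (\<forall>k\<in>K. cmod (haar_at p k) \<le> dominant u f k)"
  proof cases
    case 1
    then show ?thesis using coeff_sum[OF sL2 s_at] dom(1) by auto
  next
    case 2
    then show ?thesis using coeff_sum[OF qL2 q_at] dom(2) by auto
  next
    case 3
    \<comment> \<open>The functions \<open>haar1 (U k)\<close> are not orthogonal; convergence comes
      from the sum being finite.\<close>
    let ?F = "\<lambda>k x. (haar_at ?u k * haar_at f k) * haar1 (U k) x"
    have FL2: "?F k \<in> L2" if "k \<in> K" for k by (intro L2_cmult haar1_L2 that)
    have "L2_has_sum ?F K (\<lambda>x. \<Sum>k\<in>S. ?F k x)"
      by (rule L2_has_sum_finite[OF FL2 S]) (auto simp: f_at)
    then have hs: "L2_has_sum ?F K p" unfolding 3 by (rule L2_has_sum_L2_sum)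
    then have pL2: "p \<in> L2" by (simp add: L2_has_sum_def)
    have "haar_at p k = haar_at r k" if k: "k \<in> K" for k
    proof -
      have "haar_at p k = (\<Sum>l\<in>S. L2_inner (?F l) (hf k))"
        unfolding inner_hf[OF pL2 k, symmetric]
        by (rule L2_has_sum_inner_finite[OF hs hf_L2[OF k] S]) (simp add: f_at L2_inner_def)
      also have "\<dots> = haar_at r k"
        unfolding r_at[OF k] using SK k
        by (intro sum.cong refl) (simp add: L2_inner_cmult inner_hf haar1_L2)
      finally show ?thesis .
    qed
    then have "cmod (haar_at p k) \<le> dominant u f k" if "k \<in> K" for k
      using dom(3)[OF that] prod[OF that] that by simp
    then show ?thesis using pL2 by blast
  qed
  then show "p \<in> L2" "k \<in> K \<Longrightarrow> cmod (haar_at p k) \<le> dominant u f k" by auto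
qed

end

section \<open>The bilinear form of a multiplier between two paraproducts\<close>

lemma L2_sum_cong:
  assumes "\<And>k. k \<in> A \<Longrightarrow> F k = G k"
  shows "L2_sum F A = L2_sum G A"
proof -
  have "L2_has_sum F A g = L2_has_sum G A g" for g
  proof -
    have "((\<lambda>S. L2_norm (\<lambda>x. (\<Sum>i\<in>S. F i x) - g x)) \<longlongrightarrow> 0) (finite_subsets_at_top A)
      = ((\<lambda>S. L2_norm (\<lambda>x. (\<Sum>i\<in>S. G i x) - g x)) \<longlongrightarrow> 0) (finite_subsets_at_top A)"
    proof (rule tendsto_cong, rule eventually_finite_subsets_at_top_weakI)
      fix S assume "finite S" "S \<subseteq> A"
      then have "(\<lambda>x. (\<Sum>i\<in>S. F i x) - g x) = (\<lambda>x. (\<Sum>i\<in>S. G i x) - g x)"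
        using assms by (auto intro!: sum.cong simp: subset_iff)
      then show "L2_norm (\<lambda>x. (\<Sum>i\<in>S. F i x) - g x) = L2_norm (\<lambda>x. (\<Sum>i\<in>S. G i x) - g x)"
        by simp
    qed
    then show ?thesis using assms by (simp add: L2_has_sum_def)
  qed
  then show ?thesis by (simp add: L2_sum_def)
qed

context laminar
begin

lemma integral_mult_hf:
  assumes f: "locally_cintegrable f" and k: "k \<in> K"
  shows "(LINT x|lebesgue. f x * hf k x) = haar_at f k"
proof -
  have i: "set_integrable lebesgue (P k) f" "set_integrable lebesgue (N k) f"
    by (auto intro: locally_cintegrable_set f P_bsets N_bsets k)
  have "(LINT x|lebesgue. f x * hf k x) = (LINT x|lebesgue. (indicat_real (P k) x *\<^sub>R f x
      - indicat_real (N k) x *\<^sub>R f x) / of_real (sqrt (vol (U k))))"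
    unfolding hf_def by (intro Bochner_Integration.integral_cong) (auto simp: indicator_def)
  also have "\<dots> = haar_at f k"
    using i unfolding set_integrable_def haar_at_def set_lebesgue_integral_def by simp
  finally show ?thesis .
qed

text \<open>The form is the limit of finite sums of products of coefficients. Each finite sum is
  bounded by \<open>sum_dominant\<close> with a constant independent of the index set, and the bound
  passes to the limit.\<close>

lemma multiplier_form_bound:
  assumes h: "loc_L2 h" "\<And>x. 0 < h x" and g: "loc_L2 g" "\<And>x. 0 < g x"
    and hg: "\<And>x. h x * g x = 1"
    and A2: "\<And>k. k \<in> K \<Longrightarrow> av (sq h) k * av (sq g) k \<le> Q"
    and S: "finite S" "S \<subseteq> K" and f: "f = (\<lambda>x. \<Sum>l\<in>S. c l * hf l x)"
    and S': "finite S'" "S' \<subseteq> K" and f': "f' = (\<lambda>x. \<Sum>l\<in>S'. c' l * hf l x)"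
    and p: "p \<in> para_sums h f" and p': "p' \<in> para_sums g f'"
    and s: "\<And>k. k \<in> K \<Longrightarrow> cmod (\<sigma> k) \<le> s" and K: "K \<noteq> {}"
  shows "cmod (L2_inner (L2_sum (\<lambda>k x. \<sigma> k * haar_at p k * hf k x) K) p')
    \<le> 500 * Q * s * (L2_norm f * L2_norm f')"
proof -
  obtain k0 where k0: "k0 \<in> K" using K by auto
  \<comment> \<open>One index suffices to see that the constant is at least 1, by Cauchy--Schwarz
    for \<open>h * g = 1\<close>.\<close>
  have "1 \<le> av (sq h) k0 * av (sq g) k0"
    using av_Cauchy_Schwarz[OF h(1) g(1) k0] U_pos[OF k0]
    by (simp add: hg) (simp add: av_def mass_const U_bsets k0)
  then have Q: "1 \<le> Q" using A2[OF k0] by simp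
  have s0: "0 \<le> s" using s[OF k0] norm_ge_zero[of "\<sigma> k0"] by linarith
  have fL2: "f \<in> L2" "f' \<in> L2" unfolding f f' by (intro hf.comb_L2 S S')+
  note pd = para_sums_dominated[OF h S f p] and p'd = para_sums_dominated[OF g S' f' p']
  let ?d = "\<lambda>k. \<sigma> k * haar_at p k"
  have bd: "(\<Sum>k\<in>R. (cmod (?d k))\<^sup>2) \<le> s\<^sup>2 * (L2_norm p)\<^sup>2" if R: "finite R" "R \<subseteq> K" for R
  proof -
    have "(\<Sum>k\<in>R. (cmod (?d k))\<^sup>2) \<le> (\<Sum>k\<in>R. s\<^sup>2 * (cmod (L2_inner p (hf k)))\<^sup>2)"
    proof (rule sum_mono)
      fix k assume "k \<in> R"
      then have k: "k \<in> K" using R by auto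
      show "(cmod (?d k))\<^sup>2 \<le> s\<^sup>2 * (cmod (L2_inner p (hf k)))\<^sup>2"
        unfolding norm_mult power_mult_distrib inner_hf[OF pd(1) k]
        by (intro mult_right_mono power_mono s k) auto
    qed
    also have "\<dots> \<le> s\<^sup>2 * (L2_norm p)\<^sup>2"
      unfolding sum_distrib_left[symmetric] by (intro mult_left_mono hf.bessel pd(1) R) auto
    finally show ?thesis .
  qed
  have partial: "cmod (\<Sum>k\<in>R. L2_inner (\<lambda>x. ?d k * hf k x) p')
      \<le> 500 * Q * s * (L2_norm f * L2_norm f')" if R: "finite R" "R \<subseteq> K" for R
  proof -
    \<comment> \<open>\<open>B\<close> changes with \<open>R\<close>, but only norms over
      \<open>B\<close> enter, and these are at most the norms on the whole space.\<close>
    define B where "B = (\<Union>k\<in>R. U k)"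
    have B: "B \<in> bsets" unfolding B_def using R U_bsets by (intro bsets_UN) auto
    interpret two_weight P N K h g Q R B
      by unfold_locales (use h g hg A2 Q R B in \<open>auto simp: B_def U_def\<close>)
    have "cmod (\<Sum>k\<in>R. L2_inner (\<lambda>x. ?d k * hf k x) p')
        \<le> (\<Sum>k\<in>R. cmod (L2_inner (\<lambda>x. ?d k * hf k x) p'))" by (rule norm_sum)
    also have "\<dots> \<le> (\<Sum>k\<in>R. s * (dominant h f k * dominant g f' k))"
    proof (rule sum_mono)
      fix k assume "k \<in> R"
      then have k: "k \<in> K" using R by auto
      have "cmod (L2_inner (\<lambda>x. ?d k * hf k x) p')
          = cmod (\<sigma> k) * (cmod (haar_at p k) * cmod (haar_at p' k))"
        by (simp add: L2_inner_cmult L2_inner_commute[of "hf k" p'] inner_hf[OF p'd(1) k] norm_mult)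
      also have "\<dots> \<le> s * (dominant h f k * dominant g f' k)"
        using pd(2)[OF k] p'd(2)[OF k] s[OF k] s0
        by (intro mult_mono) (auto intro: order_trans[OF norm_ge_zero])
      finally show "cmod (L2_inner (\<lambda>x. ?d k * hf k x) p') \<le> s * (dominant h f k * dominant g f' k)" .
    qed
    also have "\<dots> \<le> s * (500 * Q * (sqrt (mass (\<lambda>x. (cmod (f x))\<^sup>2) B)
        * sqrt (mass (\<lambda>x. (cmod (f' x))\<^sup>2) B)))"
      unfolding sum_distrib_left[symmetric]
      by (intro mult_left_mono sum_dominant L2_loc_cL2 fL2 s0)
    also have "\<dots> \<le> s * (500 * Q * (L2_norm f * L2_norm f'))"
      using mass_le_L2_norm[OF fL2(1) B] mass_le_L2_norm[OF fL2(2) B] Q s0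
      by (intro mult_left_mono mult_mono real_le_lsqrt) (auto simp: L2_norm_nonneg intro!: mass_nonneg)
    finally show ?thesis by (simp only: mult_ac)
  qed
  have "((\<lambda>R. \<Sum>k\<in>R. L2_inner (\<lambda>x. ?d k * hf k x) p')
      \<longlongrightarrow> L2_inner (L2_sum (\<lambda>k x. ?d k * hf k x) K) p') (finite_subsets_at_top K)"
    by (rule L2_has_sum_inner[OF hf.inner_L2_sum(1)[OF bd] p'd(1)])
  then show ?thesis
    by (rule Lim_norm_ubound[OF finite_subsets_at_top_neq_bot])
      (intro eventually_finite_subsets_at_top_weakI partial)
qed

end

section \<open>Dyadic cubes\<close>

text \<open>The closed cube with the corners of \<open>dyadic_cube k m\<close>, written in the exact
  shape that \<open>cubes\<close> asks for, so that the characteristic applies to it.\<close>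

definition cube_at :: "int \<Rightarrow> ('n \<Rightarrow> int) \<Rightarrow> (real^'n) set" where
  "cube_at k m = cbox (\<chi> i. 2 powi k * of_int (m i))
     (\<chi> i. (\<chi> i. 2 powi k * of_int (m i)) $ i + 2 powi k)"

lemma cube_at_cubes: "cube_at k m \<in> cubes"
  unfolding cubes_def cube_at_def by (intro CollectI exI conjI, rule refl) simp

lemma dyadic_cube_nonempty: "dyadic_cube k m \<noteq> {}"
proof -
  have "(\<chi> i. 2 powi k * of_int (m i)) \<in> dyadic_cube k m" by (simp add: dyadic_cube_def)
  then show ?thesis by blast
qed

lemma dyadic_subset_cube_at: "dyadic_cube k m \<subseteq> cube_at k m"
  by (auto simp: dyadic_cube_def cube_at_def mem_box_cart distrib_left less_imp_le)

lemma measure_cube_at: "vol (cube_at k m :: (real^'n) set) = (2 powi k) ^ CARD('n)"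
proof -
  have ne: "cube_at k m \<noteq> {}" using dyadic_subset_cube_at[of k m] dyadic_cube_nonempty[of k m] by blast
  have "vol (cube_at k m) = measure lborel (cube_at k m)"
    by (rule measure_completion) (simp add: cube_at_def)
  also have "\<dots> = (2 powi k) ^ CARD('n)"
    using content_cbox_cart[OF ne[unfolded cube_at_def]] by (simp add: cube_at_def)
  finally show ?thesis .
qed

text \<open>The half-open cube lies between an open box and its closure, whose difference is
  negligible.\<close>

lemma dyadic_cube_measure:
  fixes m :: "'n::finite \<Rightarrow> int"
  shows "dyadic_cube k m \<in> bsets" and "vol (dyadic_cube k m) = (2 powi k) ^ CARD('n)"
proof -
  define a :: "real^'n" where "a = (\<chi> i. 2 powi k * of_int (m i))"
  define b :: "real^'n" where "b = (\<chi> i. a $ i + 2 powi k)"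
  let ?D = "dyadic_cube k m"
  have c: "cube_at k m = cbox a b" unfolding cube_at_def a_def b_def by simp
  have sub: "box a b \<subseteq> ?D" "?D \<subseteq> cbox a b"
    using dyadic_subset_cube_at[of k m] unfolding c
    by (auto simp: dyadic_cube_def mem_box_cart a_def b_def distrib_left less_imp_le)
  have neg: "negligible (cbox a b - box a b)" by (rule negligible_frontier_interval)
  have n: "negligible (cbox a b - ?D)" by (rule negligible_subset[OF neg]) (use sub in auto)
  have sd: "negligible (cbox a b - ?D \<union> (?D - cbox a b))"
    using n sub(2) by (simp add: Diff_eq_empty_iff[THEN iffD2])
  have "?D \<in> sets lebesgue" by (rule sets_negligible_symdiff[OF _ sd]) simp
  moreover have "bounded ?D" using sub bounded_cbox bounded_subset by blast
  ultimately show "?D \<in> bsets" by (simp add: bsets_def)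
  have "vol ?D = vol (cbox a b)"
    by (rule measure_negligible_symdiff[OF _ sd]) simp
  then show "vol ?D = (2 powi k) ^ CARD('n)"
    using measure_cube_at[of k m] by (simp add: c)
qed

text \<open>A common point compares the integer corners on the finer scale \<open>t\<close>: strict
  inequalities between integers improve by one, which yields the inclusion.\<close>

lemma dyadic_nested:
  assumes "k \<le> k'" "dyadic_cube k m \<inter> dyadic_cube k' m' \<noteq> {}"
  shows "dyadic_cube k m \<subseteq> dyadic_cube k' m'"
proof -
  define j where "j = nat (k' - k)"
  define t :: real where "t = 2 powi k"
  have t: "t > 0" by (simp add: t_def)
  have k': "2 powi k' = t * 2 ^ j"
  proof -
    have "k' = k + int j" using assms(1) by (simp add: j_def)
    then show ?thesis by (simp add: t_def power_int_add)
  qed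
  obtain z where z: "\<And>i. t * of_int (m i) \<le> z $ i" "\<And>i. z $ i < t * (of_int (m i) + 1)"
    "\<And>i. t * 2 ^ j * of_int (m' i) \<le> z $ i" "\<And>i. z $ i < t * 2 ^ j * (of_int (m' i) + 1)"
    using assms(2) by (auto simp: dyadic_cube_def k' t_def)
  have a: "2 ^ j * m' i \<le> m i" for i
  proof -
    have "t * (2 ^ j * of_int (m' i)) < t * (of_int (m i) + 1)"
      using z(2,3)[of i] by (simp add: mult.assoc)
    then have "(2 ^ j * of_int (m' i) :: real) < of_int (m i) + 1" using t by simp
    then have "real_of_int (2 ^ j * m' i) < real_of_int (m i + 1)" by simp
    then show ?thesis by linarith
  qed
  have b: "m i + 1 \<le> 2 ^ j * (m' i + 1)" for i
  proof -
    have "t * of_int (m i) < t * (2 ^ j * (of_int (m' i) + 1))"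
      using z(1,4)[of i] by (simp only: mult.assoc)
    then have "(of_int (m i) :: real) < 2 ^ j * (of_int (m' i) + 1)" using t by simp
    then have "real_of_int (m i) < real_of_int (2 ^ j * (m' i + 1))" by simp
    then show ?thesis by linarith
  qed
  show ?thesis
  proof
    fix x assume x: "x \<in> dyadic_cube k m"
    show "x \<in> dyadic_cube k' m'"
      unfolding dyadic_cube_def k'
    proof (intro CollectI allI conjI)
      fix i
      have "t * real_of_int (2 ^ j * m' i) \<le> t * real_of_int (m i)"
        using a[of i] t by (intro mult_left_mono) (simp_all only: of_int_le_iff less_imp_le)
      also have "\<dots> \<le> x $ i" using x by (simp add: dyadic_cube_def t_def)
      finally show "t * 2 ^ j * of_int (m' i) \<le> x $ i" by (simp add: mult.assoc)
      have "x $ i < t * real_of_int (m i + 1)" using x by (simp add: dyadic_cube_def t_def)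
      also have "\<dots> \<le> t * real_of_int (2 ^ j * (m' i + 1))"
        using b[of i] t by (intro mult_left_mono) (simp_all only: of_int_le_iff less_imp_le)
      finally show "x $ i < t * 2 ^ j * (of_int (m' i) + 1)" by (simp add: mult.assoc)
    qed
  qed
qed

lemma dyadic_grid_nested:
  assumes "I \<in> dyadic_grid" "J \<in> dyadic_grid"
  shows "I \<subseteq> J \<or> J \<subseteq> I \<or> I \<inter> J = {}"
proof -
  obtain k m k' m' where "I = dyadic_cube k m" "J = dyadic_cube k' m'"
    using assms by (auto simp: dyadic_grid_def)
  then show ?thesis using dyadic_nested[of k k' m m'] dyadic_nested[of k' k m' m] linear[of k k'] by blast
qed

text \<open>A proper subcube belongs to a strictly finer generation, hence one at most as coarse as
  that of the children.\<close>

lemma child_contains_or_disjoint: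
  assumes "I \<in> dyadic_grid" "I \<subset> J" "J' \<in> children J"
  shows "I \<subseteq> J' \<or> I \<inter> J' = {}"
proof -
  obtain k m where I: "I = dyadic_cube k m" using assms by (auto simp: dyadic_grid_def)
  obtain k' m' m'' where J: "J = dyadic_cube k' m'" "J' = dyadic_cube (k' - 1) m''"
    using assms by (auto simp: children_def)
  have "k < k'"
  proof (rule ccontr)
    assume "\<not> k < k'"
    moreover have "I \<inter> J \<noteq> {}" using assms(2) dyadic_cube_nonempty[of k m] I by auto
    ultimately have "J \<subseteq> I" using dyadic_nested[of k' k m' m] I J by auto
    then show False using assms(2) by auto
  qed
  then show ?thesis using dyadic_nested[of k "k' - 1" m m''] I J by auto
qed

lemma child_measure:
  fixes I :: "(real^'n) set"
  assumes "J \<in> children I"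
  shows "vol I = 2 ^ CARD('n) * vol J" "0 < vol J" "J \<subseteq> I"
    "J \<in> bsets"
proof -
  obtain k m m' where J: "I = dyadic_cube k m" "J = dyadic_cube (k - 1) m'" "J \<subseteq> I"
    using assms by (auto simp: children_def)
  have "(2::real) powi k = 2 * 2 powi (k - 1)" by (simp add: power_int_diff)
  then show "vol I = 2 ^ CARD('n) * vol J" "0 < vol J"
    "J \<subseteq> I" "J \<in> bsets"
    using J by (simp_all add: dyadic_cube_measure power_mult_distrib)
qed

lemma countable_children: "countable (children (I :: (real^'n::finite) set))"
proof -
  have "countable (UNIV :: (int \<times> ('n \<Rightarrow> int)) set)" by simp
  then have "countable (range (\<lambda>(k, m). dyadic_cube k m :: (real^'n) set))" by simp
  then show ?thesis by (rule countable_subset[rotated]) (auto simp: children_def)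
qed

text \<open>A nonempty union contains a whole child, which already has the fraction
  \<open>2^-d\<close> of the volume of \<open>I\<close>. This is the source of the dimensional
  constant.\<close>

lemma children_Union:
  fixes I :: "(real^'n) set"
  assumes "C \<subseteq> children I" "C \<noteq> {}"
  shows "\<Union>C \<in> bsets" "\<Union>C \<subseteq> I" "vol I \<le> 2 ^ CARD('n) * vol (\<Union>C)"
    "0 < vol (\<Union>C)"
proof -
  obtain J where J: "J \<in> C" using assms(2) by auto
  then have Jc: "J \<in> children I" using assms(1) by auto
  then have Ib: "I \<in> bsets" by (auto simp: children_def dyadic_cube_measure)
  show sub: "\<Union>C \<subseteq> I" using assms(1) child_measure(3) by blast
  have "\<Union>C \<in> sets lebesgue"
    using assms(1) child_measure(4) countable_subset[OF assms(1) countable_children]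
    by (intro sets.countable_Union) (auto dest: bsets_sets)
  then show b: "\<Union>C \<in> bsets" using Ib sub by (auto simp: bsets_def intro: bounded_subset)
  have "vol J \<le> vol (\<Union>C)"
    using J child_measure(4)[OF Jc] b
    by (intro measure_mono_fmeasurable) (auto intro: bsets_sets bsets_lmeasurable)
  then show "vol I \<le> 2 ^ CARD('n) * vol (\<Union>C)"
    "0 < vol (\<Union>C)"
    using child_measure(1,2)[OF Jc] by (simp_all add: mult_left_mono)
qed

text \<open>Inside one cube the nesting is part of the definition. For nested cubes the smaller one
  lies in a single child of the larger, hence in one half of the larger support or outside it;
  disjoint cubes have disjoint supports. \<open>E 2\<close> is the positive half because
  \<open>haar\<close> is positive there.\<close>

lemma wilson_system_laminar:
  assumes "wilson_system (E :: 'n::finite haar_sets)"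
  shows "laminar (\<lambda>(I, \<alpha>). E 2 \<alpha> I) (\<lambda>(I, \<alpha>). E 1 \<alpha> I) (dyadic_grid \<times> Gamma)"
proof -
  note W = bspec[OF assms[unfolded wilson_system_def]]
  have eq: "vol (E 1 \<alpha> I) = vol (E 2 \<alpha> I)"
    if "I \<in> dyadic_grid" "\<alpha> \<in> Gamma" for I \<alpha>
    using bspec[OF conjunct1[OF W[OF that(1)]] that(2)] .
  have un: "\<exists>C. C \<subseteq> children I \<and> C \<noteq> {} \<and> E s \<alpha> I = \<Union>C"
    if "I \<in> dyadic_grid" "\<alpha> \<in> Gamma" "s \<in> {1, 2}" for I \<alpha> s
    using bspec[OF bspec[OF conjunct1[OF conjunct2[OF W[OF that(1)]]] that(2)] that(3)] .
  have dj: "E 1 \<alpha> I \<inter> E 2 \<alpha> I = {}" if "I \<in> dyadic_grid" "\<alpha> \<in> Gamma" for I \<alpha>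
    using bspec[OF conjunct1[OF conjunct2[OF conjunct2[OF W[OF that(1)]]]] that(2)] .
  have ne: "haar_supp E \<alpha> I \<subseteq> E 1 \<beta> I \<or> haar_supp E \<alpha> I \<subseteq> E 2 \<beta> I \<or>
        haar_supp E \<beta> I \<subseteq> E 1 \<alpha> I \<or> haar_supp E \<beta> I \<subseteq> E 2 \<alpha> I \<or>
        haar_supp E \<alpha> I \<inter> haar_supp E \<beta> I = {}"
    if "I \<in> dyadic_grid" "\<alpha> \<in> Gamma" "\<beta> \<in> Gamma" "\<alpha> \<noteq> \<beta>" for I \<alpha> \<beta>
    using mp[OF bspec[OF bspec[OF conjunct2[OF conjunct2[OF conjunct2[OF W[OF that(1)]]]] that(2)]
          that(3)] that(4)] .
  have E: "E s \<alpha> I \<in> bsets" "E s \<alpha> I \<subseteq> I" "0 < vol (E s \<alpha> I)"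
    if asm: "I \<in> dyadic_grid" "\<alpha> \<in> Gamma" "s \<in> {1, 2}" for I \<alpha> s
  proof -
    obtain C where C: "C \<subseteq> children I" "C \<noteq> {}" "E s \<alpha> I = \<Union>C" using un[OF asm] by blast
    show "E s \<alpha> I \<in> bsets" "E s \<alpha> I \<subseteq> I" "0 < vol (E s \<alpha> I)"
      unfolding C(3) by (rule children_Union[OF C(1,2)])+
  qed
  have supp: "haar_supp E \<alpha> I \<subseteq> I" if "I \<in> dyadic_grid" "\<alpha> \<in> Gamma" for I \<alpha>
    using E(2)[OF that, of 1] E(2)[OF that, of 2] by (auto simp: haar_supp_def)
  have sub: "haar_supp E \<alpha> I \<subseteq> E 2 \<beta> J \<or> haar_supp E \<alpha> I \<subseteq> E 1 \<beta> J \<or>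
      haar_supp E \<alpha> I \<inter> haar_supp E \<beta> J = {}"
    if I: "I \<in> dyadic_grid" "\<alpha> \<in> Gamma" and J: "J \<in> dyadic_grid" "\<beta> \<in> Gamma" and IJ: "I \<subset> J"
    for I J \<alpha> \<beta>
  proof -
    have "I \<subseteq> E s \<beta> J \<or> I \<inter> E s \<beta> J = {}" if s: "s \<in> {1, 2}" for s
    proof -
      obtain C where C: "C \<subseteq> children J" "E s \<beta> J = \<Union>C" using un[OF J s] by blast
      show ?thesis
      proof (cases "I \<inter> \<Union>C = {}")
        case False
        then obtain J' where J': "J' \<in> C" "I \<inter> J' \<noteq> {}" by auto
        then have "I \<subseteq> J'" using child_contains_or_disjoint[OF I(1) IJ, of J'] C(1) by auto
        then show ?thesis using J' C(2) by auto
      qed (use C in auto)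
    qed
    from this[of 1] this[of 2] show ?thesis
      using supp[OF I] unfolding haar_supp_def[of E \<beta> J] by blast
  qed
  have nest: "haar_supp E \<alpha> I \<subseteq> E 2 \<beta> J \<or> haar_supp E \<alpha> I \<subseteq> E 1 \<beta> J \<or>
      haar_supp E \<beta> J \<subseteq> E 2 \<alpha> I \<or> haar_supp E \<beta> J \<subseteq> E 1 \<alpha> I \<or>
      haar_supp E \<alpha> I \<inter> haar_supp E \<beta> J = {}"
    if I: "I \<in> dyadic_grid" "\<alpha> \<in> Gamma" and J: "J \<in> dyadic_grid" "\<beta> \<in> Gamma"
      and neq: "(I, \<alpha>) \<noteq> (J, \<beta>)" for I \<alpha> J \<beta>
  proof (cases "I = J")
    case True
    then show ?thesis using ne[OF I J(2)] neq by blast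
  next
    case False
    then consider "I \<subset> J" | "J \<subset> I" | "I \<inter> J = {}"
      using dyadic_grid_nested[OF I(1) J(1)] by blast
    then show ?thesis
    proof cases
      case 1
      then show ?thesis using sub[OF I J 1] by blast
    next
      case 2
      then show ?thesis using sub[OF J I 2] by blast
    next
      case 3
      then show ?thesis using supp[OF I] supp[OF J] by blast
    qed
  qed
  have U: "E 2 \<alpha> I \<union> E 1 \<alpha> I = haar_supp E \<alpha> I" for \<alpha> I by (auto simp: haar_supp_def)
  define P where "P = (\<lambda>(I, \<alpha>). E 2 \<alpha> I)"
  define N where "N = (\<lambda>(I, \<alpha>). E 1 \<alpha> I)"
  have PN: "P (I, \<alpha>) = E 2 \<alpha> I" "N (I, \<alpha>) = E 1 \<alpha> I" for I \<alpha> by (simp_all add: P_def N_def)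
  have "laminar P N (dyadic_grid \<times> Gamma)"
  proof
    fix k l :: "(real^'n) set \<times> ('n \<Rightarrow> bool)"
    assume "k \<in> dyadic_grid \<times> Gamma" "l \<in> dyadic_grid \<times> Gamma" "k \<noteq> l"
    then show "P k \<union> N k \<subseteq> P l \<or> P k \<union> N k \<subseteq> N l \<or> P l \<union> N l \<subseteq> P k \<or> P l \<union> N l \<subseteq> N k \<or>
        (P k \<union> N k) \<inter> (P l \<union> N l) = {}"
      by (cases k, cases l) (simp only: PN U mem_Sigma_iff, rule nest, auto)
  next
    fix k :: "(real^'n) set \<times> ('n \<Rightarrow> bool)" assume k: "k \<in> dyadic_grid \<times> Gamma"
    obtain I \<alpha> where k': "k = (I, \<alpha>)" "I \<in> dyadic_grid" "\<alpha> \<in> Gamma" using k by (cases k) auto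
    show "P k \<in> bsets" "N k \<in> bsets" "0 < vol (P k)" "vol (P k) = vol (N k)" "P k \<inter> N k = {}"
      unfolding k'(1) PN using E[OF k'(2,3)] eq[OF k'(2,3)] dj[OF k'(2,3)] by auto
  qed
  then show ?thesis by (simp only: P_def N_def)
qed

lemma measure_dyadic_le_haar_supp:
  assumes "wilson_system (E :: 'n::finite haar_sets)" "I \<in> dyadic_grid" "\<alpha> \<in> Gamma"
  shows "haar_supp E \<alpha> I \<subseteq> I" and "vol I \<le> 2 ^ CARD('n) * vol (haar_supp E \<alpha> I)"
proof -
  note W = bspec[OF conjunct1[OF conjunct2[OF bspec[OF assms(1)[unfolded wilson_system_def] assms(2)]]] assms(3)]
  obtain C1 where C1: "C1 \<subseteq> children I" "C1 \<noteq> {}" "E 1 \<alpha> I = \<Union>C1"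
    using bspec[OF W, of 1] by blast
  obtain C2 where C2: "C2 \<subseteq> children I" "C2 \<noteq> {}" "E 2 \<alpha> I = \<Union>C2"
    using bspec[OF W, of 2] by blast
  note C = C1 C2
  have e: "haar_supp E \<alpha> I = \<Union>(C1 \<union> C2)" using C by (auto simp: haar_supp_def)
  show "haar_supp E \<alpha> I \<subseteq> I" "vol I \<le> 2 ^ CARD('n) * vol (haar_supp E \<alpha> I)"
    unfolding e using C by (intro children_Union; auto)+
qed
section \<open>\<open>A\<^sub>2\<close> weights and the theorem\<close>

lemma nn_integral_mass:
  assumes "set_integrable lebesgue A f" "\<And>x. 0 \<le> f x"
  shows "(\<integral>\<^sup>+x\<in>A. ennreal (f x) \<partial>lebesgue) = ennreal (mass f A)"
proof -
  have "(\<integral>\<^sup>+x\<in>A. ennreal (f x) \<partial>lebesgue) = (\<integral>\<^sup>+x. ennreal (indicat_real A x *\<^sub>R f x) \<partial>lebesgue)"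
    by (intro nn_integral_cong) (auto simp: indicator_def)
  also have "\<dots> = ennreal (mass f A)"
    unfolding set_lebesgue_integral_def using assms
    by (intro nn_integral_eq_integral) (auto simp: set_integrable_def)
  finally show ?thesis .
qed

lemma cubes_props:
  assumes "c \<in> cubes"
  shows "c \<in> bsets" "emeasure lebesgue c = ennreal (vol c)" "0 < vol c"
proof -
  obtain a l where c: "c = cbox a (\<chi> i. a $ i + l)" "0 < l" using assms by (auto simp: cubes_def)
  show b: "c \<in> bsets" by (simp add: bsets_def c)
  show "emeasure lebesgue c = ennreal (vol c)"
    using bsets_lmeasurable[OF b] by (simp add: emeasure_eq_measure2)
  have ne: "cbox a (\<chi> i. a $ i + l) \<noteq> {}" using c(2) by (simp add: interval_ne_empty_cart less_imp_le)
  have "vol c = measure lborel c" unfolding c(1) by (rule measure_completion) simp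
  then show "0 < vol c" using content_cbox_cart[OF ne] c by simp
qed

text \<open>The product of the two averages is finite and the average of \<open>w\<close> is
  positive, so the average of the reciprocal is finite.\<close>

lemma A2_weight_inverse_integrable:
  assumes w: "A2_weight w" and c: "c \<in> cubes"
  shows "set_integrable lebesgue c (\<lambda>x. inverse (w x))"
proof -
  have wp: "0 < w x" for x using w by (simp add: A2_weight_def weight_def)
  have wn: "0 \<le> w x" for x using wp[of x] by simp
  have wl: "locally_integrable w" using w by (simp add: A2_weight_def weight_def)
  have wm[measurable]: "w \<in> borel_measurable lebesgue" using wl by (simp add: locally_integrable_def)
  note cp = cubes_props[OF c]
  have cs[measurable]: "c \<in> sets lebesgue" by (rule bsets_sets[OF cp(1)])
  define Y where "Y = (\<integral>\<^sup>+x\<in>c. ennreal (inverse (w x)) \<partial>lebesgue)"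
  define X where "X = (\<integral>\<^sup>+x\<in>c. ennreal (w x) \<partial>lebesgue)"
  define e where "e = emeasure lebesgue c"
  have X: "X = ennreal (mass w c)"
    unfolding X_def using locally_integrable_set[OF wl cp(1)] wn by (intro nn_integral_mass) auto
  have X0: "X \<noteq> 0" unfolding X using mass_pos[OF wl cp(1) wp cp(3)] by simp
  have e: "e \<noteq> 0" "e \<noteq> top" unfolding e_def cp(2) using cp(3) by auto
  have "X / e * (Y / e) \<le> A2_char w"
    unfolding A2_char_def X_def Y_def e_def nn_average_def[symmetric] by (rule SUP_upper[OF c])
  also have "\<dots> < \<infinity>" using w by (simp add: A2_weight_def)
  finally have "X / e * (Y / e) \<noteq> top" by (auto simp: infinity_ennreal_def)
  \<comment> \<open>A vanishing factor would hide an infinite one, since \<open>0 * top\<close> is 0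
    in the extended reals.\<close>
  moreover have "X / e \<noteq> 0" using X0 e by (simp add: ennreal_divide_eq_0_iff)
  ultimately have "Y / e \<noteq> top" by (auto simp: ennreal_mult_eq_top_iff)
  then have Y: "Y \<noteq> top" using e by (auto simp: ennreal_divide_eq_top_iff)
  have "(\<integral>\<^sup>+x. ennreal (norm (indicat_real c x *\<^sub>R inverse (w x))) \<partial>lebesgue) = Y"
    unfolding Y_def using wn
    by (intro nn_integral_cong) (auto simp: indicator_def)
  moreover have "Y < \<infinity>" using Y by (simp only: infinity_ennreal_def less_top)
  ultimately show ?thesis
    unfolding set_integrable_def by (intro integrableI_bounded) simp_all
qed

lemma A2_weight_inverse:
  assumes w: "A2_weight w"
  shows "locally_integrable (\<lambda>x. inverse (w x))"
  unfolding locally_integrable_def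
proof (intro conjI allI impI)
  have wm[measurable]: "w \<in> borel_measurable lebesgue"
    using w by (simp add: A2_weight_def weight_def locally_integrable_def)
  show "(\<lambda>x. inverse (w x)) \<in> borel_measurable lebesgue" by measurable
  fix K :: "(real^'a) set" assume K: "compact K"
  obtain r where r: "0 < r" "\<And>x. x \<in> K \<Longrightarrow> norm x \<le> r"
    using iffD1[OF bounded_pos compact_imp_bounded[OF K]] by blast
  define c :: "(real^'a) set" where "c = cbox (\<chi> i. - r) (\<chi> i. (\<chi> i. - r) $ i + 2 * r)"
  have c: "c \<in> cubes"
    unfolding cubes_def c_def by (intro CollectI exI conjI, rule refl) (use r(1) in simp)
  have "K \<subseteq> c"
  proof
    fix x assume "x \<in> K"
    then have "\<bar>x $ i\<bar> \<le> r" for i using r(2)[of x] component_le_norm_cart[of x i] by linarith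
    then have b: "\<bar>x $ i\<bar> \<le> r" for i .
    have "- r \<le> x $ i" "x $ i \<le> r" for i using b[of i] by linarith+
    then show "x \<in> c" by (simp add: c_def mem_box_cart)
  qed
  then show "set_integrable lebesgue K (\<lambda>x. inverse (w x))"
    using K by (intro set_integrable_subset[OF A2_weight_inverse_integrable[OF w c]])
      (simp_all add: compact_imp_closed)
qed

lemma A2_weight_cube_bound:
  assumes w: "A2_weight w" and c: "c \<in> cubes"
  shows "mass (\<lambda>x. inverse (w x)) c * mass w c \<le> enn2real (A2_char w) * (vol c)\<^sup>2"
proof -
  have wp: "0 < w x" for x using w by (simp add: A2_weight_def weight_def)
  have wn: "0 \<le> w x" for x using wp[of x] by simp
  have wl: "locally_integrable w" using w by (simp add: A2_weight_def weight_def)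
  note cp = cubes_props[OF c]
  define M where "M = vol c"
  have M: "0 < M" using cp(3) by (simp add: M_def)
  have nn: "0 \<le> mass w c" "0 \<le> mass (\<lambda>x. inverse (w x)) c"
    using wn by (auto intro!: mass_nonneg)
  have em: "ennreal (mass w c / M * (mass (\<lambda>x. inverse (w x)) c / M))
      = ennreal (mass w c / M) * ennreal (mass (\<lambda>x. inverse (w x)) c / M)"
    by (rule ennreal_mult) (use nn M in simp_all)
  have "nn_average c w = ennreal (mass w c / M)"
    unfolding nn_average_def cp(2) M_def[symmetric]
    using locally_integrable_set[OF wl cp(1)] wn nn M
    by (subst nn_integral_mass) (auto simp: divide_ennreal)
  moreover have "nn_average c (\<lambda>x. inverse (w x)) = ennreal (mass (\<lambda>x. inverse (w x)) c / M)"
    unfolding nn_average_def cp(2) M_def[symmetric]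
    using A2_weight_inverse_integrable[OF w c] wn nn M
    by (subst nn_integral_mass) (auto simp: divide_ennreal)
  moreover have "nn_average c w * nn_average c (\<lambda>x. inverse (w x)) \<le> A2_char w"
    unfolding A2_char_def by (rule SUP_upper[OF c])
  ultimately have "ennreal (mass w c / M * (mass (\<lambda>x. inverse (w x)) c / M)) \<le> A2_char w"
    by (simp only: em)
  moreover have "A2_char w < top" using w by (simp add: A2_weight_def)
  ultimately have "enn2real (ennreal (mass w c / M * (mass (\<lambda>x. inverse (w x)) c / M))) \<le> enn2real (A2_char w)"
    by (rule enn2real_mono)
  then have "mass w c / M * (mass (\<lambda>x. inverse (w x)) c / M) \<le> enn2real (A2_char w)"
    using nn M by (subst (asm) enn2real_ennreal) auto
  then show ?thesis
    unfolding M_def[symmetric] using M by (simp add: field_simps power2_eq_square)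
qed

text \<open>The characteristic only sees cubes, while the supports are unions of children. Each mass
  is enlarged to the surrounding cube, and normalising two masses by the smaller volume costs
  \<open>2^d\<close> twice.\<close>

lemma A2_weight_dyadic_bound:
  fixes w :: "real^'n \<Rightarrow> real"
  assumes w: "A2_weight w" and I: "I \<in> dyadic_grid" and A: "A \<in> bsets" "A \<subseteq> I"
    "vol I \<le> 2 ^ CARD('n) * vol A"
  shows "mass (\<lambda>x. inverse (w x)) A * mass w A
    \<le> 4 ^ CARD('n) * enn2real (A2_char w) * (vol A)\<^sup>2"
proof -
  have wp: "0 < w x" for x using w by (simp add: A2_weight_def weight_def)
  have wn: "0 \<le> w x" for x using wp[of x] by simp
  have wl: "locally_integrable w" using w by (simp add: A2_weight_def weight_def)
  obtain k m where km: "I = dyadic_cube k m" using I by (auto simp: dyadic_grid_def)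
  let ?c = "cube_at k m"
  have c: "?c \<in> cubes" by (rule cube_at_cubes)
  have Ac: "A \<subseteq> ?c" using A(2) dyadic_subset_cube_at[of k m] km by auto
  have mc: "vol ?c = vol I"
    unfolding km measure_cube_at dyadic_cube_measure(2) ..
  note cb = cubes_props(1)[OF c]
  have "mass (\<lambda>x. inverse (w x)) A * mass w A \<le> mass (\<lambda>x. inverse (w x)) ?c * mass w ?c"
    using wn A(1) cb Ac wl A2_weight_inverse[OF w]
    by (intro mult_mono mass_mono_set mass_nonneg) auto
  also have "\<dots> \<le> enn2real (A2_char w) * (vol I)\<^sup>2"
    using A2_weight_cube_bound[OF w c] by (simp only: mc)
  also have "\<dots> \<le> enn2real (A2_char w) * (2 ^ CARD('n) * vol A)\<^sup>2"
    using A(3) by (intro mult_left_mono power_mono) auto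
  also have "\<dots> = 4 ^ CARD('n) * enn2real (A2_char w) * (vol A)\<^sup>2"
  proof -
    have "((2::real) ^ CARD('n))\<^sup>2 = (2\<^sup>2) ^ CARD('n)" by (simp only: power_mult[symmetric] mult.commute)
    then show ?thesis by (simp add: power_mult_distrib)
  qed
  finally show ?thesis .
qed

lemma Q_form_bound:
  fixes E :: "'n::finite haar_sets"
  assumes E: "wilson_system E" and \<sigma>: "symbol_bounded \<sigma>" and w: "A2_weight w"
    and e: "e \<in> para_types" and e': "e' \<in> para_types"
    and \<phi>: "\<phi> \<in> haar_polys E" and \<psi>: "\<psi> \<in> haar_polys E"
  shows "cmod (Q_form E \<sigma> w e e' \<phi> \<psi>)
    \<le> 500 * (4 ^ CARD('n) * enn2real (A2_char w)) * symbol_norm \<sigma> * (L2_norm \<phi> * L2_norm \<psi>)"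
proof -
  let ?K = "dyadic_grid \<times> Gamma :: ((real^'n) set \<times> ('n \<Rightarrow> bool)) set"
  define P where "P = (\<lambda>(I, \<alpha>). E 2 \<alpha> I)"
  define N where "N = (\<lambda>(I, \<alpha>). E 1 \<alpha> I)"
  interpret laminar P N ?K
    unfolding P_def N_def by (rule wilson_system_laminar[OF E])
  have U: "haar_supp E \<alpha> I = U (I, \<alpha>)" for I \<alpha> unfolding haar_supp_def U_def unfolding P_def N_def prod.case by (rule Un_commute)
  have hf: "haar E I \<alpha> = hf (I, \<alpha>)" for I \<alpha>
  proof
    fix x
    have pw: "m powr (- 1/2) = 1 / sqrt m" if "0 \<le> m" for m :: real
      using that by (simp add: powr_minus_divide powr_half_sqrt)
    have PN: "P (I, \<alpha>) = E 2 \<alpha> I" "N (I, \<alpha>) = E 1 \<alpha> I" by (simp_all add: P_def N_def)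
    show "haar E I \<alpha> x = hf (I, \<alpha>) x"
      unfolding haar_def hf_def PN U pw[OF measure_nonneg] by simp
  qed
  have coeff: "haar_coeff E f I \<alpha> = haar_at f (I, \<alpha>)"
    if "locally_cintegrable f" "(I, \<alpha>) \<in> ?K" for f I \<alpha>
    unfolding haar_coeff_def hf by (rule integral_mult_hf[OF that])
  have avg: "average (haar_supp E \<alpha> I) f = cav f (I, \<alpha>)" for f I \<alpha>
    by (simp add: average_def cav_def U)
  have cav_real: "cav (\<lambda>x. of_real (u x)) k = of_real (av u k)" for u k
    by (simp add: cav_def av_def cmass_of_real)
  have wp: "0 < w x" for x using w by (simp add: A2_weight_def weight_def)
  have wn: "0 \<le> w x" for x using wp[of x] by simp
  have wl: "locally_integrable w" using w by (simp add: A2_weight_def weight_def)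
  define h where "h x = w x powr (- 1/2)" for x
  define g where "g x = w x powr (1/2)" for x
  have h2: "(h x)\<^sup>2 = inverse (w x)" and g2: "(g x)\<^sup>2 = w x" and hg: "h x * g x = 1"
    and hpos: "0 < h x" and gpos: "0 < g x" for x
    unfolding h_def g_def power2_eq_square powr_add[symmetric]
    using wp[of x] less_imp_neq[OF wp[of x]] by (simp_all add: powr_minus)
  have [measurable]: "w \<in> borel_measurable lebesgue" using wl by (simp add: locally_integrable_def)
  have hL: "loc_L2 h" unfolding loc_L2_def h2 using A2_weight_inverse[OF w] by (simp add: h_def[abs_def])
  have gL: "loc_L2 g" unfolding loc_L2_def g2 using wl by (simp add: g_def[abs_def])
  have poly: "\<exists>S c. finite S \<and> S \<subseteq> ?K \<and> f = (\<lambda>x. \<Sum>k\<in>S. c k * hf k x)"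
    if f: "f \<in> haar_polys E" for f
  proof -
    obtain S c where S: "finite S" "S \<subseteq> ?K" "f = (\<lambda>x. \<Sum>(I, \<alpha>)\<in>S. c I \<alpha> * haar E I \<alpha> x)"
      using f unfolding haar_polys_def by blast
    show ?thesis
      by (intro exI[of _ S] exI[of _ "\<lambda>(I, \<alpha>). c I \<alpha>"] conjI S(1,2))
        (unfold S(3) hf, simp add: case_prod_beta)
  qed
  obtain S c where S: "finite S" "S \<subseteq> ?K" "\<phi> = (\<lambda>x. \<Sum>k\<in>S. c k * hf k x)" using poly[OF \<phi>] by blast
  obtain S' c' where S': "finite S'" "S' \<subseteq> ?K" "\<psi> = (\<lambda>x. \<Sum>k\<in>S'. c' k * hf k x)" using poly[OF \<psi>] by blast
  have para: "para E e u f \<in> para_sums u f"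
    if e: "e \<in> para_types" and u: "loc_L2 u" and f: "f \<in> L2" for e u f
  proof -
    have uc: "locally_cintegrable (\<lambda>x. of_real (u x))"
      using loc_cL2_mult_real[OF _ u, of "\<lambda>x. 1"] loc_L2_one by (simp add: loc_cL2_def)
    have fc: "locally_cintegrable f" by (rule loc_cL2_locally_cintegrable[OF L2_loc_cL2[OF f]])
    have a: "para E (0, 0) u f = L2_sum (\<lambda>k x. of_real (av u k) * haar_at f k * hf k x) ?K"
      unfolding para_def para00_def
      by (simp, rule L2_sum_cong) (auto simp: avg cav_real hf coeff[OF fc])
    have b: "para E (0, 1) u f = L2_sum (\<lambda>k x. haar_at (\<lambda>x. of_real (u x)) k * cav f k * hf k x) ?K"
      unfolding para_def para01_def
      by (simp, rule L2_sum_cong) (auto simp: avg hf coeff[OF uc])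
    have c: "para E (1, 0) u f
        = L2_sum (\<lambda>k x. haar_at (\<lambda>x. of_real (u x)) k * haar_at f k * haar1 (U k) x) ?K"
      unfolding para_def para10_def
      by (simp, rule L2_sum_cong) (auto simp: U coeff[OF uc] coeff[OF fc])
    from e consider "e = (0, 0)" | "e = (0, 1)" | "e = (1, 0)" by (auto simp: para_types_def)
    then show ?thesis by cases (simp_all only: a b c para_sums_def insert_iff simp_thms)
  qed
  have L2: "\<phi> \<in> L2" "\<psi> \<in> L2" unfolding S(3) S'(3) by (intro hf.comb_L2 S(1,2) S'(1,2))+
  \<comment> \<open>The formal adjoint of the outer paraproduct is again one of the three types, now
    for \<open>g\<close>.\<close>
  have sw: "prod.swap e \<in> para_types" using e by (auto simp: para_types_def)
  define p where "p = para E e' h \<phi>"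
  define p' where "p' = para E (prod.swap e) g \<psi>"
  have p: "p \<in> para_sums h \<phi>" and p': "p' \<in> para_sums g \<psi>"
    unfolding p_def p'_def by (intro para e' sw hL gL L2)+
  have pc: "locally_cintegrable p"
    by (rule loc_cL2_locally_cintegrable[OF L2_loc_cL2[OF para_sums_dominated(1)[OF hL hpos S p]]])
  have mult: "haar_multiplier E \<sigma> p = L2_sum (\<lambda>k x. (case k of (I, \<alpha>) \<Rightarrow> \<sigma> I \<alpha>) * haar_at p k * hf k x) ?K"
    unfolding haar_multiplier_def by (rule L2_sum_cong) (auto simp: hf coeff[OF pc])
  have ne: "?K \<noteq> {}"
  proof -
    have "dyadic_cube 0 (\<lambda>_. 0) \<in> dyadic_grid" by (auto simp: dyadic_grid_def)
    moreover have "(\<lambda>_. False) \<in> Gamma" by (auto simp: Gamma_def fun_eq_iff)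
    ultimately show ?thesis by blast
  qed
  have "cmod (L2_inner (L2_sum (\<lambda>k x. (case k of (I, \<alpha>) \<Rightarrow> \<sigma> I \<alpha>) * haar_at p k * hf k x) ?K) p')
    \<le> 500 * (4 ^ CARD('n) * enn2real (A2_char w)) * symbol_norm \<sigma> * (L2_norm \<phi> * L2_norm \<psi>)"
  proof (rule multiplier_form_bound[OF hL hpos gL gpos hg _ S S' p p' _ ne])
    fix k assume k: "k \<in> ?K"
    obtain I \<alpha> where I: "k = (I, \<alpha>)" "I \<in> dyadic_grid" "\<alpha> \<in> Gamma" using k by auto
    have "cmod (\<sigma> I \<alpha>) \<in> (\<lambda>(I, \<alpha>). cmod (\<sigma> I \<alpha>)) ` ?K" using I by force
    then show "cmod (case k of (I, \<alpha>) \<Rightarrow> \<sigma> I \<alpha>) \<le> symbol_norm \<sigma>"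
      unfolding symbol_norm_def I(1) using \<sigma>[unfolded symbol_bounded_def]
      by (simp only: prod.case) (rule cSup_upper)
    have "mass (\<lambda>x. inverse (w x)) (U k) * mass w (U k)
        \<le> 4 ^ CARD('n) * enn2real (A2_char w) * (vol (U k))\<^sup>2"
      using measure_dyadic_le_haar_supp[OF E I(2,3)] U_bsets[OF k] I(1)
      by (intro A2_weight_dyadic_bound[OF w I(2)]) (auto simp: U)
    then show "av (sq h) k * av (sq g) k \<le> 4 ^ CARD('n) * enn2real (A2_char w)"
      unfolding h2 g2 av_def using U_pos[OF k] by (simp add: field_simps power2_eq_square)
  qed
  then show ?thesis
    unfolding Q_form_def h_def[symmetric, abs_def] g_def[symmetric, abs_def] p_def[symmetric]
      p'_def[symmetric] mult .
qed

theorem theorem1p2: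
  shows "\<exists>c::real. \<forall>(E :: 'n::finite haar_sets) \<sigma> w.
    wilson_system E \<longrightarrow> symbol_bounded \<sigma> \<longrightarrow> A2_weight w \<longrightarrow>
    (\<forall>e\<in>para_types. \<forall>e'\<in>para_types. \<forall>\<phi>\<in>haar_polys E. \<forall>\<psi>\<in>haar_polys E.
       cmod (Q_form E \<sigma> w e e' \<phi> \<psi>)
         \<le> c * enn2real (A2_char w) * symbol_norm \<sigma> * L2_norm \<phi> * L2_norm \<psi>)"
\<comment> \<open>The factor 500 is the bound for the nine sums, and the power of 4 is the cost of
  passing from supports to cubes.\<close>
proof (intro exI[of _ "500 * 4 ^ CARD('n)"] allI impI ballI)
  fix E :: "'n haar_sets" and \<sigma> :: "(real^'n) set \<Rightarrow> ('n \<Rightarrow> bool) \<Rightarrow> complex"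
    and w :: "real^'n \<Rightarrow> real" and e e' and \<phi> \<psi> :: "real^'n \<Rightarrow> complex"
  assume "wilson_system E" "symbol_bounded \<sigma>" "A2_weight w" "e \<in> para_types" "e' \<in> para_types"
    "\<phi> \<in> haar_polys E" "\<psi> \<in> haar_polys E"
  from Q_form_bound[OF this] show "cmod (Q_form E \<sigma> w e e' \<phi> \<psi>)
    \<le> 500 * 4 ^ CARD('n) * enn2real (A2_char w) * symbol_norm \<sigma> * L2_norm \<phi> * L2_norm \<psi>"
    by (simp only: mult.assoc)
qed

end
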